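(* Let $n \in (0,d]$, let $\mu$ be a measure of order $n$ on $\mathbb{R}^d$ and let $T$ be an $n$-dimensional SIO with kernel $K$. Let $b$ and $t$ be large enough constants (depending only on $d$). Suppose $Q \subset \mathbb{R}^d$ is a fixed cube, $p, q \in (1,2]$ and $\delta > 0$. Assume that there exists an $L^p(\mu)$-admissible test function $b_Q$ in $Q$ (with constant $B_1$) so that $$\int_Q |T_{\mu, \delta} b_Q|^{q'}\,d\mu \lesssim \mu(Q).$$ Furthermore, assume that for every $(5,b)$-doubling cube $R \subset Q$ with $t$-small boundary (both with respect to $\mu$) there exists an $L^q(\mu)$-admissible test function $p_R$ in $R$ (with constant $B_1$) so that $$\int_R |T_{\mu, \delta}^*p_R|^{p'}\,d\mu \lesssim \mu(R) \quad \text{if } \frac1p+\frac1q < 1+\frac1{np},$$ $$\int_{2R} |T_{\mu, \delta}^*p_R|^{p'}\,d\mu \lesssim \mu(R) \quad \text{otherwise}.$$ Then for every $\tau \in (0,1)$, every $\epsilon > \delta$ and every $x \in (1-\tau)Q$ we have $$|T_{\mu, \epsilon}b_Q(x)| \lesssim_{\tau} M_{\mu}b_Q(x) + M^{\mathcal{Q}}_{\mu, p} b_Q(x) + M^{\mathcal{Q}}_{\mu, q'}(1_QT_{\mu, \delta}b_Q)(x).$$ Here the implicit constant in the conclusion may depend on $\tau$, $d$, $n$, $p$, $q$, $b$, $t$, $B_1$, the growth constant $C_0$ of $\mu$, the kernel constants $C,\alpha$ and the implicit constants in the hypotheses, but not on $Q$, $\delta$, $\epsilon$ or $x$.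
   Context: Cubes have sides parallel to the axes; $\ell(Q)$ is the side length of $Q$, and $aQ$ is the cube concentric with $Q$ with diameter $a\operatorname{diam}(Q)$. $p',q'$ are the conjugate exponents of $p,q$. $A\lesssim B$ means $A\le CB$ for some constant $C>0$. A Radon measure $\mu$ on $\mathbb{R}^d$ is of order (degree) $n\in(0,d]$ if for some $C_0<\infty$, $\mu(B(x,r))\le C_0 r^n$ for all $x\in\mathbb{R}^d$, $r>0$. A function $b_Q$ is an $L^p(\mu)$-admissible test function in a cube $Q$ with constant $B_1$ if $\operatorname{spt} b_Q\subset Q$, $\mu(Q)=\int_Q b_Q\,d\mu$, and $\int_Q|b_Q|^p\,d\mu\le B_1\mu(Q)$. All test functions have the same constant $B_1$. An $n$-dimensional Calderón–Zygmund kernel is a function $K:\mathbb{R}^d\times\mathbb{R}^d\setminus\{x=y\}\to\mathbb{C}$ such that for some $C<\infty$, $\alpha\in(0,1]$: $|K(x,y)|\le C|x-y|^{-n}$ for $x\ne y$; $|K(x,y)-K(x',y)|\le C|x-x'|^\alpha|x-y|^{-n-\alpha}$ if $|x-y|\ge2|x-x'|$; $|K(x,y)-K(x,y')|\le C|y-y'|^\alpha|x-y|^{-n-\alpha}$ if $|x-y|\ge2|y-y'|$. The $n$-dimensional SIO $T$ with kernel $K$ is given by $T\nu(x)=\int K(x,y)\,d\nu(y)$ for (complex) Radon measures $\nu$ and $x\notin\operatorname{spt}\nu$. Its truncations are, for $\epsilon>0$, $$T_{\mu,\epsilon}f(x)=\int_{|x-y|>\epsilon}K(x,y)f(y)\,d\mu(y),\qquad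 x\in\mathbb{R}^d,$$ and $T^*_{\mu,\epsilon}f(x)=\int_{|x-y|>\epsilon}K(y,x)f(y)\,d\mu(y)$ (the adjoint truncations). Maximal functions: with $B(x,r)$ balls and $Q(x,r)$ cubes centred at $x$ (of size $r$), $$M_\mu f(x)=\sup_{r>0}\frac{1}{\mu(B(x,r))}\int_{B(x,r)}|f|\,d\mu,\qquad M^{\mathcal Q}_\mu f(x)=\sup_{r>0}\frac{1}{\mu(Q(x,r))}\int_{Q(x,r)}|f|\,d\mu,$$ and $M^{\mathcal Q}_{\mu,s}f=\big(M^{\mathcal Q}_\mu(|f|^s)\big)^{1/s}$. Quotients $0/0$ are read as $0$. A cube $Q$ is $(a,b)$-doubling (with respect to $\mu$) if $\mu(aQ)\le b\,\mu(Q)$. A cube $Q$ has $t$-small boundary with respect to $\mu$ if $\mu(\{x\in5Q:\operatorname{dist}(x,\partial Q)\le\lambda\ell(Q)\})\le t\lambda\mu(5Q)$ for every $\lambda>0$. *)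

theory Defs
  imports "HOL-Analysis.Analysis"
begin

text \<open>
  A cube is given by its centre \<open>c\<close> and its side length \<open>l\<close>, so that \<open>aQ\<close> is
  \<open>cube c (a * l)\<close>. Cubes are closed.
\<close>

definition cube :: "real ^ 'd \<Rightarrow> real \<Rightarrow> (real ^ 'd) set" where
  "cube c l = cbox (c - vec (l / 2)) (c + vec (l / 2))"

definition conj_exp :: "real \<Rightarrow> real" where
  "conj_exp p = p / (p - 1)"

definition radon_measure :: "(real ^ 'd) measure \<Rightarrow> bool" where
  "radon_measure \<mu> \<longleftrightarrow>
     sets \<mu> = sets borel \<and>
     (\<forall>F. compact F \<longrightarrow> emeasure \<mu> F < \<infinity>) \<and>
     (\<forall>V. open V \<longrightarrow> emeasure \<mu> V = (SUP F\<in>{F. compact F \<and> F \<subseteq> V}. emeasure \<mu> F)) \<and>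
     (\<forall>B\<in>sets borel. emeasure \<mu> B = (INF V\<in>{V. open V \<and> B \<subseteq> V}. emeasure \<mu> V))"

definition of_order :: "real \<Rightarrow> real \<Rightarrow> (real ^ 'd) measure \<Rightarrow> bool" where
  "of_order n C\<^sub>0 \<mu> \<longleftrightarrow>
     radon_measure \<mu> \<and> (\<forall>x r. 0 < r \<longrightarrow> emeasure \<mu> (ball x r) \<le> ennreal (C\<^sub>0 * r powr n))"

text \<open>
  Kernels are total functions; all conditions, and all integrals below, only involve their
  values off the diagonal. In the two regularity conditions \<open>x \<noteq> y\<close> forces
  \<open>x' \<noteq> y\<close>, respectively \<open>x \<noteq> y'\<close>.
\<close>

definition cz_kernel ::
  "real \<Rightarrow> real \<Rightarrow> real \<Rightarrow> (real ^ 'd \<Rightarrow> real ^ 'd \<Rightarrow> complex) \<Rightarrow> bool" where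
  "cz_kernel n C \<alpha> K \<longleftrightarrow>
     (\<forall>x y. x \<noteq> y \<longrightarrow> norm (K x y) \<le> C * norm (x - y) powr (- n)) \<and>
     (\<forall>x x' y. x \<noteq> y \<longrightarrow> norm (x - y) \<ge> 2 * norm (x - x') \<longrightarrow>
        norm (K x y - K x' y) \<le> C * norm (x - x') powr \<alpha> * norm (x - y) powr (- n - \<alpha>)) \<and>
     (\<forall>x y y'. x \<noteq> y \<longrightarrow> norm (x - y) \<ge> 2 * norm (y - y') \<longrightarrow>
        norm (K x y - K x y') \<le> C * norm (y - y') powr \<alpha> * norm (x - y) powr (- n - \<alpha>))"

definition trunc ::
  "(real ^ 'd \<Rightarrow> real ^ 'd \<Rightarrow> complex) \<Rightarrow> (real ^ 'd) measure \<Rightarrow> real \<Rightarrow>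
    (real ^ 'd \<Rightarrow> complex) \<Rightarrow> real ^ 'd \<Rightarrow> complex" where
  "trunc K \<mu> \<epsilon> f x = (LINT y:{y. norm (x - y) > \<epsilon>}|\<mu>. K x y * f y)"

definition trunc_adj ::
  "(real ^ 'd \<Rightarrow> real ^ 'd \<Rightarrow> complex) \<Rightarrow> (real ^ 'd) measure \<Rightarrow> real \<Rightarrow>
    (real ^ 'd \<Rightarrow> complex) \<Rightarrow> real ^ 'd \<Rightarrow> complex" where
  "trunc_adj K \<mu> \<epsilon> f x = (LINT y:{y. norm (x - y) > \<epsilon>}|\<mu>. K y x * f y)"

definition admissible ::
  "(real ^ 'd) measure \<Rightarrow> real \<Rightarrow> real \<Rightarrow> (real ^ 'd) set \<Rightarrow> (real ^ 'd \<Rightarrow> complex) \<Rightarrow> bool" where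
  "admissible \<mu> p B\<^sub>1 Q f \<longleftrightarrow>
     f \<in> borel_measurable \<mu> \<and>
     closure {x. f x \<noteq> 0} \<subseteq> Q \<and>
     (LINT x:Q|\<mu>. f x) = complex_of_real (measure \<mu> Q) \<and>
     (\<integral>\<^sup>+x\<in>Q. ennreal (norm (f x) powr p) \<partial>\<mu>) \<le> ennreal B\<^sub>1 * emeasure \<mu> Q"

text \<open>\<open>0 / 0 = 0\<close> holds in \<^typ>\<open>ennreal\<close>.\<close>

definition max_ball ::
  "(real ^ 'd) measure \<Rightarrow> (real ^ 'd \<Rightarrow> 'b::real_normed_vector) \<Rightarrow> real ^ 'd \<Rightarrow> ennreal" where
  "max_ball \<mu> f x =
     (SUP r\<in>{0<..}. (\<integral>\<^sup>+y\<in>ball x r. ennreal (norm (f y)) \<partial>\<mu>) / emeasure \<mu> (ball x r))"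

definition max_cube ::
  "(real ^ 'd) measure \<Rightarrow> (real ^ 'd \<Rightarrow> 'b::real_normed_vector) \<Rightarrow> real ^ 'd \<Rightarrow> ennreal" where
  "max_cube \<mu> f x =
     (SUP r\<in>{0<..}. (\<integral>\<^sup>+y\<in>cube x r. ennreal (norm (f y)) \<partial>\<mu>) / emeasure \<mu> (cube x r))"

definition ennreal_powr :: "ennreal \<Rightarrow> real \<Rightarrow> ennreal" where
  "ennreal_powr a s = (if a = \<infinity> then \<infinity> else ennreal (enn2real a powr s))"

definition max_cube_powr ::
  "(real ^ 'd) measure \<Rightarrow> real \<Rightarrow> (real ^ 'd \<Rightarrow> 'b::real_normed_vector) \<Rightarrow> real ^ 'd \<Rightarrow> ennreal"
  where
  "max_cube_powr \<mu> s f x = ennreal_powr (max_cube \<mu> (\<lambda>y. norm (f y) powr s) x) (1 / s)"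

definition doubling :: "(real ^ 'd) measure \<Rightarrow> real \<Rightarrow> real \<Rightarrow> real ^ 'd \<Rightarrow> real \<Rightarrow> bool" where
  "doubling \<mu> a b c l \<longleftrightarrow> emeasure \<mu> (cube c (a * l)) \<le> ennreal b * emeasure \<mu> (cube c l)"

definition small_boundary :: "(real ^ 'd) measure \<Rightarrow> real \<Rightarrow> real ^ 'd \<Rightarrow> real \<Rightarrow> bool" where
  "small_boundary \<mu> t c l \<longleftrightarrow>
     (\<forall>\<rho>>0. emeasure \<mu> {x \<in> cube c (5 * l). infdist x (frontier (cube c l)) \<le> \<rho> * l}
        \<le> ennreal (t * \<rho>) * emeasure \<mu> (cube c (5 * l)))"

end

theory Submission
  imports Defs
begin

text \<open>
  All cubes below are centred at the given point \<open>x\<close>. Write \<open>m\<close> for the value at \<open>x\<close> of the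
  \<open>p\<close>-maximal function of \<open>b\<^sub>Q\<close> and \<open>m'\<close> for that of the \<open>q'\<close>-maximal function of \<open>T\<^sub>\<delta> b\<^sub>Q\<close> on
  \<open>Q\<close>. By Hoelder's inequality the mean of \<open>\<bar>b\<^sub>Q\<bar>\<close> over any cube is at most \<open>m\<close>, and the goal is to
  bound \<open>T\<^sub>\<epsilon> b\<^sub>Q (x)\<close> by a multiple of \<open>m + m'\<close>.

  The side length is increased from \<open>2 \<epsilon>\<close> in steps of a factor ten, up to the first cube whose
  tenfold enlargement has less than \<open>b\<close> times its measure. As \<open>b\<close> is at least \<open>2 * 10\<^sup>n\<close>, the annuli
  passed on the way, and the one after them, contribute at most a multiple of \<open>m\<close>: up to that cube
  the measures grow geometrically faster than the \<open>n\<close>th power of the radii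
  (\<open>nn_integral_nondoubling_annuli\<close>). If no such cube is found before the side length is comparable
  to \<open>\<tau>\<close> times that of \<open>Q\<close>, what remains is an integral over distances comparable to the side
  length of \<open>Q\<close> and is again at most a multiple of \<open>m\<close>.

  Otherwise let \<open>\<rho>\<close> be the side length found. A weak-type argument in the side length, based on
  Vitali's covering lemma, gives a cube \<open>R\<close> with side between \<open>\<rho>\<close> and \<open>2 \<rho>\<close> whose boundary is thin
  both for \<open>\<mu>\<close> and for \<open>\<bar>b\<^sub>Q\<bar>\<^sup>p \<mu>\<close> (\<open>exists_cube_small_boundary\<close>); it is doubling and contained
  in \<open>Q\<close>, so it has a test function \<open>p\<^sub>R\<close> with integral \<open>\<mu>(R)\<close>. Let \<open>Z w\<close> be the integral of
  \<open>K(w, y) b\<^sub>Q(y)\<close> over \<open>y\<close> outside \<open>2R\<close>. Then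
  \<open>\<mu>(R) Z x = \<integral> p\<^sub>R(w) (Z x - Z w) + \<integral> p\<^sub>R T\<^sub>\<delta> b\<^sub>Q - \<integral>\<^bsub>2R\<^esub> b\<^sub>Q T\<^sub>\<delta>\<^sup>* p\<^sub>R\<close>
  (\<open>norm_tail_integral_le\<close>). The first term is controlled by the smoothness of the kernel and
  \<open>m\<close>, the second by Hoelder's inequality and \<open>m'\<close>. So is the third, with \<open>m\<close>, wherever the
  adjoint is controlled in \<open>L\<^bsup>p'\<^esup>\<close>.

  When the adjoint is controlled on \<open>R\<close> only, the contribution of \<open>2R - R\<close> is estimated by the size
  of the kernel (\<open>nn_integral_boundary_layer\<close>). Pairs of points at distance about \<open>h\<close> involve
  only the part of \<open>2R - R\<close> within \<open>h\<close> of the boundary. By a local form of Young's inequality they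
  contribute a multiple of \<open>h powr (- n (1/p + 1/q - 1))\<close> times the \<open>L\<^sup>p\<close> norm of \<open>b\<^sub>Q\<close> on that
  part, which is of order \<open>h powr (1/p)\<close> by the choice of \<open>R\<close>. Summing over dyadic \<open>h\<close> converges
  exactly when \<open>1/p + 1/q < 1 + 1/(np)\<close>.
\<close>

section \<open>Cubes and the supremum norm\<close>

lemma mem_cube_iff:
  fixes x y :: "real ^ 'd"
  shows "y \<in> cube x r \<longleftrightarrow> infnorm (y - x) \<le> r / 2"
proof -
  have "infnorm (y - x) \<le> r / 2 \<longleftrightarrow> (\<forall>i. \<bar>(y - x) $ i\<bar> \<le> r / 2)"
  proof
    assume "infnorm (y - x) \<le> r / 2"
    then show "\<forall>i. \<bar>(y - x) $ i\<bar> \<le> r / 2"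
      using component_le_infnorm_cart order_trans by blast
  next
    assume "\<forall>i. \<bar>(y - x) $ i\<bar> \<le> r / 2"
    then show "infnorm (y - x) \<le> r / 2"
      unfolding infnorm_cart by (intro cSup_least) auto
  qed
  moreover have "\<bar>(y - x) $ i\<bar> \<le> r / 2 \<longleftrightarrow> x $ i - r / 2 \<le> y $ i \<and> y $ i \<le> x $ i + r / 2" for i
    unfolding vector_minus_component by linarith
  ultimately show ?thesis
    by (simp add: cube_def mem_box_cart)
qed

lemma cube_mono: "r \<le> s \<Longrightarrow> cube x r \<subseteq> cube x s"
  by (auto simp: mem_cube_iff)

lemma compact_cube [simp]: "compact (cube x r)"
  by (simp add: cube_def compact_cbox)

lemma closed_cube [simp]: "closed (cube x r)"
  by (simp add: cube_def closed_cbox)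

lemma cube_borel [measurable]: "cube x r \<in> sets borel"
  by simp

lemma norm_le_card_infnorm:
  fixes v :: "real ^ 'd"
  shows "norm v \<le> real CARD('d) * infnorm v"
proof -
  have "norm v \<le> sqrt (real CARD('d)) * infnorm v"
    using norm_le_infnorm [of v] by simp
  also have "sqrt (real CARD('d)) \<le> real CARD('d)"
    by (rule real_le_lsqrt) (auto simp: power2_eq_square)
  finally show ?thesis
    by (simp add: infnorm_pos_le mult_right_mono)
qed

lemma cube_subset_ball:
  fixes x :: "real ^ 'd"
  assumes "0 < r"
  shows "cube x r \<subseteq> ball x (real CARD('d) * r)"
proof
  fix y assume "y \<in> cube x r"
  then have "infnorm (y - x) \<le> r / 2" by (simp add: mem_cube_iff)
  then have "norm (y - x) \<le> real CARD('d) * (r / 2)"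
    using norm_le_card_infnorm [of "y - x"] mult_left_mono [of "infnorm (y - x)" "r / 2" "real CARD('d)"]
    by linarith
  also have "\<dots> < real CARD('d) * r" using assms by simp
  finally show "y \<in> ball x (real CARD('d) * r)"
    by (simp add: dist_norm norm_minus_commute)
qed

lemma infnorm_frontier_cube:
  fixes x y :: "real ^ 'd"
  assumes "y \<in> frontier (cube x s)"
  shows "infnorm (y - x) = s / 2"
proof -
  have "open {y. infnorm (y - x) < s / 2}"
    by (intro open_Collect_less continuous_intros)
  moreover have "{y. infnorm (y - x) < s / 2} \<subseteq> cube x s"
    by (auto simp: mem_cube_iff)
  ultimately have "{y. infnorm (y - x) < s / 2} \<subseteq> interior (cube x s)"
    by (rule interior_maximal [rotated])
  moreover have "y \<in> cube x s" "y \<notin> interior (cube x s)"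
    using assms by (auto simp: frontier_def)
  ultimately show ?thesis by (force simp: mem_cube_iff)
qed

text \<open>The distance to the boundary of a cube controls the difference of the supremum norms.\<close>

lemma infnorm_infdist_frontier_cube:
  fixes x y :: "real ^ 'd"
  assumes "0 < s" "infdist y (frontier (cube x s)) \<le> h"
  shows "\<bar>infnorm (y - x) - s / 2\<bar> \<le> h"
proof -
  have "x \<in> cube x s" using assms(1) by (simp add: mem_cube_iff infnorm_0)
  moreover have "cube x s \<noteq> UNIV"
    using compact_cube [of x s] not_compact_UNIV by metis
  ultimately have "frontier (cube x s) \<noteq> {}"
    using frontier_not_empty by blast
  then obtain z where z: "z \<in> frontier (cube x s)" "infdist y (frontier (cube x s)) = dist y z"
    using infdist_attains_inf [of "frontier (cube x s)" y] frontier_closed by blast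
  have "\<bar>infnorm (y - x) - infnorm (z - x)\<bar> \<le> infnorm (y - z)"
    using absdiff_infnorm [of "y - x" "z - x"] by simp
  also have "\<dots> \<le> norm (y - z)" by (rule infnorm_le_norm)
  also have "\<dots> \<le> h" using z assms by (simp add: dist_norm)
  finally show ?thesis using infnorm_frontier_cube [OF z(1)] by simp
qed

section \<open>Hoelder's inequality\<close>

text \<open>
  The bounds \<open>A\<close> and \<open>B\<close> on the two integrals are real numbers, so that finiteness is part of the
  hypotheses.
\<close>

lemma nn_integral_Hoelder:
  fixes f g :: "'a \<Rightarrow> real"
  assumes pq: "1 < p" "1 < q" "1 / p + 1 / q = 1"
    and [measurable]: "f \<in> borel_measurable M" "g \<in> borel_measurable M"
    and f: "\<And>x. 0 \<le> f x" and g: "\<And>x. 0 \<le> g x"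
    and A: "(\<integral>\<^sup>+x. ennreal (f x powr p) \<partial>M) \<le> ennreal A" "0 \<le> A"
    and B: "(\<integral>\<^sup>+x. ennreal (g x powr q) \<partial>M) \<le> ennreal B" "0 \<le> B"
  shows "(\<integral>\<^sup>+x. ennreal (f x * g x) \<partial>M) \<le> ennreal (A powr (1 / p) * B powr (1 / q))"
proof (cases "A = 0 \<or> B = 0")
  case True
  have "AE x in M. f x * g x = 0"
  proof (cases "A = 0")
    case True
    then have "(\<integral>\<^sup>+x. ennreal (f x powr p) \<partial>M) = 0" using A by simp
    then have "AE x in M. ennreal (f x powr p) = 0" by (subst (asm) nn_integral_0_iff_AE) auto
    then show ?thesis
    proof eventually_elim
      case (elim x)
      then have "f x = 0" using f [of x] by (auto simp: ennreal_eq_0_iff powr_eq_0_iff)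
      then show ?case by simp
    qed
  next
    case False
    then have "(\<integral>\<^sup>+x. ennreal (g x powr q) \<partial>M) = 0" using B \<open>A = 0 \<or> B = 0\<close> by simp
    then have "AE x in M. ennreal (g x powr q) = 0" by (subst (asm) nn_integral_0_iff_AE) auto
    then show ?thesis
    proof eventually_elim
      case (elim x)
      then have "g x = 0" using g [of x] by (auto simp: ennreal_eq_0_iff powr_eq_0_iff)
      then show ?case by simp
    qed
  qed
  then have "(\<integral>\<^sup>+x. ennreal (f x * g x) \<partial>M) = 0"
    by (subst nn_integral_0_iff_AE) auto
  then show ?thesis by simp
next
  case False
  then have AB: "0 < A" "0 < B" using A B by auto
  define a where "a = A powr (1 / p)"
  define c where "c = B powr (1 / q)"
  have ac: "0 < a" "0 < c" "a powr p = A" "c powr q = B"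
    using AB pq by (auto simp: a_def c_def powr_powr)
  have "f x * g x \<le> a * c / (p * A) * f x powr p + a * c / (q * B) * g x powr q" for x
  proof -
    have "f x / a * (g x / c) \<le> (f x / a) powr p / p + (g x / c) powr q / q"
      using pq ac f [of x] g [of x] by (intro Youngs_inequality) auto
    also have "\<dots> = f x powr p / (A * p) + g x powr q / (B * q)"
      using ac f [of x] g [of x] by (simp add: powr_divide)
    finally have "a * c * (f x / a * (g x / c)) \<le> a * c * (f x powr p / (A * p) + g x powr q / (B * q))"
      using ac by (intro mult_left_mono) auto
    moreover have "a * c * (f x / a * (g x / c)) = f x * g x" using ac by simp
    ultimately show ?thesis by (simp add: field_simps)
  qed
  then have "(\<integral>\<^sup>+x. ennreal (f x * g x) \<partial>M)
      \<le> (\<integral>\<^sup>+x. ennreal (a * c / (p * A)) * ennreal (f x powr p)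
              + ennreal (a * c / (q * B)) * ennreal (g x powr q) \<partial>M)"
    using ac pq AB by (intro nn_integral_mono)
      (simp add: ennreal_mult' [symmetric] ennreal_plus [symmetric] del: ennreal_plus)
  also have "\<dots> = ennreal (a * c / (p * A)) * (\<integral>\<^sup>+x. ennreal (f x powr p) \<partial>M)
              + ennreal (a * c / (q * B)) * (\<integral>\<^sup>+x. ennreal (g x powr q) \<partial>M)"
    by (simp add: nn_integral_add nn_integral_cmult)
  also have "\<dots> \<le> ennreal (a * c / (p * A)) * ennreal A + ennreal (a * c / (q * B)) * ennreal B"
    by (intro add_mono mult_left_mono A B) auto
  also have "\<dots> = ennreal (a * c / (p * A) * A + a * c / (q * B) * B)"
    using ac pq AB by (simp add: ennreal_mult' [symmetric] ennreal_plus [symmetric] del: ennreal_plus)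
  also have "a * c / (p * A) * A + a * c / (q * B) * B = a * c * (1 / p + 1 / q)"
    using AB by (simp add: field_simps)
  finally show ?thesis using pq by (simp add: a_def c_def)
qed

lemma conj_exp_conjugate:
  assumes "1 < p"
  shows "1 < conj_exp p" "1 / p + 1 / conj_exp p = 1"
  using assms by (auto simp: conj_exp_def field_simps)

lemma set_nn_integral_Hoelder:
  fixes f g :: "'a \<Rightarrow> real"
  assumes pq: "1 < p" "1 < q" "1 / p + 1 / q = 1"
    and [measurable]: "f \<in> borel_measurable M" "g \<in> borel_measurable M" "S \<in> sets M"
    and f: "\<And>x. 0 \<le> f x" and g: "\<And>x. 0 \<le> g x"
    and A: "(\<integral>\<^sup>+x\<in>S. ennreal (f x powr p) \<partial>M) \<le> ennreal A" "0 \<le> A"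
    and B: "(\<integral>\<^sup>+x\<in>S. ennreal (g x powr q) \<partial>M) \<le> ennreal B" "0 \<le> B"
  shows "(\<integral>\<^sup>+x\<in>S. ennreal (f x * g x) \<partial>M) \<le> ennreal (A powr (1 / p) * B powr (1 / q))"
proof -
  have "(\<integral>\<^sup>+x. ennreal ((f x * indicator S x) * (g x * indicator S x)) \<partial>M)
      \<le> ennreal (A powr (1 / p) * B powr (1 / q))"
  proof (rule nn_integral_Hoelder [OF pq])
    have "(\<integral>\<^sup>+x. ennreal ((f x * indicator S x) powr p) \<partial>M) = (\<integral>\<^sup>+x\<in>S. ennreal (f x powr p) \<partial>M)"
      by (intro nn_integral_cong) (auto simp: indicator_def)
    then show "(\<integral>\<^sup>+x. ennreal ((f x * indicator S x) powr p) \<partial>M) \<le> ennreal A" using A by simp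
    have "(\<integral>\<^sup>+x. ennreal ((g x * indicator S x) powr q) \<partial>M) = (\<integral>\<^sup>+x\<in>S. ennreal (g x powr q) \<partial>M)"
      by (intro nn_integral_cong) (auto simp: indicator_def)
    then show "(\<integral>\<^sup>+x. ennreal ((g x * indicator S x) powr q) \<partial>M) \<le> ennreal B" using B by simp
  qed (use f g A B in auto)
  also have "(\<integral>\<^sup>+x. ennreal ((f x * indicator S x) * (g x * indicator S x)) \<partial>M)
      = (\<integral>\<^sup>+x\<in>S. ennreal (f x * g x) \<partial>M)"
    by (intro nn_integral_cong) (auto simp: indicator_def)
  finally show ?thesis .
qed

text \<open>An \<open>L\<^sup>p\<close> average dominates the corresponding \<open>L\<^sup>1\<close> average.\<close>

lemma set_nn_integral_le_of_powr:
  fixes f :: "'a \<Rightarrow> real"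
  assumes p: "1 < p" and [measurable]: "f \<in> borel_measurable M" "S \<in> sets M"
    and f: "\<And>x. 0 \<le> f x" and m: "0 \<le> m" and fin: "emeasure M S < \<infinity>"
    and le: "(\<integral>\<^sup>+x\<in>S. ennreal (f x powr p) \<partial>M) \<le> ennreal (m powr p) * emeasure M S"
  shows "(\<integral>\<^sup>+x\<in>S. ennreal (f x) \<partial>M) \<le> ennreal m * emeasure M S"
proof -
  define q where "q = p / (p - 1)"
  have q: "1 < q" "1 / p + 1 / q = 1" using p by (auto simp: q_def field_simps)
  define e where "e = measure M S"
  have e: "emeasure M S = ennreal e" "0 \<le> e"
    using fin by (auto simp: e_def emeasure_eq_ennreal_measure top.not_eq_extremum)
  have "(\<integral>\<^sup>+x\<in>S. ennreal (f x * 1) \<partial>M) \<le> ennreal ((m powr p * e) powr (1 / p) * e powr (1 / q))"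
  proof (rule set_nn_integral_Hoelder [OF p q])
    show "(\<integral>\<^sup>+x\<in>S. ennreal (f x powr p) \<partial>M) \<le> ennreal (m powr p * e)"
      using le e by (simp add: ennreal_mult')
    show "(\<integral>\<^sup>+x\<in>S. ennreal (1 powr q) \<partial>M) \<le> ennreal e"
      using e by simp
  qed (use f e in auto)
  also have "(m powr p * e) powr (1 / p) * e powr (1 / q) = m * (e powr (1 / p) * e powr (1 / q))"
    using m e p by (simp add: powr_mult powr_powr)
  also have "e powr (1 / p) * e powr (1 / q) = e"
    using e q by (simp add: powr_add [symmetric])
  finally show ?thesis using e m by (simp add: ennreal_mult')
qed

section \<open>Levels with thin neighbourhoods\<close>

text \<open>
  This is the weak-type bound for the centred maximal function of the image of \<open>M\<close> under \<open>u\<close>: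
  the levels where this maximal function is large are covered by a set of small length.
\<close>

lemma thick_levels_small:
  fixes u :: "'a \<Rightarrow> real"
  assumes M: "finite_measure M" and [measurable]: "u \<in> borel_measurable M" and k: "0 < k"
  shows "\<exists>N\<in>sets borel. emeasure lborel N \<le> ennreal (10 / k) \<and>
    {s. \<exists>h>0. k * h * measure M (space M) < measure M {y\<in>space M. \<bar>u y - s\<bar> \<le> h}} \<subseteq> N"
proof -
  interpret finite_measure M by fact
  define T where "T = measure M (space M)"
  define Bad where "Bad = {s. \<exists>h>0. k * h * T < measure M {y\<in>space M. \<bar>u y - s\<bar> \<le> h}}"
  define Y where "Y s h = {y\<in>space M. \<bar>u y - s\<bar> \<le> h}" for s h
  have Y [measurable]: "Y s h \<in> sets M" for s h by (simp add: Y_def)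
  have YT: "measure M (Y s h) \<le> T" for s h
    unfolding T_def Y_def by (rule bounded_measure)
  show ?thesis
  proof (cases "T = 0")
    case True
    then have "Bad = {}" using YT by (force simp: Bad_def Y_def not_less)
    then show ?thesis unfolding Bad_def T_def by (intro bexI [of _ "{}"]) auto
  next
    case False
    then have T: "0 < T" using measure_nonneg [of M "space M"] by (simp add: T_def less_le)
    have "\<forall>s\<in>Bad. \<exists>h. 0 < h \<and> k * h * T < measure M (Y s h)"
      by (auto simp: Bad_def Y_def)
    then obtain r where r: "\<And>s. s \<in> Bad \<Longrightarrow> 0 < r s" "\<And>s. s \<in> Bad \<Longrightarrow> k * r s * T < measure M (Y s (r s))"
      by metis
    have r_le: "r s \<le> 1 / k" if "s \<in> Bad" for s
    proof -
      have "k * r s * T < 1 * T" using r(2) [OF that] YT [of s "r s"] by linarith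
      then have "k * r s < 1" using T by (simp add: mult_less_cancel_right)
      then show ?thesis using k by (simp add: field_simps)
    qed
    \<comment> \<open>Disjoint intervals around bad levels carry disjoint parts of the mass \<open>T\<close>, and their
      fivefold enlargements cover all bad levels.\<close>
    obtain C where C: "countable C" "C \<subseteq> Bad"
       "pairwise (\<lambda>i j. disjnt (cball i (r i)) (cball j (r j))) C"
       "Bad \<subseteq> (\<Union>i\<in>C. cball i (5 * r i))"
    proof (rule Vitali_covering_lemma_cballs [of Bad "\<lambda>s. s" r Bad "1 / k"])
      show "Bad \<subseteq> (\<Union>i\<in>Bad. cball i (r i))" using r(1) by (force simp: less_imp_le)
    qed (use r r_le in auto)
    define J where "J = to_nat_on C ` C"
    define e where "e = from_nat_into C"
    have e: "e j \<in> C" if "j \<in> J" for j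
      using that C(1) by (auto simp: J_def e_def)
    have e_inj: "e i \<noteq> e j" if "i \<in> J" "j \<in> J" "i \<noteq> j" for i j
      using that C(1) by (auto simp: J_def e_def)
    have C_eq: "C = e ` J"
      using C(1) by (auto simp: J_def e_def image_image)
    define X where "X j = (if j \<in> J then cball (e j) (5 * r (e j)) else {})" for j
    define Z where "Z j = (if j \<in> J then Y (e j) (r (e j)) else {})" for j
    have disj: "disjoint_family Z"
    proof (unfold disjoint_family_on_def, intro ballI impI)
      fix i j :: nat assume "i \<noteq> j"
      show "Z i \<inter> Z j = {}"
      proof (rule ccontr)
        assume "Z i \<inter> Z j \<noteq> {}"
        then obtain y where y: "y \<in> Z i" "y \<in> Z j" by blast
        then have ij: "i \<in> J" "j \<in> J" by (auto simp: Z_def split: if_splits)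
        have "u y \<in> cball (e i) (r (e i))" "u y \<in> cball (e j) (r (e j))"
          using y ij by (auto simp: Z_def Y_def dist_real_def abs_minus_commute)
        then show False
          using C(3) e_inj [OF ij \<open>i \<noteq> j\<close>] e ij unfolding pairwise_def disjnt_def by blast
      qed
    qed
    have le: "emeasure lborel (X j) \<le> ennreal (10 / (k * T)) * emeasure M (Z j)" for j
    proof (cases "j \<in> J")
      case True
      then have b: "e j \<in> Bad" using e C by blast
      have "X j = {e j - 5 * r (e j) .. e j + 5 * r (e j)}"
        using True by (simp add: X_def cball_eq_atLeastAtMost)
      then have "emeasure lborel (X j) = ennreal (10 * r (e j))"
        using r(1) [OF b] by simp
      also have "\<dots> \<le> ennreal (10 / (k * T) * measure M (Z j))"
        using r(2) [OF b] True k T by (intro ennreal_leI) (simp add: Z_def field_simps)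
      finally show ?thesis
        using k T by (simp add: emeasure_eq_measure flip: ennreal_mult')
    qed (simp add: X_def)
    have Z_meas: "range Z \<subseteq> sets M" by (auto simp: Z_def)
    have "emeasure lborel (\<Union>j. X j) \<le> (\<Sum>j. emeasure lborel (X j))"
      by (rule emeasure_subadditive_countably) (auto simp: X_def)
    also have "\<dots> \<le> (\<Sum>j. ennreal (10 / (k * T)) * emeasure M (Z j))"
      by (intro suminf_le le) auto
    also have "\<dots> = ennreal (10 / (k * T)) * emeasure M (\<Union>j. Z j)"
      using suminf_emeasure [OF Z_meas disj] by simp
    also have "\<dots> \<le> ennreal (10 / (k * T)) * ennreal T"
      unfolding T_def emeasure_eq_measure
      by (intro mult_left_mono ennreal_leI bounded_measure) auto
    also have "\<dots> = ennreal (10 / k)"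
      using k T by (simp add: ennreal_mult' [symmetric])
    finally have "emeasure lborel (\<Union>j. X j) \<le> ennreal (10 / k)" .
    moreover have "(\<Union>j. X j) \<in> sets borel" by (auto simp: X_def)
    moreover have "Bad \<subseteq> (\<Union>j. X j)"
      using C(4) unfolding C_eq by (force simp: X_def)
    ultimately show ?thesis unfolding Bad_def T_def by blast
  qed
qed

text \<open>
  With the constant \<open>40 / (b - a)\<close> each of the two bad sets fills at most a quarter of the
  interval, so that some level is good for both measures.
\<close>

lemma exists_thin_level:
  fixes u v :: "'a \<Rightarrow> real"
  assumes M: "finite_measure M" "u \<in> borel_measurable M"
    and N: "finite_measure N" "v \<in> borel_measurable N" and ab: "a < b"
  shows "\<exists>s\<in>{a..b}. \<forall>h>0.
    measure M {y\<in>space M. \<bar>u y - s\<bar> \<le> h} \<le> 40 / (b - a) * h * measure M (space M) \<and>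
    measure N {y\<in>space N. \<bar>v y - s\<bar> \<le> h} \<le> 40 / (b - a) * h * measure N (space N)"
proof -
  define k where "k = 40 / (b - a)"
  have k: "0 < k" using ab by (simp add: k_def)
  obtain A where A: "A \<in> sets borel" "emeasure lborel A \<le> ennreal (10 / k)"
    "{s. \<exists>h>0. k * h * measure M (space M) < measure M {y\<in>space M. \<bar>u y - s\<bar> \<le> h}} \<subseteq> A"
    using thick_levels_small [OF M k] by blast
  obtain B where B: "B \<in> sets borel" "emeasure lborel B \<le> ennreal (10 / k)"
    "{s. \<exists>h>0. k * h * measure N (space N) < measure N {y\<in>space N. \<bar>v y - s\<bar> \<le> h}} \<subseteq> B"
    using thick_levels_small [OF N k] by blast
  have "emeasure lborel (A \<union> B) \<le> emeasure lborel A + emeasure lborel B"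
    using A B by (intro emeasure_subadditive) auto
  also have "\<dots> \<le> ennreal (10 / k) + ennreal (10 / k)"
    by (intro add_mono A B)
  also have "\<dots> = ennreal ((b - a) / 2)"
    using ab by (simp add: k_def ennreal_plus [symmetric] del: ennreal_plus)
  also have "\<dots> < ennreal (b - a)" using ab by (simp add: ennreal_less_iff)
  also have "\<dots> = emeasure lborel {a..b}" using ab by simp
  finally have "\<not> {a..b} \<subseteq> A \<union> B"
    using emeasure_mono [of "{a..b}" "A \<union> B" lborel] A B by (auto simp: not_le [symmetric])
  then obtain s where s: "s \<in> {a..b}" "s \<notin> A" "s \<notin> B" by blast
  show ?thesis
    using s A(3) B(3) unfolding k_def by (intro bexI [of _ s]) (auto simp: not_less [symmetric])
qed

section \<open>Measures of polynomial growth\<close>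

lemma nn_integral_mono_set:
  assumes "\<And>x. x \<in> A \<Longrightarrow> x \<in> B" "\<And>x. x \<in> A \<Longrightarrow> f x \<le> g x"
  shows "(\<integral>\<^sup>+x\<in>A. f x \<partial>M) \<le> (\<integral>\<^sup>+x\<in>B. g x \<partial>M)"
  using assms by (intro nn_integral_mono) (auto simp: indicator_def)

lemma nn_integral_Union_le:
  fixes f :: "'a \<Rightarrow> ennreal" and S :: "nat \<Rightarrow> 'a set"
  assumes [measurable]: "f \<in> borel_measurable M" "\<And>j. S j \<in> sets M" and A: "A \<subseteq> (\<Union>j. S j)"
  shows "(\<integral>\<^sup>+x\<in>A. f x \<partial>M) \<le> (\<Sum>j. \<integral>\<^sup>+x\<in>S j. f x \<partial>M)"
proof -
  have "(\<integral>\<^sup>+x\<in>A. f x \<partial>M) \<le> (\<integral>\<^sup>+x. (\<Sum>j. f x * indicator (S j) x) \<partial>M)"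
  proof (rule nn_integral_mono)
    fix x
    show "f x * indicator A x \<le> (\<Sum>j. f x * indicator (S j) x)"
    proof (cases "x \<in> A")
      case True
      then obtain i where "x \<in> S i" using A by blast
      then have "f x * indicator A x \<le> (\<Sum>j\<in>{i}. f x * indicator (S j) x)" by (simp add: True)
      also have "\<dots> \<le> (\<Sum>j. f x * indicator (S j) x)"
        by (rule sum_le_suminf) auto
      finally show ?thesis .
    qed simp
  qed
  also have "\<dots> = (\<Sum>j. \<integral>\<^sup>+x\<in>S j. f x \<partial>M)"
    by (rule nn_integral_suminf) simp
  finally show ?thesis .
qed

lemma suminf_ennreal_geometric:
  fixes a q :: real
  assumes "0 \<le> a" "0 \<le> q" "q < 1"
  shows "(\<Sum>j. ennreal (a * q ^ j)) = ennreal (a / (1 - q))"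
proof -
  have "(\<Sum>j. ennreal (a * q ^ j)) = ennreal (\<Sum>j. a * q ^ j)"
    using assms by (intro suminf_ennreal2) (auto intro: summable_mult)
  also have "(\<Sum>j. a * q ^ j) = a / (1 - q)"
    using assms by (simp add: suminf_mult suminf_geometric summable_geometric)
  finally show ?thesis .
qed

lemma exists_dyadic_scale:
  fixes t :: real
  assumes "1 < t"
  shows "\<exists>j::nat. 2 ^ j < t \<and> t \<le> 2 ^ Suc j"
proof -
  obtain N :: nat where "t < 2 ^ N" using real_arch_pow [of 2 t] by auto
  then have ex: "t \<le> 2 ^ N" by simp
  define i where "i = (LEAST i::nat. t \<le> 2 ^ i)"
  have i: "t \<le> 2 ^ i" unfolding i_def by (rule LeastI [of _ N]) (rule ex)
  then have "i \<noteq> 0" using assms by (intro notI) simp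
  then obtain j where j: "i = Suc j" using not0_implies_Suc by blast
  have "\<not> t \<le> 2 ^ j" using not_less_Least [of j "\<lambda>i. t \<le> 2 ^ i"] j i_def by simp
  then show ?thesis using i j by (intro exI [of _ j]) auto
qed

text \<open>
  The growth condition is imposed on cubes; a measure of order \<open>n\<close> satisfies it with a
  constant that depends on the dimension.
\<close>

locale growth_measure =
  fixes \<mu> :: "(real ^ 'd) measure" and n c\<^sub>0 :: real
  assumes sets_borel [measurable_cong]: "sets \<mu> = sets borel"
    and emeasure_cube_finite: "emeasure \<mu> (cube x r) < \<infinity>"
    and n_pos: "0 < n" and c\<^sub>0_pos: "0 < c\<^sub>0"
    and measure_cube_le: "0 < r \<Longrightarrow> measure \<mu> (cube x r) \<le> c\<^sub>0 * r powr n"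

lemma growth_measure_of_order:
  fixes \<mu> :: "(real ^ 'd) measure"
  assumes "of_order n C \<mu>" "0 < n" "0 < C"
  shows "growth_measure \<mu> n (C * real CARD('d) powr n)"
proof
  show sets: "sets \<mu> = sets borel"
    using assms by (simp add: of_order_def radon_measure_def)
  show fin: "emeasure \<mu> (cube x r) < \<infinity>" for x r
  proof -
    have "\<forall>F. compact F \<longrightarrow> emeasure \<mu> F < \<infinity>"
      using assms(1) unfolding of_order_def radon_measure_def by (elim conjE)
    then show ?thesis by simp
  qed
  show "measure \<mu> (cube x r) \<le> C * real CARD('d) powr n * r powr n" if "0 < r" for x r
  proof -
    have "emeasure \<mu> (cube x r) \<le> emeasure \<mu> (ball x (real CARD('d) * r))"
      using cube_subset_ball [OF that] by (intro emeasure_mono) (auto simp: sets)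
    also have "\<dots> \<le> ennreal (C * (real CARD('d) * r) powr n)"
      using assms that unfolding of_order_def by simp
    also have "C * (real CARD('d) * r) powr n = C * real CARD('d) powr n * r powr n"
      using that by (simp add: powr_mult)
    finally show ?thesis
      using assms unfolding measure_def by (intro enn2real_leI) auto
  qed
qed (use assms in auto)

context growth_measure
begin

lemma space_UNIV [simp]: "space \<mu> = UNIV"
  using sets_eq_imp_space_eq [OF sets_borel] by simp

lemma cube_sets [measurable]: "cube x r \<in> sets \<mu>"
  by (simp add: sets_borel)

lemma emeasure_cube: "emeasure \<mu> (cube x r) = ennreal (measure \<mu> (cube x r))"
  using emeasure_cube_finite [of x r]
  by (simp add: emeasure_eq_ennreal_measure top.not_eq_extremum)

lemma measure_cube_mono: "r \<le> s \<Longrightarrow> measure \<mu> (cube x r) \<le> measure \<mu> (cube x s)"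
  using emeasure_cube_finite [of x s]
  by (intro measure_mono_fmeasurable cube_mono) (auto simp: fmeasurable_def sets_borel)

lemma emeasure_closed_ball_le:
  assumes "0 < h"
  shows "emeasure \<mu> {y. norm (w - y) \<le> h} \<le> ennreal (c\<^sub>0 * (2 * h) powr n)"
proof -
  have "{y. norm (w - y) \<le> h} \<subseteq> cube w (2 * h)"
    using order_trans [OF infnorm_le_norm] by (auto simp: mem_cube_iff infnorm_sub [of _ w])
  then have "emeasure \<mu> {y. norm (w - y) \<le> h} \<le> emeasure \<mu> (cube w (2 * h))"
    by (intro emeasure_mono) auto
  also have "\<dots> \<le> ennreal (c\<^sub>0 * (2 * h) powr n)"
    using measure_cube_le [of "2 * h" w] assms by (simp add: emeasure_cube ennreal_leI)
  finally show ?thesis .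
qed

sublocale sigma_finite_measure \<mu>
proof
  show "\<exists>A. countable A \<and> A \<subseteq> sets \<mu> \<and> \<Union> A = space \<mu> \<and> (\<forall>a\<in>A. emeasure \<mu> a \<noteq> \<infinity>)"
  proof (intro exI conjI ballI)
    show "countable (range (\<lambda>k::nat. cube (0 :: real ^ 'd) (real k)))" by simp
    show "\<Union> (range (\<lambda>k::nat. cube (0 :: real ^ 'd) (real k))) = space \<mu>"
    proof -
      have "\<exists>k::nat. y \<in> cube 0 (real k)" for y :: "real ^ 'd"
        using real_arch_simple [of "2 * infnorm y"] by (simp add: mem_cube_iff mult.commute)
      then show ?thesis by auto
    qed
  qed (use emeasure_cube_finite in \<open>auto simp: less_top [symmetric]\<close>)
qed

subsection \<open>Cubes with thin boundary\<close>

text \<open>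
  Among the cubes with centre \<open>x\<close> and side length between \<open>\<rho>\<close> and \<open>2 * \<rho>\<close> there is one whose
  boundary is small both for \<open>\<mu>\<close> and for \<open>f \<mu>\<close>.
\<close>

lemma exists_cube_small_boundary:
  fixes f :: "real ^ 'd \<Rightarrow> real"
  assumes \<rho>: "0 < \<rho>" and t: "160 \<le> t" and [measurable]: "f \<in> borel_measurable borel"
    and f: "\<And>y. 0 \<le> f y" and V: "0 \<le> V" "(\<integral>\<^sup>+y\<in>cube x (5 * \<rho>). ennreal (f y) \<partial>\<mu>) \<le> ennreal V"
  shows "\<exists>s\<in>{\<rho>..2 * \<rho>}. small_boundary \<mu> t x s \<and>
    (\<forall>h>0. (\<integral>\<^sup>+y\<in>{y \<in> cube x (5 * \<rho>). \<bar>infnorm (y - x) - s / 2\<bar> \<le> h}. ennreal (f y) \<partial>\<mu>)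
        \<le> ennreal (80 / \<rho> * h * V))"
proof -
  define u where "u y = infnorm (y - x)" for y
  have [measurable]: "u \<in> borel_measurable borel"
    unfolding u_def by (intro borel_measurable_continuous_onI continuous_intros)
  define M where "M = density \<mu> (indicator (cube x (5 * \<rho>)))"
  define N where "N = density \<mu> (\<lambda>y. ennreal (f y) * indicator (cube x (5 * \<rho>)) y)"
  have sp [simp]: "space M = UNIV" "space N = UNIV" by (auto simp: M_def N_def)
  have eM: "emeasure M A = emeasure \<mu> (A \<inter> cube x (5 * \<rho>))" if "A \<in> sets borel" for A
    unfolding M_def using that by (subst emeasure_density) (auto simp: sets_borel Int_commute
        indicator_inter_arith [symmetric] nn_integral_indicator)
  have eN: "emeasure N A = (\<integral>\<^sup>+y\<in>A \<inter> cube x (5 * \<rho>). ennreal (f y) \<partial>\<mu>)" if "A \<in> sets borel" for A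
    unfolding N_def using that
    by (subst emeasure_density) (auto simp: sets_borel indicator_inter_arith mult_ac)
  have fM: "finite_measure M"
    using emeasure_cube_finite [of x "5 * \<rho>"] by (intro finite_measureI) (simp add: eM)
  have N_le: "emeasure N UNIV \<le> ennreal V" using V by (simp add: eN)
  then have fN: "finite_measure N"
    by (intro finite_measureI) (auto simp: top_unique)
  interpret M: finite_measure M by fact
  interpret N: finite_measure N by fact
  have "\<exists>s\<in>{\<rho> / 2..\<rho>}. \<forall>h>0.
    measure M {y\<in>space M. \<bar>u y - s\<bar> \<le> h} \<le> 40 / (\<rho> - \<rho> / 2) * h * measure M (space M) \<and>
    measure N {y\<in>space N. \<bar>u y - s\<bar> \<le> h} \<le> 40 / (\<rho> - \<rho> / 2) * h * measure N (space N)"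
    by (rule exists_thin_level [OF fM _ fN]) (use \<rho> in \<open>auto simp: M_def N_def\<close>)
  then obtain s' where s': "s' \<in> {\<rho> / 2..\<rho>}"
    and thinM: "\<And>h. 0 < h \<Longrightarrow> measure M {y. \<bar>u y - s'\<bar> \<le> h} \<le> 80 / \<rho> * h * measure M UNIV"
    and thinN: "\<And>h. 0 < h \<Longrightarrow> measure N {y. \<bar>u y - s'\<bar> \<le> h} \<le> 80 / \<rho> * h * measure N UNIV"
    by auto
  define s where "s = 2 * s'"
  have s: "s \<in> {\<rho>..2 * \<rho>}" "0 < s" using s' \<rho> by (auto simp: s_def)
  have "small_boundary \<mu> t x s"
    unfolding small_boundary_def
  proof (intro allI impI)
    fix l :: real assume l: "0 < l"
    let ?S = "{y \<in> cube x (5 * s). infdist y (frontier (cube x s)) \<le> l * s}"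
    show "emeasure \<mu> ?S \<le> ennreal (t * l) * emeasure \<mu> (cube x (5 * s))"
    \<comment> \<open>For \<open>l > 3 / 4\<close> the bound is trivial as \<open>t * l \<ge> 1\<close>; for smaller \<open>l\<close> the neighbourhood
      of the boundary stays in \<open>cube x (5 * \<rho>)\<close>.\<close>
    proof (cases "l \<le> 3 / 4")
      case False
      then have "160 * (3 / 4) \<le> t * l" using t by (intro mult_mono) auto
      then have "1 \<le> t * l" by simp
      have "emeasure \<mu> ?S \<le> 1 * emeasure \<mu> (cube x (5 * s))"
        by (auto intro: emeasure_mono)
      also have "\<dots> \<le> ennreal (t * l) * emeasure \<mu> (cube x (5 * s))"
        using \<open>1 \<le> t * l\<close> by (intro mult_right_mono) (auto simp flip: ennreal_1 intro: ennreal_leI)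
      finally show ?thesis .
    next
      case True
      have sub: "?S \<subseteq> {y. \<bar>u y - s'\<bar> \<le> l * s} \<inter> cube x (5 * \<rho>)"
      proof
        fix y assume "y \<in> ?S"
        then have 1: "\<bar>u y - s'\<bar> \<le> l * s"
          using infnorm_infdist_frontier_cube [OF s(2), of y x "l * s"] by (simp add: u_def s_def)
        have "l * s \<le> 3 / 4 * (2 * \<rho>)" using l True s \<rho> by (intro mult_mono) auto
        then have "u y \<le> 5 * \<rho> / 2" using 1 s' unfolding atLeastAtMost_iff by linarith
        then show "y \<in> {y. \<bar>u y - s'\<bar> \<le> l * s} \<inter> cube x (5 * \<rho>)"
          using 1 by (simp add: mem_cube_iff u_def)
      qed
      have "emeasure \<mu> ?S \<le> emeasure \<mu> ({y. \<bar>u y - s'\<bar> \<le> l * s} \<inter> cube x (5 * \<rho>))"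
        using sub by (intro emeasure_mono) auto
      also have "\<dots> = emeasure M {y. \<bar>u y - s'\<bar> \<le> l * s}" by (simp add: eM)
      also have "\<dots> \<le> ennreal (80 / \<rho> * (l * s) * measure M UNIV)"
        using thinM [of "l * s"] l s by (simp add: M.emeasure_eq_measure ennreal_leI)
      also have "\<dots> \<le> ennreal (t * l * measure \<mu> (cube x (5 * s)))"
      proof (rule ennreal_leI)
        have "measure M UNIV = measure \<mu> (cube x (5 * \<rho>))" by (simp add: measure_def eM)
        also have "\<dots> \<le> measure \<mu> (cube x (5 * s))" using s by (intro measure_cube_mono) auto
        finally have m: "measure M UNIV \<le> measure \<mu> (cube x (5 * s))" .
        have "80 / \<rho> * (l * s) \<le> 80 / \<rho> * (l * (2 * \<rho>))"
          using l s \<rho> by (intro mult_left_mono) auto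
        also have "\<dots> = 160 * l" using \<rho> by simp
        also have "\<dots> \<le> t * l" using t l by simp
        finally show "80 / \<rho> * (l * s) * measure M UNIV \<le> t * l * measure \<mu> (cube x (5 * s))"
          by (rule mult_mono) (use m l t in auto)
      qed
      also have "\<dots> = ennreal (t * l) * emeasure \<mu> (cube x (5 * s))"
        using t l by (simp add: emeasure_cube ennreal_mult')
      finally show ?thesis .
    qed
  qed
  moreover have "(\<integral>\<^sup>+y\<in>{y \<in> cube x (5 * \<rho>). \<bar>infnorm (y - x) - s / 2\<bar> \<le> h}. ennreal (f y) \<partial>\<mu>)
        \<le> ennreal (80 / \<rho> * h * V)" if h: "0 < h" for h
  proof -
    have "{y \<in> cube x (5 * \<rho>). \<bar>infnorm (y - x) - s / 2\<bar> \<le> h} = {y. \<bar>u y - s'\<bar> \<le> h} \<inter> cube x (5 * \<rho>)"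
      by (auto simp: u_def s_def)
    then have "(\<integral>\<^sup>+y\<in>{y \<in> cube x (5 * \<rho>). \<bar>infnorm (y - x) - s / 2\<bar> \<le> h}. ennreal (f y) \<partial>\<mu>)
        = emeasure N {y. \<bar>u y - s'\<bar> \<le> h}" by (simp add: eN)
    also have "\<dots> \<le> ennreal (80 / \<rho> * h * measure N UNIV)"
      using thinN [OF h] by (simp add: N.emeasure_eq_measure ennreal_leI)
    also have "\<dots> \<le> ennreal (80 / \<rho> * h * V)"
    proof (intro ennreal_leI mult_left_mono)
      show "measure N UNIV \<le> V"
        using N_le V unfolding measure_def by (intro enn2real_leI) auto
    qed (use h \<rho> in auto)
    finally show ?thesis .
  qed
  ultimately show ?thesis using s by blast
qed

subsection \<open>Integrals against powers of the distance\<close>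

lemma nn_integral_norm_powr_le:
  fixes g :: "real ^ 'd \<Rightarrow> real"
  assumes g: "\<And>y. 0 \<le> g y" and G: "(\<integral>\<^sup>+y\<in>cube x R. ennreal (g y) \<partial>\<mu>) \<le> ennreal V"
    and [measurable]: "g \<in> borel_measurable borel"
    and S: "S \<subseteq> cube x R" "\<And>y. y \<in> S \<Longrightarrow> a \<le> norm (x - y)" and a: "0 < a" and \<beta>: "0 \<le> \<beta>"
  shows "(\<integral>\<^sup>+y\<in>S. ennreal (norm (x - y) powr (- \<beta>) * g y) \<partial>\<mu>) \<le> ennreal (a powr (- \<beta>) * V)"
proof -
  have "(\<integral>\<^sup>+y\<in>S. ennreal (norm (x - y) powr (- \<beta>) * g y) \<partial>\<mu>)
      \<le> (\<integral>\<^sup>+y\<in>cube x R. ennreal (a powr (- \<beta>)) * ennreal (g y) \<partial>\<mu>)"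
  proof (rule nn_integral_mono_set)
    fix y assume y: "y \<in> S"
    then show "y \<in> cube x R" using S by blast
    have "norm (x - y) powr (- \<beta>) \<le> a powr (- \<beta>)"
      using S(2) [OF y] a \<beta> by (intro powr_mono2') auto
    then show "ennreal (norm (x - y) powr (- \<beta>) * g y) \<le> ennreal (a powr (- \<beta>)) * ennreal (g y)"
      using g [of y] by (simp add: ennreal_mult' [symmetric] ennreal_leI mult_right_mono)
  qed
  also have "\<dots> = ennreal (a powr (- \<beta>)) * (\<integral>\<^sup>+y\<in>cube x R. ennreal (g y) \<partial>\<mu>)"
    by (simp add: nn_integral_cmult mult.assoc)
  also have "\<dots> \<le> ennreal (a powr (- \<beta>)) * ennreal V"
    by (intro mult_left_mono G) auto
  finally show ?thesis by (simp add: ennreal_mult')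
qed

lemma norm_ge_outside_cube:
  fixes x y :: "real ^ 'd"
  assumes "y \<notin> cube x r"
  shows "r / 2 \<le> norm (x - y)"
  using assms infnorm_le_norm [of "y - x"] by (simp add: mem_cube_iff norm_minus_commute)

text \<open>
  As long as the measures of the cubes grow by a factor of at least \<open>2 * 10 powr n\<close> when the
  side is multiplied by ten, the annuli contribute a geometric series dominated by the last one.
\<close>

lemma nn_integral_nondoubling_annuli:
  fixes g :: "real ^ 'd \<Rightarrow> real"
  assumes g: "\<And>y. 0 \<le> g y" and [measurable]: "g \<in> borel_measurable borel" and m: "0 \<le> m"
    and G: "\<And>r. 0 < r \<Longrightarrow> (\<integral>\<^sup>+y\<in>cube x r. ennreal (g y) \<partial>\<mu>) \<le> ennreal (m * measure \<mu> (cube x r))"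
    and b: "2 * 10 powr n \<le> b" and r: "0 < r"
    and nd: "\<And>j. j < k \<Longrightarrow> b * measure \<mu> (cube x (10 ^ j * r)) \<le> measure \<mu> (cube x (10 ^ Suc j * r))"
  shows "(\<integral>\<^sup>+y\<in>{y \<in> cube x (10 ^ k * r). r / 2 < norm (x - y)}.
            ennreal (norm (x - y) powr (- n) * g y) \<partial>\<mu>)
      \<le> ennreal (2 * 20 powr n * (10 ^ k * r) powr (- n) * (m * measure \<mu> (cube x (10 ^ k * r))))"
  using nd
proof (induction k)
  case 0
  have "(\<integral>\<^sup>+y\<in>{y \<in> cube x r. r / 2 < norm (x - y)}.
            ennreal (norm (x - y) powr (- n) * g y) \<partial>\<mu>)
      \<le> ennreal ((r / 2) powr (- n) * (m * measure \<mu> (cube x r)))"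
    using r n_pos by (intro nn_integral_norm_powr_le [OF g G]) auto
  also have "\<dots> \<le> ennreal (2 * 20 powr n * r powr (- n) * (m * measure \<mu> (cube x r)))"
  proof (intro ennreal_leI mult_right_mono)
    have "(2::real) powr n \<le> 20 powr n" using n_pos by (intro powr_mono2) auto
    then have "(2::real) powr n \<le> 2 * 20 powr n"
      using powr_ge_zero [of 20 n] by linarith
    then show "(r / 2) powr (- n) \<le> 2 * 20 powr n * r powr (- n)"
      using r by (simp add: powr_divide powr_minus field_simps)
  qed (use m in auto)
  finally show ?case by simp
next
  case (Suc k)
  define \<rho> where "\<rho> = 10 ^ k * r"
  have \<rho>: "0 < \<rho>" using r by (simp add: \<rho>_def)
  define V where "V = measure \<mu> (cube x (10 * \<rho>))"
  have V: "0 \<le> V" by (simp add: V_def)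
  have bV: "b * measure \<mu> (cube x \<rho>) \<le> V"
    using Suc.prems [of k] by (simp add: \<rho>_def V_def mult_ac)
  define h where "h y = ennreal (norm (x - y) powr (- n) * g y)" for y
  have [measurable]: "h \<in> borel_measurable borel" unfolding h_def by measurable
  let ?S = "{y \<in> cube x \<rho>. r / 2 < norm (x - y)}"
  let ?T = "cube x (10 * \<rho>) - cube x \<rho>"
  have "(\<integral>\<^sup>+y\<in>{y \<in> cube x (10 * \<rho>). r / 2 < norm (x - y)}. h y \<partial>\<mu>)
      \<le> (\<integral>\<^sup>+y. h y * indicator ?S y + h y * indicator ?T y \<partial>\<mu>)"
    by (intro nn_integral_mono) (auto simp: indicator_def)
  also have "\<dots> = (\<integral>\<^sup>+y\<in>?S. h y \<partial>\<mu>) + (\<integral>\<^sup>+y\<in>?T. h y \<partial>\<mu>)"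
    by (intro nn_integral_add) auto
  also have "\<dots> \<le> ennreal (2 * 20 powr n * \<rho> powr (- n) * (m * measure \<mu> (cube x \<rho>)))
      + ennreal ((\<rho> / 2) powr (- n) * (m * V))"
  proof (intro add_mono)
    show "(\<integral>\<^sup>+y\<in>?S. h y \<partial>\<mu>) \<le> ennreal (2 * 20 powr n * \<rho> powr (- n) * (m * measure \<mu> (cube x \<rho>)))"
      using Suc.IH Suc.prems by (simp add: h_def \<rho>_def)
    show "(\<integral>\<^sup>+y\<in>?T. h y \<partial>\<mu>) \<le> ennreal ((\<rho> / 2) powr (- n) * (m * V))"
      unfolding h_def V_def using \<rho> n_pos norm_ge_outside_cube
      by (intro nn_integral_norm_powr_le [OF g G]) auto
  qed
  also have "\<dots> = ennreal (2 * 20 powr n * \<rho> powr (- n) * (m * measure \<mu> (cube x \<rho>))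
      + (\<rho> / 2) powr (- n) * (m * V))"
    using m V by (intro ennreal_plus [symmetric]) auto
  also have "\<dots> \<le> ennreal (2 * 20 powr n * (10 * \<rho>) powr (- n) * (m * V))"
  proof (rule ennreal_leI)
    have 1: "(\<rho> / 2) powr (- n) = 2 powr n * \<rho> powr (- n)"
      using \<rho> by (simp add: powr_divide powr_minus field_simps)
    have 2: "(10 * \<rho>) powr (- n) = \<rho> powr (- n) / 10 powr n"
      using \<rho> by (simp add: powr_mult powr_minus field_simps)
    have 3: "(20::real) powr n = 2 powr n * 10 powr n"
      by (simp flip: powr_mult)
    have "2 * 10 powr n * measure \<mu> (cube x \<rho>) \<le> b * measure \<mu> (cube x \<rho>)"
      by (intro mult_right_mono b) auto
    then have "2 * 10 powr n * measure \<mu> (cube x \<rho>) \<le> V" using bV by linarith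
    then have "2 powr n * \<rho> powr (- n) * m * (2 * 10 powr n * measure \<mu> (cube x \<rho>))
        \<le> 2 powr n * \<rho> powr (- n) * m * V"
      using m by (intro mult_left_mono) auto
    then show "2 * 20 powr n * \<rho> powr (- n) * (m * measure \<mu> (cube x \<rho>)) + (\<rho> / 2) powr (- n) * (m * V)
        \<le> 2 * 20 powr n * (10 * \<rho>) powr (- n) * (m * V)"
      unfolding 1 2 3 by (simp add: mult_ac)
  qed
  finally show ?case by (simp add: h_def V_def \<rho>_def mult_ac)
qed

text \<open>
  For an integral truncated at \<open>\<epsilon>\<close> this bounds the part up to ten times a scale
  \<open>10 ^ k * (2 * \<epsilon>)\<close> before which no cube is doubling.
\<close>

lemma nn_integral_near_le:
  fixes g :: "real ^ 'd \<Rightarrow> real"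
  assumes g: "\<And>y. 0 \<le> g y" and g_meas [measurable]: "g \<in> borel_measurable borel" and m: "0 \<le> m"
    and G: "\<And>r. 0 < r \<Longrightarrow> (\<integral>\<^sup>+y\<in>cube x r. ennreal (g y) \<partial>\<mu>) \<le> ennreal (m * measure \<mu> (cube x r))"
    and b: "2 * 10 powr n \<le> b" and \<epsilon>: "0 < \<epsilon>" and \<rho>: "\<rho> = 10 ^ k * (2 * \<epsilon>)"
    and nd: "\<And>j. j < k \<Longrightarrow> b * measure \<mu> (cube x (10 ^ j * (2 * \<epsilon>)))
      \<le> measure \<mu> (cube x (10 ^ Suc j * (2 * \<epsilon>)))"
  shows "(\<integral>\<^sup>+y\<in>{y \<in> cube x (10 * \<rho>). \<epsilon> < norm (x - y)}.
            ennreal (norm (x - y) powr (- n) * g y) \<partial>\<mu>) \<le> ennreal (3 * 20 powr n * c\<^sub>0 * m)"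
proof -
  have \<rho>0: "0 < \<rho>" using \<epsilon> by (simp add: \<rho>)
  define h where "h y = ennreal (norm (x - y) powr (- n) * g y)" for y
  have [measurable]: "h \<in> borel_measurable borel" unfolding h_def by measurable
  let ?S = "{y \<in> cube x \<rho>. \<epsilon> < norm (x - y)}"
  let ?T = "cube x (10 * \<rho>) - cube x \<rho>"
  have 1: "(\<integral>\<^sup>+y\<in>?S. h y \<partial>\<mu>) \<le> ennreal (2 * 20 powr n * \<rho> powr (- n) * (m * measure \<mu> (cube x \<rho>)))"
    using nn_integral_nondoubling_annuli [OF g g_meas m G b _ nd] \<epsilon> by (simp add: h_def \<rho>)
  have 2: "(\<integral>\<^sup>+y\<in>?T. h y \<partial>\<mu>) \<le> ennreal ((\<rho> / 2) powr (- n) * (m * measure \<mu> (cube x (10 * \<rho>))))"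
    unfolding h_def using \<rho>0 n_pos norm_ge_outside_cube
    by (intro nn_integral_norm_powr_le [OF g G]) auto
  have 3: "2 * 20 powr n * \<rho> powr (- n) * (m * measure \<mu> (cube x \<rho>)) \<le> 2 * 20 powr n * c\<^sub>0 * m"
  proof -
    have "2 * 20 powr n * \<rho> powr (- n) * (m * measure \<mu> (cube x \<rho>))
        \<le> 2 * 20 powr n * \<rho> powr (- n) * (m * (c\<^sub>0 * \<rho> powr n))"
      using measure_cube_le [OF \<rho>0] m by (intro mult_left_mono) auto
    then show ?thesis using \<rho>0 by (simp add: powr_minus field_simps)
  qed
  have 4: "(\<rho> / 2) powr (- n) * (m * measure \<mu> (cube x (10 * \<rho>))) \<le> 20 powr n * c\<^sub>0 * m"
  proof -
    have "(\<rho> / 2) powr (- n) * (m * measure \<mu> (cube x (10 * \<rho>)))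
        \<le> (\<rho> / 2) powr (- n) * (m * (c\<^sub>0 * (10 * \<rho>) powr n))"
      using measure_cube_le [of "10 * \<rho>"] m \<rho>0 by (intro mult_left_mono) auto
    also have "(10 * \<rho>) powr n = 20 powr n * (\<rho> / 2) powr n"
      using \<rho>0 by (subst powr_mult [symmetric]) simp_all
    finally show ?thesis using \<rho>0 by (simp add: powr_minus field_simps)
  qed
  have "(\<integral>\<^sup>+y\<in>{y \<in> cube x (10 * \<rho>). \<epsilon> < norm (x - y)}. h y \<partial>\<mu>)
      \<le> (\<integral>\<^sup>+y. h y * indicator ?S y + h y * indicator ?T y \<partial>\<mu>)"
    by (intro nn_integral_mono) (auto simp: indicator_def)
  also have "\<dots> = (\<integral>\<^sup>+y\<in>?S. h y \<partial>\<mu>) + (\<integral>\<^sup>+y\<in>?T. h y \<partial>\<mu>)"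
    by (intro nn_integral_add) auto
  also have "\<dots> \<le> ennreal (2 * 20 powr n * c\<^sub>0 * m) + ennreal (20 powr n * c\<^sub>0 * m)"
    by (intro add_mono order_trans [OF 1] order_trans [OF 2] ennreal_leI 3 4)
  also have "\<dots> = ennreal (3 * 20 powr n * c\<^sub>0 * m)"
    using c\<^sub>0_pos m by (simp flip: ennreal_plus add: algebra_simps)
  finally show ?thesis by (simp add: h_def)
qed

text \<open>
  The integrals over the dyadic annuli outside the doubled cube decay geometrically, because of
  the extra power \<open>\<alpha>\<close> of the distance.
\<close>

lemma nn_integral_tail_le:
  fixes g :: "real ^ 'd \<Rightarrow> real"
  assumes g: "\<And>y. 0 \<le> g y" and [measurable]: "g \<in> borel_measurable borel" and m: "0 \<le> m"
    and G: "\<And>r. 0 < r \<Longrightarrow> (\<integral>\<^sup>+y\<in>cube x r. ennreal (g y) \<partial>\<mu>) \<le> ennreal (m * measure \<mu> (cube x r))"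
    and s: "0 < s" and \<alpha>: "0 < \<alpha>"
  shows "(\<integral>\<^sup>+y\<in>- cube x (2 * s). ennreal (norm (x - y) powr (- n - \<alpha>) * g y) \<partial>\<mu>)
      \<le> ennreal (c\<^sub>0 * 4 powr n / (1 - 2 powr (- \<alpha>)) * s powr (- \<alpha>) * m)"
proof -
  define S where "S j = cube x (2 ^ (j + 2) * s) - cube x (2 ^ (j + 1) * s)" for j
  have "- cube x (2 * s) \<subseteq> (\<Union>j. S j)"
  proof
    fix y assume "y \<in> - cube x (2 * s)"
    then have "1 < infnorm (y - x) / s" using s by (simp add: mem_cube_iff)
    then obtain j :: nat where "2 ^ j < infnorm (y - x) / s" "infnorm (y - x) / s \<le> 2 ^ Suc j"
      using exists_dyadic_scale by blast
    then have "y \<in> S j" using s by (simp add: S_def mem_cube_iff field_simps)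
    then show "y \<in> (\<Union>j. S j)" by blast
  qed
  then have "(\<integral>\<^sup>+y\<in>- cube x (2 * s). ennreal (norm (x - y) powr (- n - \<alpha>) * g y) \<partial>\<mu>)
      \<le> (\<Sum>j. \<integral>\<^sup>+y\<in>S j. ennreal (norm (x - y) powr (- n - \<alpha>) * g y) \<partial>\<mu>)"
    by (intro nn_integral_Union_le) (auto simp: S_def)
  also have "\<dots> \<le> (\<Sum>j. ennreal (c\<^sub>0 * 4 powr n * s powr (- \<alpha>) * m * (2 powr (- \<alpha>)) ^ j))"
  proof (rule suminf_le)
    fix j
    define a where "a = 2 ^ j * s"
    have a: "0 < a" using s by (simp add: a_def)
    have "(\<integral>\<^sup>+y\<in>S j. ennreal (norm (x - y) powr (- (n + \<alpha>)) * g y) \<partial>\<mu>)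
        \<le> ennreal (a powr (- (n + \<alpha>)) * (m * measure \<mu> (cube x (4 * a))))"
    proof (rule nn_integral_norm_powr_le [OF g G])
      show "S j \<subseteq> cube x (4 * a)" by (auto simp: S_def a_def mult_ac)
      show "a \<le> norm (x - y)" if "y \<in> S j" for y
        using norm_ge_outside_cube [of y x "2 ^ (j + 1) * s"] that by (simp add: S_def a_def)
    qed (use a n_pos \<alpha> in auto)
    also have "\<dots> \<le> ennreal (a powr (- (n + \<alpha>)) * (m * (c\<^sub>0 * (4 * a) powr n)))"
      using measure_cube_le [of "4 * a" x] a m by (intro ennreal_leI mult_left_mono) auto
    also have "a powr (- (n + \<alpha>)) * (m * (c\<^sub>0 * (4 * a) powr n))
        = c\<^sub>0 * 4 powr n * m * (a powr (- (n + \<alpha>)) * a powr n)"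
      using a by (simp add: powr_mult)
    also have "a powr (- (n + \<alpha>)) * a powr n = a powr (- \<alpha>)"
      by (simp flip: powr_add)
    also have "a powr (- \<alpha>) = (2 powr (- \<alpha>)) ^ j * s powr (- \<alpha>)"
      using s by (simp add: a_def powr_mult powr_realpow [symmetric] powr_powr mult.commute)
    finally show "(\<integral>\<^sup>+y\<in>S j. ennreal (norm (x - y) powr (- n - \<alpha>) * g y) \<partial>\<mu>)
        \<le> ennreal (c\<^sub>0 * 4 powr n * s powr (- \<alpha>) * m * (2 powr (- \<alpha>)) ^ j)"
      by (simp add: mult_ac)
  qed auto
  also have "\<dots> = ennreal (c\<^sub>0 * 4 powr n * s powr (- \<alpha>) * m / (1 - 2 powr (- \<alpha>)))"
    using c\<^sub>0_pos m \<alpha> by (intro suminf_ennreal_geometric) (auto simp: powr_less_one)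
  finally show ?thesis by (simp add: mult_ac)
qed

end

section \<open>Interaction across the boundary of a cube\<close>

context growth_measure
begin

text \<open>
  Young's inequality at a fixed scale: the interaction of \<open>f \<in> L\<^sup>p\<close> and \<open>g \<in> L\<^sup>q\<close> over pairs of
  points at distance at most \<open>h\<close>.
\<close>

lemma nn_integral_local_Young:
  fixes f g :: "real ^ 'd \<Rightarrow> real"
  assumes p: "1 < p" and q: "1 < q" and \<theta>: "\<theta> = 1 / p + 1 / q - 1" "0 \<le> \<theta>" and h: "0 < h"
    and [measurable]: "f \<in> borel_measurable borel" "g \<in> borel_measurable borel"
    and f: "\<And>y. 0 \<le> f y" and g: "\<And>y. 0 \<le> g y"
    and A: "(\<integral>\<^sup>+y. ennreal (f y powr p) \<partial>\<mu>) \<le> ennreal A" "0 \<le> A"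
    and P: "(\<integral>\<^sup>+y. ennreal (g y powr q) \<partial>\<mu>) \<le> ennreal P" "0 \<le> P"
  shows "(\<integral>\<^sup>+w. \<integral>\<^sup>+y. (if norm (w - y) \<le> h then ennreal (g w * f y) else 0) \<partial>\<mu> \<partial>\<mu>)
    \<le> ennreal ((c\<^sub>0 * (2 * h) powr n) powr (1 - \<theta>) * A powr (1 / p) * P powr (1 / q))"
proof -
  interpret pair_sigma_finite \<mu> \<mu> by standard
  define p' where "p' = conj_exp p"
  define q' where "q' = conj_exp q"
  have p': "1 < p'" "1 / p + 1 / p' = 1" and q': "1 < q'" "1 / q + 1 / q' = 1"
    using conj_exp_conjugate p q by (auto simp: p'_def q'_def)
  define D where "D = c\<^sub>0 * (2 * h) powr n"
  have D: "0 < D" using c\<^sub>0_pos h by (simp add: D_def)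
  define B where "B w = {y. norm (w - y) \<le> h}" for w :: "real ^ 'd"
  have B_sets [measurable]: "B w \<in> sets borel" for w by (simp add: B_def)
  define \<Phi> where "\<Phi> w = (\<integral>\<^sup>+y. (if norm (w - y) \<le> h then ennreal (f y powr p) else 0) \<partial>\<mu>)" for w
  have \<Phi>_eq: "\<Phi> w = (\<integral>\<^sup>+y\<in>B w. ennreal (f y powr p) \<partial>\<mu>)" for w
    unfolding \<Phi>_def by (intro nn_integral_cong) (auto simp: B_def)
  have \<Phi>_le: "\<Phi> w \<le> ennreal A" for w
    unfolding \<Phi>_def by (rule order_trans [OF nn_integral_mono A(1)]) auto
  have [measurable]: "\<Phi> \<in> borel_measurable borel"
    unfolding \<Phi>_def by measurable
  define \<phi> where "\<phi> w = enn2real (\<Phi> w)" for w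
  have [measurable]: "\<phi> \<in> borel_measurable borel" unfolding \<phi>_def by measurable
  have \<phi>: "ennreal (\<phi> w) = \<Phi> w" "0 \<le> \<phi> w" "\<phi> w \<le> A" for w
  proof -
    show eq: "ennreal (\<phi> w) = \<Phi> w"
      unfolding \<phi>_def by (intro ennreal_enn2real le_less_trans [OF \<Phi>_le ennreal_less_top])
    show "0 \<le> \<phi> w" by (simp add: \<phi>_def)
    show "\<phi> w \<le> A" using \<Phi>_le [of w] A(2) by (simp add: eq [symmetric])
  qed
  \<comment> \<open>The part \<open>\<theta>\<close> of the exponent \<open>1 / p\<close> is used up by the uniform bound on \<open>\<phi>\<close>.\<close>
  have inner: "(\<integral>\<^sup>+y. (if norm (w - y) \<le> h then ennreal (g w * f y) else 0) \<partial>\<mu>)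
      \<le> ennreal (D powr (1 / p') * A powr \<theta>) * ennreal (g w * \<phi> w powr (1 / q'))" for w
  proof -
    have "(\<integral>\<^sup>+y. (if norm (w - y) \<le> h then ennreal (g w * f y) else 0) \<partial>\<mu>)
        = (\<integral>\<^sup>+y. ennreal (g w) * (ennreal (f y * 1) * indicator (B w) y) \<partial>\<mu>)"
      using g [of w] f by (intro nn_integral_cong) (auto simp: B_def ennreal_mult')
    also have "\<dots> = ennreal (g w) * (\<integral>\<^sup>+y\<in>B w. ennreal (f y * 1) \<partial>\<mu>)"
      by (intro nn_integral_cmult) auto
    also have "\<dots> \<le> ennreal (g w) * ennreal (\<phi> w powr (1 / p) * D powr (1 / p'))"
    proof (intro mult_left_mono set_nn_integral_Hoelder [OF p p'])
      show "(\<integral>\<^sup>+y\<in>B w. ennreal (f y powr p) \<partial>\<mu>) \<le> ennreal (\<phi> w)" using \<phi> \<Phi>_eq by simp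
      show "(\<integral>\<^sup>+y\<in>B w. ennreal (1 powr p') \<partial>\<mu>) \<le> ennreal D"
        using emeasure_closed_ball_le [OF h, of w] by (simp add: B_def D_def sets_borel)
    qed (use f \<phi> D in auto)
    also have "\<dots> = ennreal (g w * (\<phi> w powr (1 / p) * D powr (1 / p')))"
      using g [of w] by (simp add: ennreal_mult')
    also have "\<dots> \<le> ennreal (g w * (A powr \<theta> * \<phi> w powr (1 / q') * D powr (1 / p')))"
    proof (intro ennreal_leI mult_left_mono mult_right_mono)
      have "1 / p = \<theta> + 1 / q'" using \<theta> q' by simp
      then have "\<phi> w powr (1 / p) = \<phi> w powr \<theta> * \<phi> w powr (1 / q')"
        by (simp add: powr_add)
      also have "\<dots> \<le> A powr \<theta> * \<phi> w powr (1 / q')"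
        using \<phi> [of w] \<theta> by (intro mult_right_mono powr_mono2) auto
      finally show "\<phi> w powr (1 / p) \<le> A powr \<theta> * \<phi> w powr (1 / q')" .
    qed (use g in auto)
    also have "\<dots> = ennreal (D powr (1 / p') * A powr \<theta>) * ennreal (g w * \<phi> w powr (1 / q'))"
      by (subst ennreal_mult' [symmetric]) (simp_all add: mult_ac)
    finally show ?thesis .
  qed
  have int_\<phi>: "(\<integral>\<^sup>+w. ennreal (\<phi> w) \<partial>\<mu>) \<le> ennreal (D * A)"
  proof -
    have "(\<integral>\<^sup>+w. ennreal (\<phi> w) \<partial>\<mu>)
        = (\<integral>\<^sup>+w. \<integral>\<^sup>+y. (if norm (w - y) \<le> h then ennreal (f y powr p) else 0) \<partial>\<mu> \<partial>\<mu>)"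
      by (simp add: \<phi> \<Phi>_def)
    also have "\<dots> = (\<integral>\<^sup>+y. \<integral>\<^sup>+w. (if norm (w - y) \<le> h then ennreal (f y powr p) else 0) \<partial>\<mu> \<partial>\<mu>)"
      by (rule Fubini' [symmetric]) measurable
    also have "\<dots> = (\<integral>\<^sup>+y. \<integral>\<^sup>+w. ennreal (f y powr p) * indicator (B y) w \<partial>\<mu> \<partial>\<mu>)"
      by (intro nn_integral_cong) (auto simp: B_def norm_minus_commute)
    also have "\<dots> = (\<integral>\<^sup>+y. ennreal (f y powr p) * emeasure \<mu> (B y) \<partial>\<mu>)"
      by (intro nn_integral_cong) (simp add: nn_integral_cmult_indicator sets_borel)
    also have "\<dots> \<le> (\<integral>\<^sup>+y. ennreal (f y powr p) * ennreal D \<partial>\<mu>)"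
      using emeasure_closed_ball_le [OF h] unfolding B_def D_def
      by (intro nn_integral_mono mult_left_mono) auto
    also have "\<dots> = (\<integral>\<^sup>+y. ennreal (f y powr p) \<partial>\<mu>) * ennreal D"
      by (intro nn_integral_multc) measurable
    also have "\<dots> \<le> ennreal A * ennreal D" by (intro mult_right_mono A) auto
    finally show ?thesis using D A by (simp add: ennreal_mult' [symmetric] mult.commute)
  qed
  have "(\<integral>\<^sup>+w. \<integral>\<^sup>+y. (if norm (w - y) \<le> h then ennreal (g w * f y) else 0) \<partial>\<mu> \<partial>\<mu>)
      \<le> (\<integral>\<^sup>+w. ennreal (D powr (1 / p') * A powr \<theta>) * ennreal (g w * \<phi> w powr (1 / q')) \<partial>\<mu>)"
    by (intro nn_integral_mono inner)
  also have "\<dots> = ennreal (D powr (1 / p') * A powr \<theta>) * (\<integral>\<^sup>+w. ennreal (g w * \<phi> w powr (1 / q')) \<partial>\<mu>)"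
    by (intro nn_integral_cmult) measurable
  also have "\<dots> \<le> ennreal (D powr (1 / p') * A powr \<theta>) * ennreal (P powr (1 / q) * (D * A) powr (1 / q'))"
  proof (intro mult_left_mono nn_integral_Hoelder [OF q q'])
    have "(\<phi> w powr (1 / q')) powr q' = \<phi> w" for w
      using q' \<phi> [of w] by (simp add: powr_powr)
    then show "(\<integral>\<^sup>+w. ennreal ((\<phi> w powr (1 / q')) powr q') \<partial>\<mu>) \<le> ennreal (D * A)"
      using int_\<phi> by simp
  qed (use g P D A in auto)
  also have "\<dots> = ennreal (D powr (1 / p') * A powr \<theta> * (P powr (1 / q) * (D * A) powr (1 / q')))"
    by (simp add: ennreal_mult')
  also have "D powr (1 / p') * A powr \<theta> * (P powr (1 / q) * (D * A) powr (1 / q'))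
      = (D powr (1 / p') * D powr (1 / q')) * (A powr \<theta> * A powr (1 / q')) * P powr (1 / q)"
    using D A by (simp add: powr_mult mult_ac)
  also have "\<dots> = D powr (1 / p' + 1 / q') * A powr (\<theta> + 1 / q') * P powr (1 / q)"
    by (simp add: powr_add)
  also have "1 / p' + 1 / q' = 1 - \<theta>" using \<theta> p' q' by simp
  also have "\<theta> + 1 / q' = 1 / p" using \<theta> q' by simp
  finally show ?thesis by (simp add: D_def)
qed

text \<open>
  Dyadic decomposition of the distance. At distance \<open>h\<close> only the points outside the cube that lie
  within \<open>h\<close> of it matter, and there \<open>f\<close> has small \<open>L\<^sup>p\<close> norm; the resulting gain \<open>h powr (1 / p)\<close>
  beats the loss \<open>h powr (- n * \<theta>)\<close> exactly when \<open>0 < \<eta>\<close>.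
\<close>

lemma nn_integral_boundary_layer:
  fixes f g :: "real ^ 'd \<Rightarrow> real"
  assumes p: "1 < p" and q: "1 < q" and \<theta>: "\<theta> = 1 / p + 1 / q - 1" "0 \<le> \<theta>"
    and \<eta>: "\<eta> = 1 / p - n * \<theta>" "0 < \<eta>" and s: "0 < s"
    and f_meas [measurable]: "f \<in> borel_measurable borel" and g_meas [measurable]: "g \<in> borel_measurable borel"
    and f: "\<And>y. 0 \<le> f y" and g: "\<And>y. 0 \<le> g y"
    and V: "0 \<le> V" "\<And>h. 0 < h \<Longrightarrow>
      (\<integral>\<^sup>+y\<in>{y \<in> cube x (2 * s) - cube x s. infnorm (y - x) - s / 2 \<le> h}. ennreal (f y powr p) \<partial>\<mu>)
        \<le> ennreal (V * h / s)"
    and P: "0 \<le> P" "(\<integral>\<^sup>+y\<in>cube x s. ennreal (g y powr q) \<partial>\<mu>) \<le> ennreal P"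
  shows "(\<integral>\<^sup>+w\<in>cube x s. (\<integral>\<^sup>+y\<in>cube x (2 * s) - cube x s.
        ennreal (norm (w - y) powr (- n) * (g w * f y)) \<partial>\<mu>) \<partial>\<mu>)
    \<le> ennreal (2 powr n * (c\<^sub>0 * 2 powr n) powr (1 - \<theta>) * (2 * real CARD('d)) powr \<eta> / (1 - 2 powr (- \<eta>))
        * s powr (- n * \<theta>) * V powr (1 / p) * P powr (1 / q))"
proof -
  define L where "L = 2 * real CARD('d) * s"
  have d: "0 < real CARD('d)" by simp
  have L: "0 < L" using s unfolding L_def by (intro mult_pos_pos d) auto
  define h where "h j = L / 2 ^ j" for j :: nat
  have h: "0 < h j" for j using L by (simp add: h_def)
  define F where "F j y = f y * indicator {y \<in> cube x (2 * s) - cube x s. infnorm (y - x) - s / 2 \<le> h j} y" for j y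
  define G where "G y = g y * indicator (cube x s) y" for y
  have [measurable]: "F j \<in> borel_measurable borel" for j
  proof -
    have [measurable]: "(\<lambda>y. infnorm (y - x)) \<in> borel_measurable borel"
      by (intro borel_measurable_continuous_onI continuous_intros)
    show ?thesis unfolding F_def by measurable
  qed
  have [measurable]: "G \<in> borel_measurable borel" unfolding G_def by measurable
  have pointwise: "ennreal (norm (w - y) powr (- n) * (g w * f y)) * indicator (cube x (2 * s) - cube x s) y
        * indicator (cube x s) w
      \<le> (\<Sum>j. ennreal (2 powr n * h j powr (- n)) * (if norm (w - y) \<le> h j then ennreal (G w * F j y) else 0))"
    for w y
  proof (cases "w \<in> cube x s \<and> y \<in> cube x (2 * s) - cube x s")
    case True
    then have wy: "infnorm (w - x) \<le> s / 2" "infnorm (y - x) \<le> s" "w \<noteq> y"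
      by (auto simp: mem_cube_iff)
    have *: "infnorm (y - x) - infnorm (w - x) \<le> infnorm (w - y)"
      using absdiff_infnorm [of "y - x" "w - x"] infnorm_sub [of y w] by simp
    have "infnorm (w - y) \<le> infnorm (w - x) + infnorm (y - x)"
      using infnorm_triangle [of "w - x" "x - y"] infnorm_sub [of x y] by simp
    then have "infnorm (w - y) < 2 * s" using wy s by linarith
    then have "real CARD('d) * infnorm (w - y) < real CARD('d) * (2 * s)"
      using d by (intro mult_strict_left_mono) auto
    then have "norm (w - y) < L"
      using norm_le_card_infnorm [of "w - y"] unfolding L_def by linarith
    moreover have nz: "0 < norm (w - y)" using wy by simp
    ultimately have "1 < L / norm (w - y)" by simp
    then obtain j :: nat where "2 ^ j < L / norm (w - y)" "L / norm (w - y) \<le> 2 ^ Suc j"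
      using exists_dyadic_scale by blast
    then have j: "norm (w - y) \<le> h j" "h j / 2 \<le> norm (w - y)"
      using nz by (auto simp: h_def field_simps)
    have "infnorm (y - x) - s / 2 \<le> h j"
      using j(1) * wy infnorm_le_norm [of "w - y"] by linarith
    then have F: "F j y = f y" and G: "G w = g w"
      using True by (auto simp: F_def G_def)
    have "norm (w - y) powr (- n) \<le> (h j / 2) powr (- n)"
      using j h [of j] n_pos by (intro powr_mono2') auto
    also have "\<dots> = 2 powr n * h j powr (- n)"
      using h [of j] by (simp add: powr_divide powr_minus field_simps)
    finally have "norm (w - y) powr (- n) * (g w * f y) \<le> 2 powr n * h j powr (- n) * (G w * F j y)"
      unfolding F G by (intro mult_right_mono) (auto simp: f g)
    then have "ennreal (norm (w - y) powr (- n) * (g w * f y))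
        \<le> ennreal (2 powr n * h j powr (- n)) * ennreal (G w * F j y)"
      by (simp add: ennreal_mult' [symmetric] ennreal_leI)
    also have "\<dots> = (\<Sum>j\<in>{j}. ennreal (2 powr n * h j powr (- n)) * (if norm (w - y) \<le> h j then ennreal (G w * F j y) else 0))"
      using j by simp
    also have "\<dots> \<le> (\<Sum>j. ennreal (2 powr n * h j powr (- n)) * (if norm (w - y) \<le> h j then ennreal (G w * F j y) else 0))"
      by (rule sum_le_suminf) auto
    finally show ?thesis using True by simp
  qed auto
  have bound: "(\<integral>\<^sup>+w. \<integral>\<^sup>+y. (if norm (w - y) \<le> h j then ennreal (G w * F j y) else 0) \<partial>\<mu> \<partial>\<mu>)
      \<le> ennreal ((c\<^sub>0 * (2 * h j) powr n) powr (1 - \<theta>) * (V * h j / s) powr (1 / p) * P powr (1 / q))" for j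
  proof (rule nn_integral_local_Young [OF p q \<theta> h])
    have "(\<integral>\<^sup>+y. ennreal (F j y powr p) \<partial>\<mu>)
      = (\<integral>\<^sup>+y\<in>{y \<in> cube x (2 * s) - cube x s. infnorm (y - x) - s / 2 \<le> h j}. ennreal (f y powr p) \<partial>\<mu>)"
      by (intro nn_integral_cong) (auto simp: F_def indicator_def)
    then show "(\<integral>\<^sup>+y. ennreal (F j y powr p) \<partial>\<mu>) \<le> ennreal (V * h j / s)"
      using V(2) [OF h] by simp
    show "0 \<le> V * h j / s" using V h [of j] s by simp
    have "(\<integral>\<^sup>+y. ennreal (G y powr q) \<partial>\<mu>) = (\<integral>\<^sup>+y\<in>cube x s. ennreal (g y powr q) \<partial>\<mu>)"
      by (intro nn_integral_cong) (auto simp: G_def indicator_def)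
    then show "(\<integral>\<^sup>+y. ennreal (G y powr q) \<partial>\<mu>) \<le> ennreal P" using P by simp
    show "0 \<le> F j y" "0 \<le> G y" for y using f g by (auto simp: F_def G_def)
  qed (use P in auto)
  define C where "C = 2 powr n * (c\<^sub>0 * 2 powr n) powr (1 - \<theta>) * (2 * real CARD('d)) powr \<eta>
    * s powr (- n * \<theta>) * V powr (1 / p) * P powr (1 / q)"
  have C: "0 \<le> C" by (simp add: C_def)
  have coeff: "2 powr n * h j powr (- n)
      * ((c\<^sub>0 * (2 * h j) powr n) powr (1 - \<theta>) * (V * h j / s) powr (1 / p) * P powr (1 / q))
      = C * (2 powr (- \<eta>)) ^ j" for j
  proof -
    have hj: "h j = 2 * real CARD('d) * (s * (1 / 2) ^ j)"
      by (simp add: h_def L_def power_divide)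
    have "(c\<^sub>0 * (2 * h j) powr n) powr (1 - \<theta>) = (c\<^sub>0 * 2 powr n) powr (1 - \<theta>) * h j powr (n * (1 - \<theta>))"
      using c\<^sub>0_pos h [of j] by (simp add: powr_mult powr_powr)
    moreover have "(V * h j / s) powr (1 / p) = V powr (1 / p) * h j powr (1 / p) * s powr (- 1 / p)"
      using V s h [of j] by (simp add: powr_mult powr_divide powr_minus_divide)
    ultimately have "2 powr n * h j powr (- n)
      * ((c\<^sub>0 * (2 * h j) powr n) powr (1 - \<theta>) * (V * h j / s) powr (1 / p) * P powr (1 / q))
      = 2 powr n * (c\<^sub>0 * 2 powr n) powr (1 - \<theta>) * (h j powr (- n) * h j powr (n * (1 - \<theta>)) * h j powr (1 / p))
        * V powr (1 / p) * s powr (- 1 / p) * P powr (1 / q)"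
      by (simp only: mult_ac)
    also have "h j powr (- n) * h j powr (n * (1 - \<theta>)) * h j powr (1 / p) = h j powr \<eta>"
      by (simp add: powr_add [symmetric] \<eta> algebra_simps)
    also have "h j powr \<eta> = (2 * real CARD('d)) powr \<eta> * (s powr \<eta> * ((1 / 2) ^ j) powr \<eta>)"
      unfolding hj using s by (simp add: powr_mult)
    also have "((1 / 2) ^ j) powr \<eta> = ((2::real) powr (- \<eta>)) ^ j"
      by (simp add: powr_realpow [symmetric] powr_powr powr_minus_divide powr_divide mult.commute)
    finally have "2 powr n * h j powr (- n)
      * ((c\<^sub>0 * (2 * h j) powr n) powr (1 - \<theta>) * (V * h j / s) powr (1 / p) * P powr (1 / q))
      = 2 powr n * (c\<^sub>0 * 2 powr n) powr (1 - \<theta>) * (2 * real CARD('d)) powr \<eta>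
        * (s powr \<eta> * s powr (- 1 / p)) * V powr (1 / p) * P powr (1 / q) * (2 powr (- \<eta>)) ^ j"
      by (simp only: mult_ac)
    also have "s powr \<eta> * s powr (- 1 / p) = s powr (- n * \<theta>)"
      by (simp add: powr_add [symmetric] \<eta>)
    finally show ?thesis by (simp add: C_def)
  qed
  have "(\<integral>\<^sup>+w\<in>cube x s. (\<integral>\<^sup>+y\<in>cube x (2 * s) - cube x s.
        ennreal (norm (w - y) powr (- n) * (g w * f y)) \<partial>\<mu>) \<partial>\<mu>)
      = (\<integral>\<^sup>+w. \<integral>\<^sup>+y. ennreal (norm (w - y) powr (- n) * (g w * f y))
          * indicator (cube x (2 * s) - cube x s) y * indicator (cube x s) w \<partial>\<mu> \<partial>\<mu>)"
    by (intro nn_integral_cong nn_integral_multc [symmetric]) measurable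
  also have "\<dots> \<le> (\<integral>\<^sup>+w. \<integral>\<^sup>+y. (\<Sum>j. ennreal (2 powr n * h j powr (- n))
        * (if norm (w - y) \<le> h j then ennreal (G w * F j y) else 0)) \<partial>\<mu> \<partial>\<mu>)"
    by (intro nn_integral_mono pointwise)
  also have "\<dots> = (\<integral>\<^sup>+w. (\<Sum>j. \<integral>\<^sup>+y. ennreal (2 powr n * h j powr (- n))
        * (if norm (w - y) \<le> h j then ennreal (G w * F j y) else 0) \<partial>\<mu>) \<partial>\<mu>)"
    by (intro nn_integral_cong nn_integral_suminf) measurable
  also have "\<dots> = (\<Sum>j. \<integral>\<^sup>+w. \<integral>\<^sup>+y. ennreal (2 powr n * h j powr (- n))
        * (if norm (w - y) \<le> h j then ennreal (G w * F j y) else 0) \<partial>\<mu> \<partial>\<mu>)"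
    by (intro nn_integral_suminf) measurable
  also have "\<dots> = (\<Sum>j. \<integral>\<^sup>+w. ennreal (2 powr n * h j powr (- n))
        * (\<integral>\<^sup>+y. (if norm (w - y) \<le> h j then ennreal (G w * F j y) else 0) \<partial>\<mu>) \<partial>\<mu>)"
    by (intro suminf_cong nn_integral_cong nn_integral_cmult) measurable
  also have "\<dots> = (\<Sum>j. ennreal (2 powr n * h j powr (- n))
        * (\<integral>\<^sup>+w. \<integral>\<^sup>+y. (if norm (w - y) \<le> h j then ennreal (G w * F j y) else 0) \<partial>\<mu> \<partial>\<mu>))"
    by (intro suminf_cong nn_integral_cmult) measurable
  also have "\<dots> \<le> (\<Sum>j. ennreal (2 powr n * h j powr (- n))
        * ennreal ((c\<^sub>0 * (2 * h j) powr n) powr (1 - \<theta>) * (V * h j / s) powr (1 / p) * P powr (1 / q)))"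
    by (intro suminf_le mult_left_mono bound) auto
  also have "\<dots> = (\<Sum>j. ennreal (C * (2 powr (- \<eta>)) ^ j))"
    by (simp only: coeff ennreal_mult' [symmetric] powr_ge_zero mult_nonneg_nonneg zero_le_numeral)
  also have "\<dots> = ennreal (C / (1 - 2 powr (- \<eta>)))"
    using C \<eta> by (intro suminf_ennreal_geometric) (auto simp: powr_less_one)
  finally show ?thesis by (simp add: C_def mult_ac)
qed

end

section \<open>Truncated kernels\<close>

lemma continuous_on_cz_kernel:
  fixes K :: "real ^ 'd \<Rightarrow> real ^ 'd \<Rightarrow> complex"
  assumes K: "cz_kernel n C \<alpha> K" and \<alpha>: "0 < \<alpha>"
  shows "continuous_on {z. fst z \<noteq> snd z} (\<lambda>z. K (fst z) (snd z))"
proof -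
  have K2: "norm (K x y - K x' y) \<le> C * norm (x - x') powr \<alpha> * norm (x - y) powr (- n - \<alpha>)"
    if "x \<noteq> y" "2 * norm (x - x') \<le> norm (x - y)" for x x' y
    using K that unfolding cz_kernel_def by blast
  have K3: "norm (K x y - K x y') \<le> C * norm (y - y') powr \<alpha> * norm (x - y) powr (- n - \<alpha>)"
    if "x \<noteq> y" "2 * norm (y - y') \<le> norm (x - y)" for x y y'
    using K that unfolding cz_kernel_def by blast
  have "isCont (\<lambda>z. K (fst z) (snd z)) (x, y)" if "x \<noteq> y" for x y
  proof -
    let ?F = "at (x, y) :: ((real ^ 'd) \<times> (real ^ 'd)) filter"
    have lim1: "((\<lambda>z. norm (x - fst z)) \<longlongrightarrow> norm (x - fst (x, y))) ?F"
      and lim2: "((\<lambda>z. norm (y - snd z)) \<longlongrightarrow> norm (y - snd (x, y))) ?F"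
      and lim3: "((\<lambda>z. norm (fst z - y)) \<longlongrightarrow> norm (fst (x, y) - y)) ?F"
      by (intro tendsto_intros)+
    have pos: "0 < norm (x - y)" using that by simp
    have ev: "eventually (\<lambda>z. norm (x - fst z) < norm (x - y) / 4) ?F"
       "eventually (\<lambda>z. norm (y - snd z) < norm (x - y) / 4) ?F"
       "eventually (\<lambda>z. norm (x - y) / 2 < norm (fst z - y)) ?F"
      using order_tendstoD(2) [OF lim1, of "norm (x - y) / 4"]
        order_tendstoD(2) [OF lim2, of "norm (x - y) / 4"]
        order_tendstoD(1) [OF lim3, of "norm (x - y) / 2"] pos by auto
    have "eventually (\<lambda>z. norm (K (fst z) (snd z) - K x y)
        \<le> C * norm (y - snd z) powr \<alpha> * norm (fst z - y) powr (- n - \<alpha>)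
          + C * norm (x - fst z) powr \<alpha> * norm (x - y) powr (- n - \<alpha>)) ?F"
      using ev
    proof eventually_elim
      case (elim z)
      have "norm (K (fst z) y - K (fst z) (snd z))
          \<le> C * norm (y - snd z) powr \<alpha> * norm (fst z - y) powr (- n - \<alpha>)"
      proof (rule K3)
        show "fst z \<noteq> y" using elim pos by auto
        show "2 * norm (y - snd z) \<le> norm (fst z - y)" using elim by linarith
      qed
      moreover have "norm (K x y - K (fst z) y)
          \<le> C * norm (x - fst z) powr \<alpha> * norm (x - y) powr (- n - \<alpha>)"
        using elim norm_ge_zero [of "x - fst z"] by (intro K2 that) linarith
      ultimately show ?case
        using norm_triangle_ineq [of "K (fst z) (snd z) - K (fst z) y" "K (fst z) y - K x y"]
        by (simp add: norm_minus_commute)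
    qed
    moreover have "((\<lambda>z. C * norm (y - snd z) powr \<alpha> * norm (fst z - y) powr (- n - \<alpha>)
          + C * norm (x - fst z) powr \<alpha> * norm (x - y) powr (- n - \<alpha>)) \<longlongrightarrow>
          C * 0 powr \<alpha> * norm (x - y) powr (- n - \<alpha>) + C * 0 powr \<alpha> * norm (x - y) powr (- n - \<alpha>)) ?F"
    proof -
      have "((\<lambda>z. norm (x - fst z) powr \<alpha>) \<longlongrightarrow> 0 powr \<alpha>) ?F" "((\<lambda>z. norm (y - snd z) powr \<alpha>) \<longlongrightarrow> 0 powr \<alpha>) ?F"
        using lim1 lim2 \<alpha> by (intro tendsto_powr' [OF _ tendsto_const]; simp)+
      moreover have "((\<lambda>z. norm (fst z - y) powr (- n - \<alpha>)) \<longlongrightarrow> norm (x - y) powr (- n - \<alpha>)) ?F"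
        using lim3 pos by (intro tendsto_powr [OF _ tendsto_const]) auto
      ultimately show ?thesis by (intro tendsto_add tendsto_mult tendsto_const)
    qed
    ultimately have "((\<lambda>z. K (fst z) (snd z) - K x y) \<longlongrightarrow> 0) ?F"
      using Lim_null_comparison by force
    then show ?thesis
      unfolding isCont_def by (simp add: LIM_zero_iff)
  qed
  then show ?thesis
    by (intro continuous_at_imp_continuous_on) (auto simp: case_prod_beta)
qed

text \<open>
  The kernel, set to zero at distance at most \<open>\<delta>\<close> from the diagonal. For \<open>\<delta> > 0\<close>, unlike the kernel
  itself, it is bounded and measurable on the product, which makes Fubini's theorem applicable.
\<close>

definition cutoff :: "(real ^ 'd \<Rightarrow> real ^ 'd \<Rightarrow> complex) \<Rightarrow> real \<Rightarrow> real ^ 'd \<Rightarrow> real ^ 'd \<Rightarrow> complex" where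
  "cutoff K \<delta> x y = (if \<delta> < norm (x - y) then K x y else 0)"

lemma trunc_eq_cutoff: "trunc K \<mu> \<delta> f x = (\<integral>y. cutoff K \<delta> x y * f y \<partial>\<mu>)"
  unfolding trunc_def set_lebesgue_integral_def
  by (intro Bochner_Integration.integral_cong) (auto simp: cutoff_def)

lemma trunc_adj_eq_cutoff: "trunc_adj K \<mu> \<delta> f x = (\<integral>y. cutoff K \<delta> y x * f y \<partial>\<mu>)"
  unfolding trunc_adj_def set_lebesgue_integral_def
  by (intro Bochner_Integration.integral_cong) (auto simp: cutoff_def norm_minus_commute)

text \<open>A measure of polynomial growth together with a Calderon-Zygmund kernel of the same dimension.\<close>

locale cz_growth = growth_measure \<mu> n c\<^sub>0
  for \<mu> :: "(real ^ 'd) measure" and n c\<^sub>0 +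
  fixes K :: "real ^ 'd \<Rightarrow> real ^ 'd \<Rightarrow> complex" and C\<^sub>K \<alpha> :: real
  assumes kernel: "cz_kernel n C\<^sub>K \<alpha> K" and \<alpha>_pos: "0 < \<alpha>" and C\<^sub>K_pos: "0 < C\<^sub>K"
begin

lemma kernel_le: "x \<noteq> y \<Longrightarrow> norm (K x y) \<le> C\<^sub>K * norm (x - y) powr (- n)"
  using kernel unfolding cz_kernel_def by blast

lemma cutoff_measurable:
  assumes "0 < \<delta>"
  shows "(\<lambda>z. cutoff K \<delta> (fst z) (snd z)) \<in> borel_measurable (borel \<Otimes>\<^sub>M borel)"
proof -
  let ?A = "{z :: (real ^ 'd) \<times> (real ^ 'd). \<delta> < norm (fst z - snd z)}"
  have "open ?A" by (intro open_Collect_less continuous_intros)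
  moreover have "continuous_on ?A (\<lambda>z. K (fst z) (snd z))"
    by (rule continuous_on_subset [OF continuous_on_cz_kernel [OF kernel \<alpha>_pos]]) (use assms in auto)
  ultimately have "(\<lambda>z. if z \<in> ?A then K (fst z) (snd z) else 0) \<in> borel_measurable borel"
    by (intro borel_measurable_continuous_on_if) auto
  then show ?thesis by (simp add: cutoff_def borel_prod)
qed

lemma cutoff_measurable' [measurable (raw)]:
  assumes "0 < \<delta>" "f \<in> borel_measurable M" "g \<in> borel_measurable M"
  shows "(\<lambda>z. cutoff K \<delta> (f z) (g z)) \<in> borel_measurable M"
proof -
  have "(\<lambda>z. (f z, g z)) \<in> measurable M (borel \<Otimes>\<^sub>M borel)" using assms by measurable
  from measurable_compose [OF this cutoff_measurable [OF assms(1)]] show ?thesis by simp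
qed

lemma norm_cutoff_le:
  assumes "0 < \<delta>"
  shows "norm (cutoff K \<delta> x y) \<le> C\<^sub>K * \<delta> powr (- n)"
proof (cases "\<delta> < norm (x - y)")
  case True
  then have "norm (K x y) \<le> C\<^sub>K * norm (x - y) powr (- n)"
    using assms by (intro kernel_le) auto
  also have "\<dots> \<le> C\<^sub>K * \<delta> powr (- n)"
    using True assms n_pos C\<^sub>K_pos by (intro mult_left_mono powr_mono2') auto
  finally show ?thesis using True by (simp add: cutoff_def)
qed (use C\<^sub>K_pos in \<open>auto simp: cutoff_def\<close>)

lemma norm_cutoff_le_kernel:
  "0 < \<delta> \<Longrightarrow> norm (cutoff K \<delta> x y) \<le> C\<^sub>K * norm (x - y) powr (- n)"
  using kernel_le [of x y] C\<^sub>K_pos by (cases "x = y") (auto simp: cutoff_def)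

lemma integrable_cutoff_mult:
  assumes "0 < \<delta>" "integrable \<mu> f"
  shows "integrable \<mu> (\<lambda>y. cutoff K \<delta> x y * f y)" "integrable \<mu> (\<lambda>y. cutoff K \<delta> y x * f y)"
proof -
  have [measurable]: "f \<in> borel_measurable \<mu>" using assms by auto
  have m [measurable]: "(\<lambda>y. cutoff K \<delta> x y) \<in> borel_measurable \<mu>" "(\<lambda>y. cutoff K \<delta> y x) \<in> borel_measurable \<mu>"
    by (intro cutoff_measurable' assms; simp)+
  have i: "integrable \<mu> (\<lambda>y. complex_of_real (C\<^sub>K * \<delta> powr (- n)) * f y)" using assms by simp
  show "integrable \<mu> (\<lambda>y. cutoff K \<delta> x y * f y)" "integrable \<mu> (\<lambda>y. cutoff K \<delta> y x * f y)"
    by (rule Bochner_Integration.integrable_bound [OF i];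
        use assms norm_cutoff_le C\<^sub>K_pos in \<open>auto simp: norm_mult intro!: mult_right_mono\<close>)+
qed

text \<open>
  The smoothness condition covers the points \<open>y\<close> with \<open>norm (x - y) \<ge> 2 * norm (x - w)\<close>. For the
  remaining \<open>y\<close> outside the doubled cube both distances are comparable to \<open>s\<close>, and the size
  condition suffices.
\<close>

lemma kernel_difference_le:
  assumes s: "0 < s" and w: "w \<in> cube x s" and y: "y \<notin> cube x (2 * s)"
  shows "norm (K x y - K w y)
    \<le> C\<^sub>K * (1 + (2 * real CARD('d)) powr n) * (real CARD('d) * s) powr \<alpha> * norm (x - y) powr (- n - \<alpha>)"
proof -
  define d where "d = real CARD('d)"
  have d: "0 < d" by (simp add: d_def)
  have iw: "infnorm (x - w) \<le> s / 2" and iy: "s < infnorm (x - y)"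
    using w y by (auto simp: mem_cube_iff infnorm_sub [of x])
  have pos: "0 < norm (x - y)" using iy s infnorm_le_norm [of "x - y"] by linarith
  have "d * infnorm (x - w) \<le> d * (s / 2)" using iw d by (intro mult_left_mono) auto
  then have xw: "2 * norm (x - w) \<le> d * s"
    using norm_le_card_infnorm [of "x - w"] unfolding d_def by linarith
  have xw': "norm (x - w) \<le> d * s" using xw norm_ge_zero [of "x - w"] by linarith
  show ?thesis
  proof (cases "norm (x - y) \<ge> 2 * norm (x - w)")
    case True
    have "norm (K x y - K w y) \<le> C\<^sub>K * norm (x - w) powr \<alpha> * norm (x - y) powr (- n - \<alpha>)"
      using kernel True pos unfolding cz_kernel_def by force
    also have "\<dots> \<le> C\<^sub>K * (d * s) powr \<alpha> * norm (x - y) powr (- n - \<alpha>)"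
      using xw' C\<^sub>K_pos \<alpha>_pos
      by (intro mult_right_mono mult_left_mono powr_mono2) auto
    also have "\<dots> \<le> C\<^sub>K * (1 + (2 * d) powr n) * (d * s) powr \<alpha> * norm (x - y) powr (- n - \<alpha>)"
      using C\<^sub>K_pos by (intro mult_right_mono) auto
    finally show ?thesis by (simp add: d_def)
  next
    case False
    have "infnorm (x - y) \<le> infnorm (x - w) + infnorm (w - y)"
      using infnorm_triangle [of "x - w" "w - y"] by simp
    then have "infnorm (x - y) / 2 \<le> infnorm (w - y)" using iw iy by linarith
    then have "d * (infnorm (x - y) / 2) \<le> d * infnorm (w - y)" using d by (intro mult_left_mono) auto
    also have "\<dots> \<le> d * norm (w - y)" using d infnorm_le_norm by (intro mult_left_mono) auto
    finally have "norm (x - y) \<le> 2 * d * norm (w - y)"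
      using norm_le_card_infnorm [of "x - y"] unfolding d_def by linarith
    then have wy: "norm (x - y) / (2 * d) \<le> norm (w - y)" using d by (simp add: field_simps)
    have wy0: "0 < norm (x - y) / (2 * d)" using pos d by simp
    have "norm (K w y) \<le> C\<^sub>K * norm (w - y) powr (- n)"
      using wy wy0 by (intro kernel_le) auto
    also have "\<dots> \<le> C\<^sub>K * (norm (x - y) / (2 * d)) powr (- n)"
      using wy wy0 n_pos C\<^sub>K_pos by (intro mult_left_mono powr_mono2') auto
    also have "(norm (x - y) / (2 * d)) powr (- n) = (2 * d) powr n * norm (x - y) powr (- n)"
      using pos d by (simp add: powr_divide powr_minus field_simps)
    finally have "norm (K x y - K w y) \<le> C\<^sub>K * norm (x - y) powr (- n) + C\<^sub>K * ((2 * d) powr n * norm (x - y) powr (- n))"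
      using norm_triangle_ineq4 [of "K x y" "K w y"] kernel_le [of x y] pos by auto
    also have "\<dots> = C\<^sub>K * (1 + (2 * d) powr n) * norm (x - y) powr (\<alpha> + (- n - \<alpha>))"
      by (simp add: algebra_simps)
    also have "\<dots> = C\<^sub>K * (1 + (2 * d) powr n) * norm (x - y) powr \<alpha> * norm (x - y) powr (- n - \<alpha>)"
      by (simp only: powr_add mult.assoc)
    also have "\<dots> \<le> C\<^sub>K * (1 + (2 * d) powr n) * (d * s) powr \<alpha> * norm (x - y) powr (- n - \<alpha>)"
      using False xw C\<^sub>K_pos \<alpha>_pos by (intro mult_right_mono mult_left_mono powr_mono2) auto
    finally show ?thesis by (simp add: d_def)
  qed
qed

section \<open>Averaging against the test function\<close>

lemma integral_cutoff_commute:
  assumes \<delta>: "0 < \<delta>" and f: "integrable \<mu> f" and g: "integrable \<mu> g"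
  shows "(\<integral>w. g w * (\<integral>y. cutoff K \<delta> w y * f y \<partial>\<mu>) \<partial>\<mu>)
    = (\<integral>y. f y * (\<integral>w. cutoff K \<delta> w y * g w \<partial>\<mu>) \<partial>\<mu>)"
proof -
  interpret pair_sigma_finite \<mu> \<mu> by standard
  have [measurable]: "f \<in> borel_measurable \<mu>" "g \<in> borel_measurable \<mu>" using f g by auto
  have fg: "integrable (\<mu> \<Otimes>\<^sub>M \<mu>) (\<lambda>(w, y). g w * f y)"
  proof (rule Fubini_integrable)
    have "(\<integral>y. norm (case (w, y) of (w, y) \<Rightarrow> g w * f y) \<partial>\<mu>) = norm (g w) * (\<integral>y. norm (f y) \<partial>\<mu>)" for w
      by (simp add: norm_mult)
    then show "integrable \<mu> (\<lambda>w. \<integral>y. norm (case (w, y) of (w, y) \<Rightarrow> g w * f y) \<partial>\<mu>)"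
      using g by (simp add: integrable_norm)
  qed (use f in auto)
  have m [measurable]: "(\<lambda>z. cutoff K \<delta> (fst z) (snd z)) \<in> borel_measurable (\<mu> \<Otimes>\<^sub>M \<mu>)"
    by (intro cutoff_measurable' \<delta>) measurable
  have "integrable (\<mu> \<Otimes>\<^sub>M \<mu>) (\<lambda>z. complex_of_real (C\<^sub>K * \<delta> powr (- n)) * (case z of (w, y) \<Rightarrow> g w * f y))"
    using fg by simp
  then have "integrable (\<mu> \<Otimes>\<^sub>M \<mu>) (\<lambda>(w, y). cutoff K \<delta> w y * (g w * f y))"
    by (rule Bochner_Integration.integrable_bound)
      (use m norm_cutoff_le [OF \<delta>] C\<^sub>K_pos in \<open>auto simp: norm_mult case_prod_beta intro!: mult_right_mono\<close>)
  from Fubini_integral [OF this]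
  have "(\<integral>y. \<integral>w. cutoff K \<delta> w y * (g w * f y) \<partial>\<mu> \<partial>\<mu>) = (\<integral>w. \<integral>y. cutoff K \<delta> w y * (g w * f y) \<partial>\<mu> \<partial>\<mu>)" .
  moreover have "(\<integral>y. cutoff K \<delta> w y * (g w * f y) \<partial>\<mu>) = g w * (\<integral>y. cutoff K \<delta> w y * f y \<partial>\<mu>)" for w
    by (subst integral_mult_right_zero [symmetric]) (simp add: mult_ac)
  moreover have "(\<integral>w. cutoff K \<delta> w y * (g w * f y) \<partial>\<mu>) = f y * (\<integral>w. cutoff K \<delta> w y * g w \<partial>\<mu>)" for y
    by (subst integral_mult_right_zero [symmetric]) (simp add: mult_ac)
  ultimately show ?thesis by simp
qed

lemma integrable_mult_cutoff_integral:
  assumes \<delta>: "0 < \<delta>" and f: "integrable \<mu> f" and g: "integrable \<mu> g"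
  shows "integrable \<mu> (\<lambda>w. g w * (\<integral>y. cutoff K \<delta> w y * f y \<partial>\<mu>))"
proof -
  have [measurable]: "f \<in> borel_measurable \<mu>" "g \<in> borel_measurable \<mu>" using f g by auto
  have m [measurable]: "(\<lambda>z. cutoff K \<delta> (fst z) (snd z)) \<in> borel_measurable (\<mu> \<Otimes>\<^sub>M \<mu>)"
    by (intro cutoff_measurable' \<delta>) measurable
  have [measurable]: "(\<lambda>w. \<integral>y. cutoff K \<delta> w y * f y \<partial>\<mu>) \<in> borel_measurable \<mu>"
    by (intro borel_measurable_lebesgue_integral) (use m in \<open>simp add: case_prod_beta\<close>)
  define B where "B = C\<^sub>K * \<delta> powr (- n) * (\<integral>y. norm (f y) \<partial>\<mu>)"
  have B: "norm (\<integral>y. cutoff K \<delta> w y * f y \<partial>\<mu>) \<le> B" for w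
  proof -
    have "norm (\<integral>y. cutoff K \<delta> w y * f y \<partial>\<mu>) \<le> (\<integral>y. norm (cutoff K \<delta> w y * f y) \<partial>\<mu>)"
      by (rule integral_norm_bound)
    also have "\<dots> \<le> (\<integral>y. C\<^sub>K * \<delta> powr (- n) * norm (f y) \<partial>\<mu>)"
    proof (rule integral_mono)
      show "integrable \<mu> (\<lambda>y. norm (cutoff K \<delta> w y * f y))"
        by (intro integrable_norm integrable_cutoff_mult \<delta> f)
    qed (use f norm_cutoff_le [OF \<delta>] in \<open>auto simp: norm_mult intro!: mult_right_mono\<close>)
    finally show ?thesis by (simp add: B_def)
  qed
  have "integrable \<mu> (\<lambda>w. complex_of_real B * g w)" using g by simp
  then show ?thesis
  proof (rule Bochner_Integration.integrable_bound)
    show "AE w in \<mu>. norm (g w * (\<integral>y. cutoff K \<delta> w y * f y \<partial>\<mu>)) \<le> norm (complex_of_real B * g w)"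
    proof (rule AE_I2)
      fix w
      have "norm (\<integral>y. cutoff K \<delta> w y * f y \<partial>\<mu>) \<le> \<bar>B\<bar>" using B [of w] by linarith
      then show "norm (g w * (\<integral>y. cutoff K \<delta> w y * f y \<partial>\<mu>)) \<le> norm (complex_of_real B * g w)"
        by (simp add: norm_mult mult.commute [of "norm (g w)"] mult_right_mono)
    qed
  qed measurable
qed

text \<open>
  Let \<open>R\<close> be the cube. The part of \<open>T f (x)\<close> coming from outside the doubled cube is, up to a smoothness error, its
  average against \<open>g\<close>; by duality \<open>\<mu>(R)\<close> times this average is \<open>\<integral> g T f - \<integral> f T\<^sup>* g\<close>, with
  the last integral over the doubled cube.
\<close>

lemma norm_tail_integral_le:
  fixes f g :: "real ^ 'd \<Rightarrow> complex"
  assumes \<delta>: "0 < \<delta>" "\<delta> < s / 2" and f: "integrable \<mu> f" and g: "integrable \<mu> g"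
    and supp: "\<And>w. w \<notin> cube x s \<Longrightarrow> g w = 0"
    and avg: "(\<integral>w. g w \<partial>\<mu>) = complex_of_real (measure \<mu> (cube x s))" and pos: "0 < measure \<mu> (cube x s)"
    and a: "0 \<le> a\<^sub>1" "0 \<le> a\<^sub>2" "0 \<le> a\<^sub>3" "0 \<le> a\<^sub>4"
    and 1: "(\<integral>\<^sup>+y\<in>- cube x (2 * s). ennreal (norm (x - y) powr (- n - \<alpha>) * norm (f y)) \<partial>\<mu>)
        \<le> ennreal (s powr (- \<alpha>) * a\<^sub>1)"
    and 2: "(\<integral>\<^sup>+w\<in>cube x s. ennreal (norm (g w)) \<partial>\<mu>) \<le> ennreal (a\<^sub>2 * measure \<mu> (cube x s))"
    and 3: "(\<integral>\<^sup>+w\<in>cube x s. ennreal (norm (g w) * norm (trunc K \<mu> \<delta> f w)) \<partial>\<mu>)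
        \<le> ennreal (a\<^sub>3 * measure \<mu> (cube x s))"
    and 4: "(\<integral>\<^sup>+y\<in>cube x (2 * s). ennreal (norm (f y) * norm (trunc_adj K \<mu> \<delta> g y)) \<partial>\<mu>)
        \<le> ennreal (a\<^sub>4 * measure \<mu> (cube x s))"
  shows "norm (\<integral>y. indicator (- cube x (2 * s)) y *\<^sub>R (cutoff K \<delta> x y * f y) \<partial>\<mu>)
    \<le> C\<^sub>K * (1 + (2 * real CARD('d)) powr n) * real CARD('d) powr \<alpha> * a\<^sub>1 * a\<^sub>2 + a\<^sub>3 + a\<^sub>4"
proof -
  define c where "c = C\<^sub>K * (1 + (2 * real CARD('d)) powr n) * real CARD('d) powr \<alpha>"
  have c: "0 \<le> c" using C\<^sub>K_pos by (simp add: c_def)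
  have s: "0 < s" using \<delta> by simp
  define v where "v = measure \<mu> (cube x s)"
  let ?k = "cutoff K \<delta>"
  have [measurable]: "f \<in> borel_measurable \<mu>" "g \<in> borel_measurable \<mu>" using f g by auto
  have [measurable]: "- cube x (2 * s) \<in> sets \<mu>" by (simp add: sets_borel)
  define f1 where "f1 y = indicator (- cube x (2 * s)) y *\<^sub>R f y" for y
  define f2 where "f2 y = indicator (cube x (2 * s)) y *\<^sub>R f y" for y
  have f12: "integrable \<mu> f1" "integrable \<mu> f2" "f y = f1 y + f2 y" for y
    unfolding f1_def f2_def
    by (intro integrable_mult_indicator f; simp add: sets_borel)+ (simp add: indicator_def)
  define I1 where "I1 w = (\<integral>y. ?k w y * f1 y \<partial>\<mu>)" for w
  define I2 where "I2 w = (\<integral>y. ?k w y * f2 y \<partial>\<mu>)" for w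
  have I12: "trunc K \<mu> \<delta> f w = I1 w + I2 w" for w
    unfolding trunc_eq_cutoff I1_def I2_def f12(3) distrib_left
    by (intro Bochner_Integration.integral_add integrable_cutoff_mult \<delta> f12)
  have int1: "integrable \<mu> (\<lambda>w. g w * I1 w)" and int2: "integrable \<mu> (\<lambda>w. g w * I2 w)"
    unfolding I1_def I2_def by (intro integrable_mult_cutoff_integral \<delta> f12 g)+
  have intT: "integrable \<mu> (\<lambda>w. g w * trunc K \<mu> \<delta> f w)"
    unfolding I12 distrib_left using int1 int2 by auto
  have diff: "norm (I1 x - I1 w) \<le> c * a\<^sub>1" if w: "w \<in> cube x s" for w
  proof -
    have "I1 x - I1 w = (\<integral>y. ?k x y * f1 y - ?k w y * f1 y \<partial>\<mu>)"
      unfolding I1_def by (intro Bochner_Integration.integral_diff [symmetric] integrable_cutoff_mult \<delta> f12)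
    then have "ennreal (norm (I1 x - I1 w)) \<le> (\<integral>\<^sup>+y. ennreal (norm (?k x y * f1 y - ?k w y * f1 y)) \<partial>\<mu>)"
      by (simp, intro integral_norm_bound_ennreal Bochner_Integration.integrable_diff
          integrable_cutoff_mult \<delta> f12)
    also have "\<dots> \<le> (\<integral>\<^sup>+y. ennreal (c * s powr \<alpha>) *
        (ennreal (norm (x - y) powr (- n - \<alpha>) * norm (f y)) * indicator (- cube x (2 * s)) y) \<partial>\<mu>)"
    proof (rule nn_integral_mono)
      fix y
      show "ennreal (norm (?k x y * f1 y - ?k w y * f1 y)) \<le> ennreal (c * s powr \<alpha>) *
        (ennreal (norm (x - y) powr (- n - \<alpha>) * norm (f y)) * indicator (- cube x (2 * s)) y)"
      proof (cases "y \<in> cube x (2 * s)")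
        case False
        \<comment> \<open>Both points lie further than \<open>s / 2 > \<delta>\<close> from \<open>y\<close>, so the cut-off has no effect.\<close>
        have iw: "infnorm (y - w) \<le> norm (w - y)" "infnorm (y - x) \<le> norm (x - y)"
          using infnorm_le_norm [of "y - w"] infnorm_le_norm [of "y - x"] by (simp_all add: norm_minus_commute)
        have "infnorm (y - x) \<le> infnorm (y - w) + infnorm (w - x)"
          using infnorm_triangle [of "y - w" "w - x"] by simp
        then have "\<delta> < norm (w - y)" "\<delta> < norm (x - y)"
          using iw w False \<delta> by (auto simp: mem_cube_iff)
        then have "?k x y * f1 y - ?k w y * f1 y = (K x y - K w y) * f y"
          using False by (simp add: cutoff_def f1_def left_diff_distrib)
        then have "norm (?k x y * f1 y - ?k w y * f1 y)
            \<le> C\<^sub>K * (1 + (2 * real CARD('d)) powr n) * (real CARD('d) * s) powr \<alpha>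
                * norm (x - y) powr (- n - \<alpha>) * norm (f y)"
          using kernel_difference_le [OF s w False] by (simp add: norm_mult mult_right_mono)
        also have "\<dots> = c * s powr \<alpha> * (norm (x - y) powr (- n - \<alpha>) * norm (f y))"
          using s by (simp add: c_def powr_mult)
        finally show ?thesis using False c by (simp add: ennreal_mult' [symmetric] ennreal_leI)
      qed (simp add: f1_def)
    qed
    also have "\<dots> = ennreal (c * s powr \<alpha>) *
        (\<integral>\<^sup>+y\<in>- cube x (2 * s). ennreal (norm (x - y) powr (- n - \<alpha>) * norm (f y)) \<partial>\<mu>)"
      by (intro nn_integral_cmult) measurable
    also have "\<dots> \<le> ennreal (c * s powr \<alpha>) * ennreal (s powr (- \<alpha>) * a\<^sub>1)"
      by (intro mult_left_mono 1) auto
    also have "\<dots> = ennreal (c * s powr \<alpha> * (s powr (- \<alpha>) * a\<^sub>1))"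
      using c by (simp add: ennreal_mult')
    also have "c * s powr \<alpha> * (s powr (- \<alpha>) * a\<^sub>1) = c * a\<^sub>1"
      using s by (simp add: powr_minus field_simps)
    finally show ?thesis using c a by simp
  qed
  have "(\<integral>w. g w * I2 w \<partial>\<mu>) = (\<integral>y. f2 y * trunc_adj K \<mu> \<delta> g y \<partial>\<mu>)"
    unfolding I2_def trunc_adj_eq_cutoff using integral_cutoff_commute [OF \<delta>(1) f12(2) g] .
  moreover have "complex_of_real v * I1 x = (\<integral>w. g w * I1 x \<partial>\<mu>)"
    using avg by (simp add: v_def)
  moreover have "(\<integral>w. g w * I1 x \<partial>\<mu>)
      = (\<integral>w. g w * (I1 x - I1 w) + g w * trunc K \<mu> \<delta> f w - g w * I2 w \<partial>\<mu>)"
    by (intro Bochner_Integration.integral_cong) (auto simp: I12 algebra_simps)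
  moreover have int3: "integrable \<mu> (\<lambda>w. g w * (I1 x - I1 w))"
    unfolding right_diff_distrib using int1 g by auto
  ultimately have eq: "complex_of_real v * I1 x = (\<integral>w. g w * (I1 x - I1 w) \<partial>\<mu>)
      + (\<integral>w. g w * trunc K \<mu> \<delta> f w \<partial>\<mu>) - (\<integral>y. f2 y * trunc_adj K \<mu> \<delta> g y \<partial>\<mu>)"
    using intT int2 avg by (simp add: v_def)
  have n1: "norm (\<integral>w. g w * (I1 x - I1 w) \<partial>\<mu>) \<le> c * a\<^sub>1 * a\<^sub>2 * v"
  proof -
    have "ennreal (norm (\<integral>w. g w * (I1 x - I1 w) \<partial>\<mu>)) \<le> (\<integral>\<^sup>+w. ennreal (norm (g w * (I1 x - I1 w))) \<partial>\<mu>)"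
      by (intro integral_norm_bound_ennreal int3)
    also have "\<dots> \<le> (\<integral>\<^sup>+w. ennreal (c * a\<^sub>1) * (ennreal (norm (g w)) * indicator (cube x s) w) \<partial>\<mu>)"
    proof (rule nn_integral_mono)
      fix w
      show "ennreal (norm (g w * (I1 x - I1 w))) \<le> ennreal (c * a\<^sub>1) * (ennreal (norm (g w)) * indicator (cube x s) w)"
        using supp [of w] diff [of w] c a
        by (cases "w \<in> cube x s")
          (auto simp: norm_mult ennreal_mult' [symmetric] mult.commute [of "norm (g w)"] intro!: ennreal_leI mult_right_mono)
    qed
    also have "\<dots> = ennreal (c * a\<^sub>1) * (\<integral>\<^sup>+w\<in>cube x s. ennreal (norm (g w)) \<partial>\<mu>)"
      by (intro nn_integral_cmult) measurable
    also have "\<dots> \<le> ennreal (c * a\<^sub>1) * ennreal (a\<^sub>2 * v)"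
      unfolding v_def by (intro mult_left_mono 2) auto
    also have "\<dots> = ennreal (c * a\<^sub>1 * (a\<^sub>2 * v))" using c a by (simp add: ennreal_mult')
    finally show ?thesis using c a by (simp add: v_def mult_ac)
  qed
  have n2: "norm (\<integral>w. g w * trunc K \<mu> \<delta> f w \<partial>\<mu>) \<le> a\<^sub>3 * v"
  proof -
    have "ennreal (norm (\<integral>w. g w * trunc K \<mu> \<delta> f w \<partial>\<mu>)) \<le> (\<integral>\<^sup>+w. ennreal (norm (g w * trunc K \<mu> \<delta> f w)) \<partial>\<mu>)"
      by (intro integral_norm_bound_ennreal intT)
    also have "\<dots> = (\<integral>\<^sup>+w\<in>cube x s. ennreal (norm (g w) * norm (trunc K \<mu> \<delta> f w)) \<partial>\<mu>)"
      using supp by (intro nn_integral_cong) (auto simp: norm_mult indicator_def)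
    also have "\<dots> \<le> ennreal (a\<^sub>3 * v)" unfolding v_def by (rule 3)
    finally show ?thesis using a by (simp add: v_def)
  qed
  have n3: "norm (\<integral>y. f2 y * trunc_adj K \<mu> \<delta> g y \<partial>\<mu>) \<le> a\<^sub>4 * v"
  proof (cases "integrable \<mu> (\<lambda>y. f2 y * trunc_adj K \<mu> \<delta> g y)")
    case True
    then have "ennreal (norm (\<integral>y. f2 y * trunc_adj K \<mu> \<delta> g y \<partial>\<mu>)) \<le> (\<integral>\<^sup>+y. ennreal (norm (f2 y * trunc_adj K \<mu> \<delta> g y)) \<partial>\<mu>)"
      by (rule integral_norm_bound_ennreal)
    also have "\<dots> = (\<integral>\<^sup>+y\<in>cube x (2 * s). ennreal (norm (f y) * norm (trunc_adj K \<mu> \<delta> g y)) \<partial>\<mu>)"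
      by (intro nn_integral_cong) (auto simp: norm_mult indicator_def f2_def)
    also have "\<dots> \<le> ennreal (a\<^sub>4 * v)" unfolding v_def by (rule 4)
    finally show ?thesis using a by (simp add: v_def)
  qed (use a in \<open>simp add: not_integrable_integral_eq v_def\<close>)
  have "v * norm (I1 x) = norm (complex_of_real v * I1 x)"
    by (simp add: norm_mult v_def)
  also have "\<dots> \<le> c * a\<^sub>1 * a\<^sub>2 * v + a\<^sub>3 * v + a\<^sub>4 * v"
    unfolding eq by (intro norm_triangle_mono norm_triangle_le_diff add_mono order_trans [OF norm_triangle_ineq4] n1 n2 n3)
  also have "\<dots> = v * (c * a\<^sub>1 * a\<^sub>2 + a\<^sub>3 + a\<^sub>4)" by (simp add: algebra_simps)
  finally have "norm (I1 x) \<le> c * a\<^sub>1 * a\<^sub>2 + a\<^sub>3 + a\<^sub>4"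
    using pos by (simp add: v_def)
  moreover have "I1 x = (\<integral>y. indicator (- cube x (2 * s)) y *\<^sub>R (?k x y * f y) \<partial>\<mu>)"
    unfolding I1_def f1_def by simp
  ultimately show ?thesis by (simp add: c_def)
qed

end

section \<open>Maximal functions and admissible functions\<close>

lemma ennreal_le_mult_of_divide_le:
  fixes a b c :: ennreal
  assumes "a / b \<le> c" "b < \<infinity>" "c < \<infinity>"
  shows "a \<le> c * b"
proof (cases "b = 0")
  case True
  then show ?thesis using assms by (cases "a = 0") (auto simp: top_unique)
next
  case False
  then have "a = a / b * b"
    using assms by (simp add: ennreal_divide_times)
  also have "\<dots> \<le> c * b" by (intro mult_right_mono assms) auto
  finally show ?thesis .
qed

lemma (in growth_measure) nn_integral_le_of_max_cube_powr:
  assumes m: "max_cube_powr \<mu> s f x = ennreal m" "0 \<le> m" and s: "0 < s" and r: "0 < r"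
  shows "(\<integral>\<^sup>+y\<in>cube x r. ennreal (norm (f y) powr s) \<partial>\<mu>) \<le> ennreal (m powr s * measure \<mu> (cube x r))"
proof -
  define a where "a = max_cube \<mu> (\<lambda>y. norm (f y) powr s) x"
  have a: "a \<noteq> \<infinity>" using m by (auto simp: max_cube_powr_def ennreal_powr_def a_def)
  then have "ennreal (enn2real a powr (1 / s)) = ennreal m"
    using m by (simp add: max_cube_powr_def ennreal_powr_def a_def)
  then have "enn2real a powr (1 / s) = m" using m by simp
  then have ma: "m powr s = enn2real a" using s by (auto simp: powr_powr)
  have "(\<integral>\<^sup>+y\<in>cube x r. ennreal (norm (norm (f y) powr s)) \<partial>\<mu>) / emeasure \<mu> (cube x r) \<le> a"
    unfolding a_def max_cube_def using r by (intro SUP_upper) auto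
  then have "(\<integral>\<^sup>+y\<in>cube x r. ennreal (norm (f y) powr s) \<partial>\<mu>) \<le> a * emeasure \<mu> (cube x r)"
    using a emeasure_cube_finite [of x r]
    by (intro ennreal_le_mult_of_divide_le) (auto simp: less_top)
  also have "a = ennreal (m powr s)"
    using a by (simp add: ma ennreal_enn2real_if)
  finally show ?thesis by (simp add: emeasure_cube ennreal_mult')
qed

context growth_measure
begin

lemma admissibleD:
  assumes adm: "admissible \<mu> p B (cube z s) g" and p: "1 < p" and B: "0 < B"
  shows "integrable \<mu> g" and "\<And>w. w \<notin> cube z s \<Longrightarrow> g w = 0"
    and "(\<integral>w. g w \<partial>\<mu>) = complex_of_real (measure \<mu> (cube z s))"
    and "(\<integral>\<^sup>+w\<in>cube z s. ennreal (norm (g w) powr p) \<partial>\<mu>) \<le> ennreal (B * measure \<mu> (cube z s))"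
    and "(\<integral>\<^sup>+w\<in>cube z s. ennreal (norm (g w)) \<partial>\<mu>) \<le> ennreal (B powr (1 / p) * measure \<mu> (cube z s))"
proof -
  have [measurable]: "g \<in> borel_measurable \<mu>" using adm by (simp add: admissible_def)
  show supp: "g w = 0" if "w \<notin> cube z s" for w
    using adm that closure_subset [of "{x. g x \<noteq> 0}"] unfolding admissible_def by blast
  show Lp: "(\<integral>\<^sup>+w\<in>cube z s. ennreal (norm (g w) powr p) \<partial>\<mu>) \<le> ennreal (B * measure \<mu> (cube z s))"
    using adm B by (simp add: admissible_def emeasure_cube ennreal_mult')
  have "(\<integral>\<^sup>+w\<in>cube z s. ennreal (norm (g w)) \<partial>\<mu>) \<le> ennreal (B powr (1 / p)) * emeasure \<mu> (cube z s)"
  proof (rule set_nn_integral_le_of_powr [OF p])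
    show "(\<integral>\<^sup>+w\<in>cube z s. ennreal (norm (g w) powr p) \<partial>\<mu>)
        \<le> ennreal ((B powr (1 / p)) powr p) * emeasure \<mu> (cube z s)"
      using adm B p by (simp add: admissible_def powr_powr)
  qed (use emeasure_cube_finite in auto)
  then show L1: "(\<integral>\<^sup>+w\<in>cube z s. ennreal (norm (g w)) \<partial>\<mu>) \<le> ennreal (B powr (1 / p) * measure \<mu> (cube z s))"
    by (simp add: emeasure_cube ennreal_mult')
  have "(\<integral>\<^sup>+w. ennreal (norm (g w)) \<partial>\<mu>) = (\<integral>\<^sup>+w\<in>cube z s. ennreal (norm (g w)) \<partial>\<mu>)"
    using supp by (intro nn_integral_cong) (auto simp: indicator_def)
  then show "integrable \<mu> g"
    using L1 by (intro integrableI_bounded) (auto intro: le_less_trans)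
  have "(\<integral>w. g w \<partial>\<mu>) = (LINT w:cube z s|\<mu>. g w)"
    unfolding set_lebesgue_integral_def
    using supp by (intro Bochner_Integration.integral_cong) (auto simp: indicator_def)
  then show "(\<integral>w. g w \<partial>\<mu>) = complex_of_real (measure \<mu> (cube z s))"
    using adm by (simp add: admissible_def)
qed

end

section \<open>The dual pairing on the doubled cube\<close>

context cz_growth
begin

lemma trunc_measurable:
  assumes "0 < \<delta>" "f \<in> borel_measurable \<mu>"
  shows "trunc K \<mu> \<delta> f \<in> borel_measurable borel" "trunc_adj K \<mu> \<delta> f \<in> borel_measurable borel"
proof -
  have [measurable]: "f \<in> borel_measurable \<mu>" by fact
  have [measurable]: "(\<lambda>z. cutoff K \<delta> (fst z) (snd z)) \<in> borel_measurable (\<mu> \<Otimes>\<^sub>M \<mu>)"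
    "(\<lambda>z. cutoff K \<delta> (snd z) (fst z)) \<in> borel_measurable (\<mu> \<Otimes>\<^sub>M \<mu>)"
    by (intro cutoff_measurable' assms; measurable)+
  have "(\<lambda>w. \<integral>y. cutoff K \<delta> w y * f y \<partial>\<mu>) \<in> borel_measurable \<mu>"
    "(\<lambda>w. \<integral>y. cutoff K \<delta> y w * f y \<partial>\<mu>) \<in> borel_measurable \<mu>"
    by (intro borel_measurable_lebesgue_integral; simp add: case_prod_beta)+
  then show "trunc K \<mu> \<delta> f \<in> borel_measurable borel" "trunc_adj K \<mu> \<delta> f \<in> borel_measurable borel"
    unfolding trunc_eq_cutoff [abs_def] trunc_adj_eq_cutoff [abs_def]
    by (simp_all cong: measurable_cong_sets add: sets_borel)
qed

lemma nn_integral_dual_le: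
  fixes f g :: "real ^ 'd \<Rightarrow> complex"
  assumes p: "1 < p" and \<delta>: "0 < \<delta>" and [measurable]: "f \<in> borel_measurable \<mu>" "g \<in> borel_measurable \<mu>"
    and m: "0 \<le> m" and A: "0 < A" and D: "0 < D"
    and f: "(\<integral>\<^sup>+y\<in>cube x r. ennreal (norm (f y) powr p) \<partial>\<mu>) \<le> ennreal (m powr p * measure \<mu> (cube x r))"
    and g: "(\<integral>\<^sup>+y\<in>cube x r. ennreal (norm (trunc_adj K \<mu> \<delta> g y) powr conj_exp p) \<partial>\<mu>)
        \<le> ennreal A * emeasure \<mu> (cube x s)"
    and D_le: "measure \<mu> (cube x r) \<le> D * measure \<mu> (cube x s)"
  shows "(\<integral>\<^sup>+y\<in>cube x r. ennreal (norm (f y) * norm (trunc_adj K \<mu> \<delta> g y)) \<partial>\<mu>)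
    \<le> ennreal (D powr (1 / p) * A powr (1 / conj_exp p) * m * measure \<mu> (cube x s))"
proof -
  define v where "v = measure \<mu> (cube x s)"
  have v: "0 \<le> v" by (simp add: v_def)
  have [measurable]: "trunc_adj K \<mu> \<delta> g \<in> borel_measurable borel"
    by (intro trunc_measurable \<delta>) measurable
  have "(\<integral>\<^sup>+y\<in>cube x r. ennreal (norm (f y) * norm (trunc_adj K \<mu> \<delta> g y)) \<partial>\<mu>)
    \<le> ennreal ((m powr p * (D * v)) powr (1 / p) * (A * v) powr (1 / conj_exp p))"
  proof (rule set_nn_integral_Hoelder [OF p conj_exp_conjugate [OF p]])
    have "m powr p * measure \<mu> (cube x r) \<le> m powr p * (D * v)"
      unfolding v_def by (intro mult_left_mono D_le) auto
    then show "(\<integral>\<^sup>+y\<in>cube x r. ennreal (norm (f y) powr p) \<partial>\<mu>) \<le> ennreal (m powr p * (D * v))"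
      using f ennreal_leI order_trans by blast
    show "(\<integral>\<^sup>+y\<in>cube x r. ennreal (norm (trunc_adj K \<mu> \<delta> g y) powr conj_exp p) \<partial>\<mu>) \<le> ennreal (A * v)"
      using g A by (simp add: emeasure_cube ennreal_mult' v_def)
  qed (use A D v in auto)
  also have "(m powr p * (D * v)) powr (1 / p) * (A * v) powr (1 / conj_exp p)
      = D powr (1 / p) * A powr (1 / conj_exp p) * m * (v powr (1 / p) * v powr (1 / conj_exp p))"
    using A D v m p by (simp add: powr_mult powr_powr)
  also have "v powr (1 / p) * v powr (1 / conj_exp p) = v"
    using conj_exp_conjugate [OF p] v by (simp flip: powr_add)
  finally show ?thesis by (simp add: v_def)
qed

text \<open>Off the cube the adjoint is estimated by the size of the kernel alone.\<close>

lemma nn_integral_dual_off_cube_le: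
  fixes f g :: "real ^ 'd \<Rightarrow> complex"
  assumes \<delta>: "0 < \<delta>" and [measurable]: "f \<in> borel_measurable \<mu>" and g: "integrable \<mu> g"
    and supp: "\<And>w. w \<notin> cube x s \<Longrightarrow> g w = 0"
  shows "(\<integral>\<^sup>+y\<in>cube x (2 * s) - cube x s. ennreal (norm (f y) * norm (trunc_adj K \<mu> \<delta> g y)) \<partial>\<mu>)
    \<le> ennreal C\<^sub>K * (\<integral>\<^sup>+w\<in>cube x s. (\<integral>\<^sup>+y\<in>cube x (2 * s) - cube x s.
        ennreal (norm (w - y) powr (- n) * (norm (g w) * norm (f y))) \<partial>\<mu>) \<partial>\<mu>)"
proof -
  interpret pair_sigma_finite \<mu> \<mu> by standard
  have [measurable]: "g \<in> borel_measurable \<mu>" using g by auto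
  define H where "H w y = ennreal (norm (w - y) powr (- n) * (norm (g w) * norm (f y)))
      * indicator (cube x (2 * s) - cube x s) y * indicator (cube x s) w" for w y
  have H [measurable]: "(\<lambda>(w, y). H w y) \<in> borel_measurable (\<mu> \<Otimes>\<^sub>M \<mu>)"
    unfolding H_def by measurable
  have "(\<integral>\<^sup>+y\<in>cube x (2 * s) - cube x s. ennreal (norm (f y) * norm (trunc_adj K \<mu> \<delta> g y)) \<partial>\<mu>)
      \<le> (\<integral>\<^sup>+y. ennreal C\<^sub>K * (\<integral>\<^sup>+w. H w y \<partial>\<mu>) \<partial>\<mu>)"
  proof (rule nn_integral_mono)
    fix y
    show "ennreal (norm (f y) * norm (trunc_adj K \<mu> \<delta> g y)) * indicator (cube x (2 * s) - cube x s) y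
      \<le> ennreal C\<^sub>K * (\<integral>\<^sup>+w. H w y \<partial>\<mu>)"
    proof (cases "y \<in> cube x (2 * s) - cube x s")
      case True
      have "ennreal (norm (trunc_adj K \<mu> \<delta> g y)) \<le> (\<integral>\<^sup>+w. ennreal (norm (cutoff K \<delta> w y * g w)) \<partial>\<mu>)"
        unfolding trunc_adj_eq_cutoff by (intro integral_norm_bound_ennreal integrable_cutoff_mult \<delta> g)
      then have "ennreal (norm (f y)) * ennreal (norm (trunc_adj K \<mu> \<delta> g y))
          \<le> ennreal (norm (f y)) * (\<integral>\<^sup>+w. ennreal (norm (cutoff K \<delta> w y * g w)) \<partial>\<mu>)"
        by (intro mult_left_mono) auto
      also have "\<dots> = (\<integral>\<^sup>+w. ennreal (norm (f y)) * ennreal (norm (cutoff K \<delta> w y * g w)) \<partial>\<mu>)"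
        using integrable_cutoff_mult(2) [OF \<delta> g, of y] by (intro nn_integral_cmult [symmetric]) auto
      also have "\<dots> \<le> (\<integral>\<^sup>+w. ennreal C\<^sub>K * H w y \<partial>\<mu>)"
      proof (rule nn_integral_mono)
        fix w
        show "ennreal (norm (f y)) * ennreal (norm (cutoff K \<delta> w y * g w)) \<le> ennreal C\<^sub>K * H w y"
        proof (cases "w \<in> cube x s")
          case w: True
          have "norm (f y) * (norm (cutoff K \<delta> w y) * norm (g w))
              \<le> norm (f y) * (C\<^sub>K * norm (w - y) powr (- n) * norm (g w))"
            by (intro mult_left_mono mult_right_mono norm_cutoff_le_kernel \<delta>) auto
          also have "\<dots> = C\<^sub>K * (norm (w - y) powr (- n) * (norm (g w) * norm (f y)))" by simp
          finally have "norm (f y) * norm (cutoff K \<delta> w y * g w)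
              \<le> C\<^sub>K * (norm (w - y) powr (- n) * (norm (g w) * norm (f y)))" by (simp add: norm_mult)
          then have "ennreal (norm (f y) * norm (cutoff K \<delta> w y * g w))
              \<le> ennreal (C\<^sub>K * (norm (w - y) powr (- n) * (norm (g w) * norm (f y))))"
            by (rule ennreal_leI)
          then show ?thesis using True w C\<^sub>K_pos by (simp add: H_def ennreal_mult')
        qed (simp add: supp)
      qed
      also have "\<dots> = ennreal C\<^sub>K * (\<integral>\<^sup>+w. H w y \<partial>\<mu>)"
        by (intro nn_integral_cmult) measurable
      finally show ?thesis using True by (simp add: ennreal_mult')
    qed simp
  qed
  also have "\<dots> = ennreal C\<^sub>K * (\<integral>\<^sup>+y. \<integral>\<^sup>+w. H w y \<partial>\<mu> \<partial>\<mu>)"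
    by (intro nn_integral_cmult) measurable
  also have "(\<integral>\<^sup>+y. \<integral>\<^sup>+w. H w y \<partial>\<mu> \<partial>\<mu>) = (\<integral>\<^sup>+w. \<integral>\<^sup>+y. H w y \<partial>\<mu> \<partial>\<mu>)"
    by (rule Fubini' [OF H])
  also have "\<dots> = (\<integral>\<^sup>+w\<in>cube x s. (\<integral>\<^sup>+y\<in>cube x (2 * s) - cube x s.
        ennreal (norm (w - y) powr (- n) * (norm (g w) * norm (f y))) \<partial>\<mu>) \<partial>\<mu>)"
    unfolding H_def by (intro nn_integral_cong nn_integral_multc) measurable
  finally show ?thesis .
qed

end

text \<open>
  The constant in the bound for the pairing of \<open>f\<close> with the adjoint of the test function. The
  first case is the one where the adjoint is controlled on the cube only. Here \<open>d\<close> is the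
  dimension, \<open>c\<close> the growth constant on cubes, \<open>C\<close> the kernel constant, \<open>B\<close> bounds the test
  functions and \<open>A\<close> their images.
\<close>

definition dual_const :: "real \<Rightarrow> real \<Rightarrow> real \<Rightarrow> real \<Rightarrow> real \<Rightarrow> real \<Rightarrow> real \<Rightarrow> real \<Rightarrow> real \<Rightarrow> real" where
  "dual_const d n c p q C b B A =
    (if 1 / p + 1 / q < 1 + 1 / (n * p)
     then let \<theta> = 1 / p + 1 / q - 1; \<eta> = 1 / p - n * \<theta> in
       A powr (1 / conj_exp p)
       + C * (2 powr n * (c * 2 powr n) powr (1 - \<theta>) * (2 * d) powr \<eta> / (1 - 2 powr (- \<eta>)))
         * c powr \<theta> * (160 * b) powr (1 / p) * B powr (1 / q)
     else b powr (1 / p) * A powr (1 / conj_exp p))"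

text \<open>In the first case the exponent \<open>\<eta>\<close> of the boundary layer estimate is positive.\<close>

lemma layer_exponent_pos:
  fixes n p q :: real
  assumes "0 < n" "1 < p" "1 / p + 1 / q < 1 + 1 / (n * p)"
  shows "0 < 1 / p - n * (1 / p + 1 / q - 1)"
proof -
  have "n * (1 / p + 1 / q - 1) < n * (1 / (n * p))"
    using assms by (intro mult_strict_left_mono) auto
  then show ?thesis using assms by simp
qed

lemma dual_const_nonneg:
  assumes "0 < n" "1 < p" "0 < C"
  shows "0 \<le> dual_const d n c p q C b B A"
proof (cases "1 / p + 1 / q < 1 + 1 / (n * p)")
  case True
  have "0 < 1 / p - n * (1 / p + 1 / q - 1)"
    using assms True by (intro layer_exponent_pos)
  then have "2 powr (- (1 / p - n * (1 / p + 1 / q - 1))) < (1::real)"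
    by (intro powr_less_one) auto
  then show ?thesis
    using True assms unfolding dual_const_def Let_def
    by (auto intro!: add_nonneg_nonneg mult_nonneg_nonneg divide_nonneg_nonneg)
next
  case False
  then show ?thesis by (simp add: dual_const_def)
qed

context cz_growth
begin

text \<open>
  If the adjoint is controlled on the doubled cube this is Hoelder's inequality. Otherwise the
  annulus \<open>cube x (2 * s) - cube x s\<close> is treated by the boundary layer estimate; the hypothesis
  \<open>layer\<close> says that the boundary of the cube is thin for \<open>norm (f y) powr p\<close>.
\<close>

lemma nn_integral_dual_double_cube_le:
  fixes f g :: "real ^ 'd \<Rightarrow> complex"
  assumes p: "1 < p" "p \<le> 2" and q: "1 < q" "q \<le> 2" and B: "0 < B" and A: "0 < A" and b: "0 < b"
    and \<delta>: "0 < \<delta>" and \<rho>: "0 < \<rho>" "s \<in> {\<rho>..2 * \<rho>}" and m: "0 \<le> m"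
    and f: "integrable \<mu> f" and adm: "admissible \<mu> q B (cube x s) g"
    and Fp: "\<And>r. 0 < r \<Longrightarrow> (\<integral>\<^sup>+y\<in>cube x r. ennreal (norm (f y) powr p) \<partial>\<mu>)
      \<le> ennreal (m powr p * measure \<mu> (cube x r))"
    and dbl: "measure \<mu> (cube x (5 * \<rho>)) \<le> b * measure \<mu> (cube x s)"
    and layer: "\<And>h. 0 < h \<Longrightarrow> (\<integral>\<^sup>+y\<in>{y \<in> cube x (5 * \<rho>). \<bar>infnorm (y - x) - s / 2\<bar> \<le> h}.
        ennreal (norm (f y) powr p) \<partial>\<mu>) \<le> ennreal (80 / \<rho> * h * (m powr p * (b * measure \<mu> (cube x s))))"
    and test: "if 1 / p + 1 / q < 1 + 1 / (n * p)
      then (\<integral>\<^sup>+y\<in>cube x s. ennreal (norm (trunc_adj K \<mu> \<delta> g y) powr conj_exp p) \<partial>\<mu>)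
        \<le> ennreal A * emeasure \<mu> (cube x s)
      else (\<integral>\<^sup>+y\<in>cube x (2 * s). ennreal (norm (trunc_adj K \<mu> \<delta> g y) powr conj_exp p) \<partial>\<mu>)
        \<le> ennreal A * emeasure \<mu> (cube x s)"
  shows "(\<integral>\<^sup>+y\<in>cube x (2 * s). ennreal (norm (f y) * norm (trunc_adj K \<mu> \<delta> g y)) \<partial>\<mu>)
    \<le> ennreal (dual_const (real CARD('d)) n c\<^sub>0 p q C\<^sub>K b B A * m * measure \<mu> (cube x s))"
proof -
  have s: "0 < s" "s \<le> 2 * \<rho>" "\<rho> \<le> s" using \<rho> by auto
  define v where "v = measure \<mu> (cube x s)"
  have v: "0 \<le> v" by (simp add: v_def)
  have [measurable]: "f \<in> borel_measurable \<mu>" using f by auto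
  note g = admissibleD [OF adm q(1) B]
  have [measurable]: "g \<in> borel_measurable \<mu>" using g(1) by auto
  have [measurable]: "trunc_adj K \<mu> \<delta> g \<in> borel_measurable borel"
    by (intro trunc_measurable \<delta>) measurable
  show ?thesis
  proof (cases "1 / p + 1 / q < 1 + 1 / (n * p)")
    case False
    have "measure \<mu> (cube x (2 * s)) \<le> measure \<mu> (cube x (5 * \<rho>))"
      using s \<rho> by (intro measure_cube_mono) auto
    then have "measure \<mu> (cube x (2 * s)) \<le> b * measure \<mu> (cube x s)" using dbl by linarith
    then have "(\<integral>\<^sup>+y\<in>cube x (2 * s). ennreal (norm (f y) * norm (trunc_adj K \<mu> \<delta> g y)) \<partial>\<mu>)
      \<le> ennreal (b powr (1 / p) * A powr (1 / conj_exp p) * m * measure \<mu> (cube x s))"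
      using False test s by (intro nn_integral_dual_le p \<delta> m A b Fp) auto
    then show ?thesis using False by (simp add: dual_const_def)
  next
    case True
    define \<theta> where "\<theta> = 1 / p + 1 / q - 1"
    define \<eta> where "\<eta> = 1 / p - n * \<theta>"
    define H where "H = 2 powr n * (c\<^sub>0 * 2 powr n) powr (1 - \<theta>) * (2 * real CARD('d)) powr \<eta> / (1 - 2 powr (- \<eta>))"
    have "1 / 2 \<le> 1 / p" "1 / 2 \<le> 1 / q" using p q by (auto simp: field_simps)
    then have \<theta>: "0 \<le> \<theta>" unfolding \<theta>_def by linarith
    have \<eta>: "0 < \<eta>"
      unfolding \<eta>_def \<theta>_def by (intro layer_exponent_pos n_pos p True)
    have "2 powr (- \<eta>) < 1" using \<eta> by (intro powr_less_one) auto
    then have H: "0 \<le> H" unfolding H_def by (intro divide_nonneg_nonneg mult_nonneg_nonneg) auto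
    have inner: "(\<integral>\<^sup>+y\<in>cube x s. ennreal (norm (f y) * norm (trunc_adj K \<mu> \<delta> g y)) \<partial>\<mu>)
      \<le> ennreal (1 powr (1 / p) * A powr (1 / conj_exp p) * m * measure \<mu> (cube x s))"
      using True test s by (intro nn_integral_dual_le p \<delta> m A Fp) auto
    have outer: "(\<integral>\<^sup>+y\<in>cube x (2 * s) - cube x s. ennreal (norm (f y) * norm (trunc_adj K \<mu> \<delta> g y)) \<partial>\<mu>)
      \<le> ennreal (C\<^sub>K * H * c\<^sub>0 powr \<theta> * (160 * b) powr (1 / p) * B powr (1 / q) * m * v)"
    proof -
      define V where "V = 160 * (m powr p * (b * v))"
      have V: "0 \<le> V" using m b v by (simp add: V_def)
      have "(\<integral>\<^sup>+w\<in>cube x s. (\<integral>\<^sup>+y\<in>cube x (2 * s) - cube x s.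
          ennreal (norm (w - y) powr (- n) * (norm (g w) * norm (f y))) \<partial>\<mu>) \<partial>\<mu>)
          \<le> ennreal (H * s powr (- n * \<theta>) * V powr (1 / p) * (B * v) powr (1 / q))"
        unfolding H_def
      proof (rule nn_integral_boundary_layer [OF p(1) q(1) \<theta>_def \<theta> \<eta>_def \<eta> s(1)])
        fix h :: real assume h: "0 < h"
        have "(\<integral>\<^sup>+y\<in>{y \<in> cube x (2 * s) - cube x s. infnorm (y - x) - s / 2 \<le> h}. ennreal (norm (f y) powr p) \<partial>\<mu>)
          \<le> (\<integral>\<^sup>+y\<in>{y \<in> cube x (5 * \<rho>). \<bar>infnorm (y - x) - s / 2\<bar> \<le> h}. ennreal (norm (f y) powr p) \<partial>\<mu>)"
          using s \<rho> by (intro nn_integral_mono_set) (auto simp: mem_cube_iff)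
        also have "\<dots> \<le> ennreal (80 / \<rho> * h * (m powr p * (b * v)))"
          unfolding v_def by (rule layer [OF h])
        also have "\<dots> \<le> ennreal (V * h / s)"
        proof (rule ennreal_leI)
          have "80 / \<rho> \<le> 160 / s" using s \<rho> by (simp add: field_simps)
          then have "80 / \<rho> * (h * (m powr p * (b * v))) \<le> 160 / s * (h * (m powr p * (b * v)))"
            using h b v by (intro mult_right_mono) auto
          then show "80 / \<rho> * h * (m powr p * (b * v)) \<le> V * h / s" by (simp add: V_def mult_ac)
        qed
        finally show "(\<integral>\<^sup>+y\<in>{y \<in> cube x (2 * s) - cube x s. infnorm (y - x) - s / 2 \<le> h}.
            ennreal (norm (f y) powr p) \<partial>\<mu>) \<le> ennreal (V * h / s)" .
      next
        show "(\<integral>\<^sup>+w\<in>cube x s. ennreal (norm (g w) powr q) \<partial>\<mu>) \<le> ennreal (B * v)"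
          unfolding v_def by (rule g(4))
      qed (use V B v in auto)
      also have "\<dots> \<le> ennreal (H * (c\<^sub>0 powr \<theta> * (160 * b) powr (1 / p) * B powr (1 / q) * m * v))"
      proof (rule ennreal_leI)
        have "s powr (- n * \<theta>) * v powr \<theta> \<le> s powr (- n * \<theta>) * (c\<^sub>0 * s powr n) powr \<theta>"
          using measure_cube_le [OF s(1), of x] v \<theta> unfolding v_def by (intro mult_left_mono powr_mono2) auto
        also have "(c\<^sub>0 * s powr n) powr \<theta> = c\<^sub>0 powr \<theta> * s powr (n * \<theta>)"
          using c\<^sub>0_pos by (simp add: powr_mult powr_powr)
        finally have sv: "s powr (- n * \<theta>) * v powr \<theta> \<le> c\<^sub>0 powr \<theta>"
          using s by (simp add: powr_minus field_simps)
        have "V powr (1 / p) = (160 * b) powr (1 / p) * m * v powr (1 / p)"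
          using m b v p by (simp add: V_def powr_mult powr_powr)
        then have "H * s powr (- n * \<theta>) * V powr (1 / p) * (B * v) powr (1 / q)
            = H * ((160 * b) powr (1 / p) * B powr (1 / q) * m * (s powr (- n * \<theta>) * (v powr (1 / p) * v powr (1 / q))))"
          using B v by (simp add: powr_mult)
        also have "v powr (1 / p) * v powr (1 / q) = v powr (\<theta> + 1)"
          by (simp add: \<theta>_def flip: powr_add)
        also have "\<dots> = v powr \<theta> * v" using v by (simp add: powr_add)
        also have "s powr (- n * \<theta>) * (v powr \<theta> * v) \<le> c\<^sub>0 powr \<theta> * v"
          using sv v mult_right_mono [of _ _ v] by (simp add: mult.assoc [symmetric])
        finally have "H * s powr (- n * \<theta>) * V powr (1 / p) * (B * v) powr (1 / q)
            \<le> H * ((160 * b) powr (1 / p) * B powr (1 / q) * m * (c\<^sub>0 powr \<theta> * v))"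
          using H m by (simp add: mult_left_mono)
        then show "H * s powr (- n * \<theta>) * V powr (1 / p) * (B * v) powr (1 / q)
            \<le> H * (c\<^sub>0 powr \<theta> * (160 * b) powr (1 / p) * B powr (1 / q) * m * v)"
          by (simp only: mult_ac)
      qed
      finally have le: "(\<integral>\<^sup>+w\<in>cube x s. (\<integral>\<^sup>+y\<in>cube x (2 * s) - cube x s.
          ennreal (norm (w - y) powr (- n) * (norm (g w) * norm (f y))) \<partial>\<mu>) \<partial>\<mu>)
          \<le> ennreal (H * (c\<^sub>0 powr \<theta> * (160 * b) powr (1 / p) * B powr (1 / q) * m * v))" .
      have "(\<integral>\<^sup>+y\<in>cube x (2 * s) - cube x s. ennreal (norm (f y) * norm (trunc_adj K \<mu> \<delta> g y)) \<partial>\<mu>)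
        \<le> ennreal C\<^sub>K * (\<integral>\<^sup>+w\<in>cube x s. (\<integral>\<^sup>+y\<in>cube x (2 * s) - cube x s.
          ennreal (norm (w - y) powr (- n) * (norm (g w) * norm (f y))) \<partial>\<mu>) \<partial>\<mu>)"
        by (rule nn_integral_dual_off_cube_le [OF \<delta> _ g(1) g(2)]) simp_all
      also have "\<dots> \<le> ennreal C\<^sub>K * ennreal (H * (c\<^sub>0 powr \<theta> * (160 * b) powr (1 / p) * B powr (1 / q) * m * v))"
        by (intro mult_left_mono le) auto
      finally show ?thesis using C\<^sub>K_pos by (simp add: ennreal_mult' [symmetric] mult.assoc)
    qed
    have "(\<integral>\<^sup>+y\<in>cube x (2 * s). ennreal (norm (f y) * norm (trunc_adj K \<mu> \<delta> g y)) \<partial>\<mu>)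
      \<le> (\<integral>\<^sup>+y. ennreal (norm (f y) * norm (trunc_adj K \<mu> \<delta> g y)) * indicator (cube x s) y
          + ennreal (norm (f y) * norm (trunc_adj K \<mu> \<delta> g y)) * indicator (cube x (2 * s) - cube x s) y \<partial>\<mu>)"
      by (intro nn_integral_mono) (auto simp: indicator_def)
    also have "\<dots> = (\<integral>\<^sup>+y\<in>cube x s. ennreal (norm (f y) * norm (trunc_adj K \<mu> \<delta> g y)) \<partial>\<mu>)
        + (\<integral>\<^sup>+y\<in>cube x (2 * s) - cube x s. ennreal (norm (f y) * norm (trunc_adj K \<mu> \<delta> g y)) \<partial>\<mu>)"
      by (intro nn_integral_add) auto
    also have "\<dots> \<le> ennreal (1 powr (1 / p) * A powr (1 / conj_exp p) * m * measure \<mu> (cube x s))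
        + ennreal (C\<^sub>K * H * c\<^sub>0 powr \<theta> * (160 * b) powr (1 / p) * B powr (1 / q) * m * v)"
      by (intro add_mono inner outer)
    also have "\<dots> = ennreal (A powr (1 / conj_exp p) * m * v
        + C\<^sub>K * H * c\<^sub>0 powr \<theta> * (160 * b) powr (1 / p) * B powr (1 / q) * m * v)"
      using m v C\<^sub>K_pos H by (simp add: v_def flip: ennreal_plus)
    also have "A powr (1 / conj_exp p) * m * v
        + C\<^sub>K * H * c\<^sub>0 powr \<theta> * (160 * b) powr (1 / p) * B powr (1 / q) * m * v
        = dual_const (real CARD('d)) n c\<^sub>0 p q C\<^sub>K b B A * m * v"
      using True by (simp add: dual_const_def Let_def H_def \<theta>_def \<eta>_def algebra_simps)
    finally show ?thesis by (simp add: v_def)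
  qed
qed

section \<open>The estimate at a doubling cube\<close>

text \<open>
  The cube of side \<open>\<rho>\<close> is replaced by a larger one with thin boundary. It is still
  doubling because the hypothesis compares with the tenfold cube, which contains all cubes
  \<open>cube x (5 * s)\<close> with \<open>s \<le> 2 * \<rho>\<close>.
\<close>

lemma doubling_cube_estimate:
  fixes f :: "real ^ 'd \<Rightarrow> complex"
  assumes p: "1 < p" "p \<le> 2" and q: "1 < q" "q \<le> 2" and B: "0 < B" and A: "0 < A" and b: "0 < b"
    and t: "160 \<le> t" and \<delta>: "0 < \<delta>" "2 * \<delta> < \<rho>" and m: "0 \<le> m" and m': "0 \<le> m'"
    and f: "integrable \<mu> f"
    and Fp: "\<And>r. 0 < r \<Longrightarrow> (\<integral>\<^sup>+y\<in>cube x r. ennreal (norm (f y) powr p) \<partial>\<mu>)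
      \<le> ennreal (m powr p * measure \<mu> (cube x r))"
    and F1: "\<And>r. 0 < r \<Longrightarrow> (\<integral>\<^sup>+y\<in>cube x r. ennreal (norm (f y)) \<partial>\<mu>)
      \<le> ennreal (m * measure \<mu> (cube x r))"
    and dbl: "measure \<mu> (cube x (10 * \<rho>)) < b * measure \<mu> (cube x \<rho>)"
    and Tq: "\<And>s. s \<in> {\<rho>..2 * \<rho>} \<Longrightarrow>
      (\<integral>\<^sup>+w\<in>cube x s. ennreal (norm (trunc K \<mu> \<delta> f w) powr conj_exp q) \<partial>\<mu>)
      \<le> ennreal (m' powr conj_exp q * measure \<mu> (cube x s))"
    and test: "\<And>s. s \<in> {\<rho>..2 * \<rho>} \<Longrightarrow> doubling \<mu> 5 b x s \<Longrightarrow> small_boundary \<mu> t x s \<Longrightarrow>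
      \<exists>g. admissible \<mu> q B (cube x s) g \<and>
       (if 1 / p + 1 / q < 1 + 1 / (n * p)
        then (\<integral>\<^sup>+y\<in>cube x s. ennreal (norm (trunc_adj K \<mu> \<delta> g y) powr conj_exp p) \<partial>\<mu>)
          \<le> ennreal A * emeasure \<mu> (cube x s)
        else (\<integral>\<^sup>+y\<in>cube x (2 * s). ennreal (norm (trunc_adj K \<mu> \<delta> g y) powr conj_exp p) \<partial>\<mu>)
          \<le> ennreal A * emeasure \<mu> (cube x s))"
  shows "\<exists>s\<in>{\<rho>..2 * \<rho>}. norm (\<integral>y. indicator (- cube x (2 * s)) y *\<^sub>R (cutoff K \<delta> x y * f y) \<partial>\<mu>)
    \<le> C\<^sub>K * (1 + (2 * real CARD('d)) powr n) * real CARD('d) powr \<alpha>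
        * (c\<^sub>0 * 4 powr n / (1 - 2 powr (- \<alpha>)) * m) * B powr (1 / q)
      + B powr (1 / q) * m' + dual_const (real CARD('d)) n c\<^sub>0 p q C\<^sub>K b B A * m"
proof -
  have \<rho>: "0 < \<rho>" using \<delta> by simp
  have f_meas [measurable]: "f \<in> borel_measurable borel"
    using f sets_borel by (metis borel_measurable_integrable measurable_cong_sets)
  define V where "V = m powr p * measure \<mu> (cube x (5 * \<rho>))"
  obtain s where s: "s \<in> {\<rho>..2 * \<rho>}" and sb: "small_boundary \<mu> t x s"
    and thin: "\<And>h. 0 < h \<Longrightarrow> (\<integral>\<^sup>+y\<in>{y \<in> cube x (5 * \<rho>). \<bar>infnorm (y - x) - s / 2\<bar> \<le> h}.
        ennreal (norm (f y) powr p) \<partial>\<mu>) \<le> ennreal (80 / \<rho> * h * V)"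
    using exists_cube_small_boundary [OF \<rho> t, of "\<lambda>y. norm (f y) powr p" V x] Fp [of "5 * \<rho>"] \<rho> m
    unfolding V_def by auto
  have s': "0 < s" "s \<le> 2 * \<rho>" "\<rho> \<le> s" using s \<rho> by auto
  define v where "v = measure \<mu> (cube x s)"
  have "measure \<mu> (cube x (5 * s)) \<le> measure \<mu> (cube x (10 * \<rho>))"
    "measure \<mu> (cube x (5 * \<rho>)) \<le> measure \<mu> (cube x (10 * \<rho>))"
    using s' \<rho> by (auto intro: measure_cube_mono)
  moreover have "b * measure \<mu> (cube x \<rho>) \<le> b * v"
    unfolding v_def using s' b by (intro mult_left_mono measure_cube_mono) auto
  ultimately have dbl': "measure \<mu> (cube x (5 * s)) \<le> b * v" "measure \<mu> (cube x (5 * \<rho>)) \<le> b * v" "0 < b * v"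
    using dbl measure_nonneg [of \<mu> "cube x (10 * \<rho>)"] by linarith+
  have v: "0 < v" using dbl'(3) b by (simp add: zero_less_mult_iff)
  have "doubling \<mu> 5 b x s"
    unfolding doubling_def using dbl'(1) b
    by (simp add: emeasure_cube v_def ennreal_mult' [symmetric] ennreal_leI)
  then obtain g where adm: "admissible \<mu> q B (cube x s) g" and adj: "if 1 / p + 1 / q < 1 + 1 / (n * p)
        then (\<integral>\<^sup>+y\<in>cube x s. ennreal (norm (trunc_adj K \<mu> \<delta> g y) powr conj_exp p) \<partial>\<mu>)
          \<le> ennreal A * emeasure \<mu> (cube x s)
        else (\<integral>\<^sup>+y\<in>cube x (2 * s). ennreal (norm (trunc_adj K \<mu> \<delta> g y) powr conj_exp p) \<partial>\<mu>)
          \<le> ennreal A * emeasure \<mu> (cube x s)"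
    using test [OF s _ sb] by blast
  note g = admissibleD [OF adm q(1) B]
  have [measurable]: "g \<in> borel_measurable \<mu>" using g(1) by auto
  have \<alpha>1: "2 powr (- \<alpha>) < 1" using \<alpha>_pos by (intro powr_less_one) auto
  have "norm (\<integral>y. indicator (- cube x (2 * s)) y *\<^sub>R (cutoff K \<delta> x y * f y) \<partial>\<mu>)
    \<le> C\<^sub>K * (1 + (2 * real CARD('d)) powr n) * real CARD('d) powr \<alpha>
        * (c\<^sub>0 * 4 powr n / (1 - 2 powr (- \<alpha>)) * m) * B powr (1 / q)
      + B powr (1 / q) * m' + dual_const (real CARD('d)) n c\<^sub>0 p q C\<^sub>K b B A * m"
  proof (rule norm_tail_integral_le [OF \<delta>(1) _ f g(1-3)])
    show "\<delta> < s / 2" using \<delta> s' by simp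
    show "0 < measure \<mu> (cube x s)" using v by (simp add: v_def)
    show "0 \<le> c\<^sub>0 * 4 powr n / (1 - 2 powr (- \<alpha>)) * m" using c\<^sub>0_pos m \<alpha>1 by simp
    show "0 \<le> dual_const (real CARD('d)) n c\<^sub>0 p q C\<^sub>K b B A * m"
      using m by (intro mult_nonneg_nonneg dual_const_nonneg n_pos p C\<^sub>K_pos) auto
    show "(\<integral>\<^sup>+y\<in>- cube x (2 * s). ennreal (norm (x - y) powr (- n - \<alpha>) * norm (f y)) \<partial>\<mu>)
        \<le> ennreal (s powr (- \<alpha>) * (c\<^sub>0 * 4 powr n / (1 - 2 powr (- \<alpha>)) * m))"
      using nn_integral_tail_le [of "\<lambda>y. norm (f y)" m x, OF _ _ m F1 s'(1) \<alpha>_pos] by (simp add: mult_ac)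
    show "(\<integral>\<^sup>+w\<in>cube x s. ennreal (norm (g w)) \<partial>\<mu>) \<le> ennreal (B powr (1 / q) * measure \<mu> (cube x s))"
      by (rule g(5))
    show "(\<integral>\<^sup>+w\<in>cube x s. ennreal (norm (g w) * norm (trunc K \<mu> \<delta> f w)) \<partial>\<mu>)
        \<le> ennreal (B powr (1 / q) * m' * measure \<mu> (cube x s))"
    proof -
      have [measurable]: "trunc K \<mu> \<delta> f \<in> borel_measurable borel"
        using f by (intro trunc_measurable \<delta>) auto
      have "(\<integral>\<^sup>+w\<in>cube x s. ennreal (norm (g w) * norm (trunc K \<mu> \<delta> f w)) \<partial>\<mu>)
          \<le> ennreal ((B * v) powr (1 / q) * (m' powr conj_exp q * v) powr (1 / conj_exp q))"
        unfolding v_def using g(4) Tq [OF s] B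
        by (intro set_nn_integral_Hoelder [OF q(1) conj_exp_conjugate [OF q(1)]]) auto
      also have "(B * v) powr (1 / q) * (m' powr conj_exp q * v) powr (1 / conj_exp q)
          = B powr (1 / q) * m' * (v powr (1 / q) * v powr (1 / conj_exp q))"
        using B v m' conj_exp_conjugate(1) [OF q(1)] by (simp add: powr_mult powr_powr)
      also have "v powr (1 / q) * v powr (1 / conj_exp q) = v"
        using conj_exp_conjugate [OF q(1)] v by (simp flip: powr_add)
      finally show ?thesis by (simp add: v_def)
    qed
    show "(\<integral>\<^sup>+y\<in>cube x (2 * s). ennreal (norm (f y) * norm (trunc_adj K \<mu> \<delta> g y)) \<partial>\<mu>)
        \<le> ennreal (dual_const (real CARD('d)) n c\<^sub>0 p q C\<^sub>K b B A * m * measure \<mu> (cube x s))"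
    proof (rule nn_integral_dual_double_cube_le [OF p q B A b \<delta>(1) \<rho> s m f adm Fp _ _ adj])
      show "measure \<mu> (cube x (5 * \<rho>)) \<le> b * measure \<mu> (cube x s)" using dbl'(2) by (simp add: v_def)
      fix h :: real assume h: "0 < h"
      have "80 / \<rho> * h * V \<le> 80 / \<rho> * h * (m powr p * (b * measure \<mu> (cube x s)))"
        unfolding V_def using dbl'(2) h \<rho> by (intro mult_left_mono) (auto simp: v_def)
      then show "(\<integral>\<^sup>+y\<in>{y \<in> cube x (5 * \<rho>). \<bar>infnorm (y - x) - s / 2\<bar> \<le> h}.
          ennreal (norm (f y) powr p) \<partial>\<mu>) \<le> ennreal (80 / \<rho> * h * (m powr p * (b * measure \<mu> (cube x s))))"
        using thin [OF h] ennreal_leI order_trans by blast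
    qed
  qed (use m' in auto)
  then show ?thesis using s by blast
qed

end

section \<open>Selection of the scale\<close>

context cz_growth
begin

lemma norm_integral_cutoff_le:
  fixes f :: "real ^ 'd \<Rightarrow> complex"
  assumes \<epsilon>: "0 < \<epsilon>" and f: "integrable \<mu> f" and S [measurable]: "S \<in> sets borel"
    and le: "(\<integral>\<^sup>+y\<in>{y \<in> S. \<epsilon> < norm (x - y)}. ennreal (norm (x - y) powr (- n) * norm (f y)) \<partial>\<mu>) \<le> ennreal a"
    and a: "0 \<le> a"
  shows "norm (\<integral>y. indicator S y *\<^sub>R (cutoff K \<epsilon> x y * f y) \<partial>\<mu>) \<le> C\<^sub>K * a"
proof -
  have [measurable]: "f \<in> borel_measurable \<mu>" using f by auto
  have S': "S \<in> sets \<mu>" by (simp add: sets_borel S)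
  have "ennreal (norm (\<integral>y. indicator S y *\<^sub>R (cutoff K \<epsilon> x y * f y) \<partial>\<mu>))
      \<le> (\<integral>\<^sup>+y. ennreal (norm (indicator S y *\<^sub>R (cutoff K \<epsilon> x y * f y))) \<partial>\<mu>)"
    by (intro integral_norm_bound_ennreal integrable_mult_indicator S' integrable_cutoff_mult \<epsilon> f)
  also have "\<dots> \<le> (\<integral>\<^sup>+y. ennreal C\<^sub>K * (ennreal (norm (x - y) powr (- n) * norm (f y))
      * indicator {y \<in> S. \<epsilon> < norm (x - y)} y) \<partial>\<mu>)"
  proof (rule nn_integral_mono)
    fix y
    show "ennreal (norm (indicator S y *\<^sub>R (cutoff K \<epsilon> x y * f y)))
      \<le> ennreal C\<^sub>K * (ennreal (norm (x - y) powr (- n) * norm (f y)) * indicator {y \<in> S. \<epsilon> < norm (x - y)} y)"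
    proof (cases "y \<in> S \<and> \<epsilon> < norm (x - y)")
      case True
      have "norm (cutoff K \<epsilon> x y) * norm (f y) \<le> C\<^sub>K * norm (x - y) powr (- n) * norm (f y)"
        by (intro mult_right_mono norm_cutoff_le_kernel \<epsilon>) auto
      then show ?thesis using True C\<^sub>K_pos
        by (simp add: norm_mult ennreal_mult' [symmetric] ennreal_leI mult.assoc)
    qed (auto simp: cutoff_def)
  qed
  also have "\<dots> = ennreal C\<^sub>K * (\<integral>\<^sup>+y\<in>{y \<in> S. \<epsilon> < norm (x - y)}.
      ennreal (norm (x - y) powr (- n) * norm (f y)) \<partial>\<mu>)"
    by (intro nn_integral_cmult) measurable
  also have "\<dots> \<le> ennreal C\<^sub>K * ennreal a" by (intro mult_left_mono le) auto
  also have "\<dots> = ennreal (C\<^sub>K * a)" using C\<^sub>K_pos by (simp add: ennreal_mult')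
  finally show ?thesis using a C\<^sub>K_pos by simp
qed

text \<open>
  If no doubling scale occurs below a scale comparable to the side length of \<open>Q\<close>, then the rest
  of the integral is taken over points at distance comparable to that side length.
\<close>

lemma trunc_large_scale_le:
  fixes f :: "real ^ 'd \<Rightarrow> complex"
  assumes \<epsilon>: "0 < \<epsilon>" and f: "integrable \<mu> f" and m: "0 \<le> m" and \<tau>: "0 < \<tau>" and l: "0 < l"
    and F1: "\<And>r. 0 < r \<Longrightarrow> (\<integral>\<^sup>+y\<in>cube x r. ennreal (norm (f y)) \<partial>\<mu>)
      \<le> ennreal (m * measure \<mu> (cube x r))"
    and supp: "\<And>y. y \<notin> cube x (2 * l) \<Longrightarrow> f y = 0"
    and \<rho>: "\<tau> * l \<le> 5 * \<rho>" and a: "0 \<le> a"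
    and near: "(\<integral>\<^sup>+y\<in>{y \<in> cube x (10 * \<rho>). \<epsilon> < norm (x - y)}.
      ennreal (norm (x - y) powr (- n) * norm (f y)) \<partial>\<mu>) \<le> ennreal a"
  shows "norm (trunc K \<mu> \<epsilon> f x) \<le> C\<^sub>K * (a + (2 / \<tau>) powr n * c\<^sub>0 * m)"
proof -
  have \<tau>l: "0 < \<tau> * l" using \<tau> l by simp
  have [measurable]: "f \<in> borel_measurable \<mu>" using f by auto
  have f_meas [measurable]: "f \<in> borel_measurable borel"
    using f sets_borel by (metis borel_measurable_integrable measurable_cong_sets)
  define h where "h y = ennreal (norm (x - y) powr (- n) * norm (f y))" for y
  have [measurable]: "h \<in> borel_measurable borel" unfolding h_def by measurable
  let ?S = "{y \<in> cube x (10 * \<rho>). \<epsilon> < norm (x - y)}"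
  let ?T = "cube x (2 * l) - cube x (10 * \<rho>)"
  have T: "(\<integral>\<^sup>+y\<in>?T. h y \<partial>\<mu>) \<le> ennreal ((\<tau> * l) powr (- n) * (m * measure \<mu> (cube x (2 * l))))"
    unfolding h_def
  proof (rule nn_integral_norm_powr_le [OF _ F1])
    show "\<tau> * l \<le> norm (x - y)" if "y \<in> ?T" for y
      using norm_ge_outside_cube [of y x "10 * \<rho>"] that \<rho> by simp
  qed (use \<tau>l l n_pos in auto)
  have T': "(\<tau> * l) powr (- n) * (m * measure \<mu> (cube x (2 * l))) \<le> (2 / \<tau>) powr n * c\<^sub>0 * m"
  proof -
    have "(\<tau> * l) powr (- n) * (m * measure \<mu> (cube x (2 * l)))
        \<le> (\<tau> * l) powr (- n) * (m * (c\<^sub>0 * (2 * l) powr n))"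
      using measure_cube_le [of "2 * l" x] l m by (intro mult_left_mono) auto
    also have "\<dots> = (2 / \<tau>) powr n * c\<^sub>0 * m"
      using \<tau> l by (simp add: powr_mult powr_divide powr_minus field_simps)
    finally show ?thesis .
  qed
  have "(\<integral>\<^sup>+y\<in>{y \<in> UNIV. \<epsilon> < norm (x - y)}. h y \<partial>\<mu>)
      \<le> (\<integral>\<^sup>+y. h y * indicator ?S y + h y * indicator ?T y \<partial>\<mu>)"
  proof (rule nn_integral_mono)
    fix y
    show "h y * indicator {y \<in> UNIV. \<epsilon> < norm (x - y)} y \<le> h y * indicator ?S y + h y * indicator ?T y"
      using supp [of y] by (cases "y \<in> cube x (2 * l)") (auto simp: h_def indicator_def)
  qed
  also have "\<dots> = (\<integral>\<^sup>+y\<in>?S. h y \<partial>\<mu>) + (\<integral>\<^sup>+y\<in>?T. h y \<partial>\<mu>)"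
    by (intro nn_integral_add) auto
  also have "\<dots> \<le> ennreal a + ennreal ((2 / \<tau>) powr n * c\<^sub>0 * m)"
    using near by (intro add_mono order_trans [OF T] ennreal_leI T') (simp add: h_def)
  also have "\<dots> = ennreal (a + (2 / \<tau>) powr n * c\<^sub>0 * m)"
    using a c\<^sub>0_pos m by (simp flip: ennreal_plus)
  finally have "norm (\<integral>y. indicator UNIV y *\<^sub>R (cutoff K \<epsilon> x y * f y) \<partial>\<mu>)
      \<le> C\<^sub>K * (a + (2 / \<tau>) powr n * c\<^sub>0 * m)"
    using a c\<^sub>0_pos m by (intro norm_integral_cutoff_le \<epsilon> f) (auto simp: h_def)
  then show ?thesis by (simp add: trunc_eq_cutoff)
qed

lemma trunc_split_at_cube:
  fixes f :: "real ^ 'd \<Rightarrow> complex"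
  assumes \<epsilon>: "0 < \<delta>" "\<delta> < \<epsilon>" "\<epsilon> \<le> s" and f: "integrable \<mu> f"
  shows "trunc K \<mu> \<epsilon> f x = (\<integral>y. indicator (cube x (2 * s)) y *\<^sub>R (cutoff K \<epsilon> x y * f y) \<partial>\<mu>)
    + (\<integral>y. indicator (- cube x (2 * s)) y *\<^sub>R (cutoff K \<delta> x y * f y) \<partial>\<mu>)"
proof -
  have \<epsilon>0: "0 < \<epsilon>" using \<epsilon> by simp
  have "trunc K \<mu> \<epsilon> f x = (\<integral>y. indicator (cube x (2 * s)) y *\<^sub>R (cutoff K \<epsilon> x y * f y)
      + indicator (- cube x (2 * s)) y *\<^sub>R (cutoff K \<delta> x y * f y) \<partial>\<mu>)"
    unfolding trunc_eq_cutoff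
  proof (intro Bochner_Integration.integral_cong refl)
    fix y
    show "cutoff K \<epsilon> x y * f y = indicator (cube x (2 * s)) y *\<^sub>R (cutoff K \<epsilon> x y * f y)
      + indicator (- cube x (2 * s)) y *\<^sub>R (cutoff K \<delta> x y * f y)"
    proof (cases "y \<in> cube x (2 * s)")
      case False
      then have "s < norm (x - y)"
        using infnorm_le_norm [of "y - x"] by (simp add: mem_cube_iff norm_minus_commute)
      then show ?thesis using False \<epsilon> by (simp add: cutoff_def)
    qed simp
  qed
  also have "\<dots> = (\<integral>y. indicator (cube x (2 * s)) y *\<^sub>R (cutoff K \<epsilon> x y * f y) \<partial>\<mu>)
    + (\<integral>y. indicator (- cube x (2 * s)) y *\<^sub>R (cutoff K \<delta> x y * f y) \<partial>\<mu>)"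
    by (intro Bochner_Integration.integral_add integrable_mult_indicator integrable_cutoff_mult \<epsilon> \<epsilon>0 f)
      (simp_all add: sets_borel)
  finally show ?thesis .
qed

text \<open>
  The scale is the smallest \<open>10 ^ k * (2 * \<epsilon>)\<close> that is either doubling, with the strict
  inequality that forces positive measure, or comparable to the side length \<open>l\<close>.
\<close>

lemma trunc_pointwise_bound:
  fixes f :: "real ^ 'd \<Rightarrow> complex"
  assumes p: "1 < p" "p \<le> 2" and q: "1 < q" "q \<le> 2" and B: "0 < B" and A: "0 < A"
    and b: "2 * 10 powr n \<le> b" and t: "160 \<le> t" and \<delta>: "0 < \<delta>" "\<delta> < \<epsilon>" and m: "0 \<le> m" and m': "0 \<le> m'"
    and l: "0 < l" and \<tau>: "0 < \<tau>" "\<tau> < 1" and x: "x \<in> cube c ((1 - \<tau>) * l)"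
    and adm: "admissible \<mu> p B (cube c l) f"
    and Fp: "\<And>r. 0 < r \<Longrightarrow> (\<integral>\<^sup>+y\<in>cube x r. ennreal (norm (f y) powr p) \<partial>\<mu>)
      \<le> ennreal (m powr p * measure \<mu> (cube x r))"
    and Tq: "\<And>r. 0 < r \<Longrightarrow> cube x r \<subseteq> cube c l \<Longrightarrow>
      (\<integral>\<^sup>+w\<in>cube x r. ennreal (norm (trunc K \<mu> \<delta> f w) powr conj_exp q) \<partial>\<mu>)
      \<le> ennreal (m' powr conj_exp q * measure \<mu> (cube x r))"
    and test: "\<And>z s. 0 < s \<Longrightarrow> cube z s \<subseteq> cube c l \<Longrightarrow> doubling \<mu> 5 b z s \<Longrightarrow> small_boundary \<mu> t z s \<Longrightarrow>
      \<exists>g. admissible \<mu> q B (cube z s) g \<and>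
       (if 1 / p + 1 / q < 1 + 1 / (n * p)
        then (\<integral>\<^sup>+y\<in>cube z s. ennreal (norm (trunc_adj K \<mu> \<delta> g y) powr conj_exp p) \<partial>\<mu>)
          \<le> ennreal A * emeasure \<mu> (cube z s)
        else (\<integral>\<^sup>+y\<in>cube z (2 * s). ennreal (norm (trunc_adj K \<mu> \<delta> g y) powr conj_exp p) \<partial>\<mu>)
          \<le> ennreal A * emeasure \<mu> (cube z s))"
  shows "norm (trunc K \<mu> \<epsilon> f x)
    \<le> (C\<^sub>K * (3 * 20 powr n * c\<^sub>0 + (2 / \<tau>) powr n * c\<^sub>0)
       + C\<^sub>K * (1 + (2 * real CARD('d)) powr n) * real CARD('d) powr \<alpha>
          * (c\<^sub>0 * 4 powr n / (1 - 2 powr (- \<alpha>))) * B powr (1 / q)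
       + B powr (1 / q) + dual_const (real CARD('d)) n c\<^sub>0 p q C\<^sub>K b B A) * (m + m')"
proof -
  define D where "D = 3 * 20 powr n * c\<^sub>0"
  define E where "E = (2 / \<tau>) powr n * c\<^sub>0"
  define G where "G = C\<^sub>K * (1 + (2 * real CARD('d)) powr n) * real CARD('d) powr \<alpha>
          * (c\<^sub>0 * 4 powr n / (1 - 2 powr (- \<alpha>))) * B powr (1 / q)"
  define H where "H = dual_const (real CARD('d)) n c\<^sub>0 p q C\<^sub>K b B A"
  have "2 powr (- \<alpha>) < 1" using \<alpha>_pos by (intro powr_less_one) auto
  then have nonneg: "0 \<le> D" "0 \<le> E" "0 \<le> G" "0 \<le> H" "0 \<le> B powr (1 / q)"
    using c\<^sub>0_pos C\<^sub>K_pos dual_const_nonneg [OF n_pos p(1) C\<^sub>K_pos] by (auto simp: D_def E_def G_def H_def)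
  have b0: "0 < b" using b powr_gt_zero [of 10 n] by linarith
  have \<epsilon>: "0 < \<epsilon>" using \<delta> by simp
  note fD = admissibleD [OF adm p(1) B]
  note f = fD(1)
  have f_meas [measurable]: "f \<in> borel_measurable borel"
    using f sets_borel by (metis borel_measurable_integrable measurable_cong_sets)
  have [measurable]: "f \<in> borel_measurable \<mu>" using f by auto
  have F1: "(\<integral>\<^sup>+y\<in>cube x r. ennreal (norm (f y)) \<partial>\<mu>) \<le> ennreal (m * measure \<mu> (cube x r))" if r: "0 < r" for r
  proof -
    have "(\<integral>\<^sup>+y\<in>cube x r. ennreal (norm (f y)) \<partial>\<mu>) \<le> ennreal m * emeasure \<mu> (cube x r)"
      by (rule set_nn_integral_le_of_powr [OF p(1)])
        (use Fp [OF r] emeasure_cube_finite [of x r] m in \<open>auto simp: emeasure_cube ennreal_mult'\<close>)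
    then show ?thesis using m by (simp add: emeasure_cube ennreal_mult')
  qed
  have xc: "infnorm (x - c) \<le> (1 - \<tau>) * l / 2" using x by (simp add: mem_cube_iff)
  \<comment> \<open>Starting at \<open>2 * \<epsilon>\<close> ensures \<open>\<delta> < s / 2\<close> for every side \<open>s\<close> that occurs below.\<close>
  define \<rho> where "\<rho> k = 10 ^ k * (2 * \<epsilon>)" for k :: nat
  have \<rho>_pos: "0 < \<rho> k" "2 * \<epsilon> \<le> \<rho> k" for k
    using \<epsilon> by (auto simp: \<rho>_def)
  define P where "P k \<longleftrightarrow> measure \<mu> (cube x (10 * \<rho> k)) < b * measure \<mu> (cube x (\<rho> k)) \<or> \<tau> * l \<le> 2 * \<rho> k" for k
  obtain k0 :: nat where "\<tau> * l / (4 * \<epsilon>) < 10 ^ k0" using real_arch_pow [of 10 "\<tau> * l / (4 * \<epsilon>)"] by auto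
  then have "P k0" using \<epsilon> by (simp add: P_def \<rho>_def field_simps)
  define k where "k = (LEAST k. P k)"
  have Pk: "P k" unfolding k_def by (rule LeastI [of P, OF \<open>P k0\<close>])
  have nd: "b * measure \<mu> (cube x (10 ^ j * (2 * \<epsilon>))) \<le> measure \<mu> (cube x (10 ^ Suc j * (2 * \<epsilon>)))"
    if "j < k" for j
  proof -
    have "\<not> P j" using that not_less_Least unfolding k_def by blast
    then show ?thesis by (simp add: P_def \<rho>_def not_less mult.assoc)
  qed
  have near: "(\<integral>\<^sup>+y\<in>{y \<in> cube x (10 * \<rho> k). \<epsilon> < norm (x - y)}.
      ennreal (norm (x - y) powr (- n) * norm (f y)) \<partial>\<mu>) \<le> ennreal (D * m)"
    unfolding D_def
    by (rule nn_integral_near_le [OF _ _ m F1 b \<epsilon> \<rho>_def nd]) auto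
  have Dm: "0 \<le> D * m" using nonneg m by simp
  have bound: "norm (trunc K \<mu> \<epsilon> f x) \<le> C\<^sub>K * (D + E) * m + G * m + H * m + B powr (1 / q) * m'"
  proof (cases "\<tau> * l \<le> 2 * \<rho> k")
    case True
    have "norm (trunc K \<mu> \<epsilon> f x) \<le> C\<^sub>K * (D * m + (2 / \<tau>) powr n * c\<^sub>0 * m)"
    proof (rule trunc_large_scale_le [OF \<epsilon> f m \<tau>(1) l F1 _ _ Dm near])
      show "\<tau> * l \<le> 5 * \<rho> k" using True \<rho>_pos(1) [of k] by linarith
      fix y assume y: "y \<notin> cube x (2 * l)"
      have "infnorm (y - x) \<le> infnorm (y - c) + infnorm (x - c)"
        using infnorm_triangle [of "y - c" "c - x"] infnorm_sub [of c x] by simp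
      moreover have "(1 - \<tau>) * l \<le> l" using \<tau> l by simp
      ultimately have "y \<notin> cube c l" using y xc by (auto simp: mem_cube_iff)
      then show "f y = 0" by (rule fD(2))
    qed
    then have "norm (trunc K \<mu> \<epsilon> f x) \<le> C\<^sub>K * (D + E) * m" by (simp add: E_def algebra_simps)
    moreover have "0 \<le> G * m" "0 \<le> H * m" "0 \<le> B powr (1 / q) * m'" using nonneg m m' by auto
    ultimately show ?thesis by linarith
  next
    case False
    then have dbl: "measure \<mu> (cube x (10 * \<rho> k)) < b * measure \<mu> (cube x (\<rho> k))"
      using Pk by (simp add: P_def)
    \<comment> \<open>As \<open>x\<close> lies in \<open>(1 - \<tau>)Q\<close>, the cubes of side less than \<open>\<tau> * l\<close> centred at \<open>x\<close> stay in \<open>Q\<close>.\<close>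
    have sub: "cube x s \<subseteq> cube c l" if "s \<in> {\<rho> k..2 * \<rho> k}" for s
    proof
      fix y assume "y \<in> cube x s"
      then have "infnorm (y - x) \<le> \<tau> * l / 2" using that False by (simp add: mem_cube_iff)
      moreover have "infnorm (y - c) \<le> infnorm (y - x) + infnorm (x - c)"
        using infnorm_triangle [of "y - x" "x - c"] by simp
      moreover have "\<tau> * l / 2 + (1 - \<tau>) * l / 2 = l / 2" by (simp add: field_simps)
      ultimately show "y \<in> cube c l" using xc by (simp add: mem_cube_iff)
    qed
    have pos: "0 < s" if "s \<in> {\<rho> k..2 * \<rho> k}" for s using that \<rho>_pos(1) [of k] by simp
    have "2 * \<delta> < \<rho> k" using \<delta> \<rho>_pos(2) [of k] by linarith
    then have "\<exists>s\<in>{\<rho> k..2 * \<rho> k}. norm (\<integral>y. indicator (- cube x (2 * s)) y *\<^sub>R (cutoff K \<delta> x y * f y) \<partial>\<mu>)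
      \<le> C\<^sub>K * (1 + (2 * real CARD('d)) powr n) * real CARD('d) powr \<alpha>
        * (c\<^sub>0 * 4 powr n / (1 - 2 powr (- \<alpha>)) * m) * B powr (1 / q)
      + B powr (1 / q) * m' + dual_const (real CARD('d)) n c\<^sub>0 p q C\<^sub>K b B A * m"
      by (intro doubling_cube_estimate [OF p q B A b0 t \<delta>(1) _ m m' f Fp F1 dbl])
        (use Tq test sub pos in blast)+
    then obtain s where s: "s \<in> {\<rho> k..2 * \<rho> k}"
      and far: "norm (\<integral>y. indicator (- cube x (2 * s)) y *\<^sub>R (cutoff K \<delta> x y * f y) \<partial>\<mu>)
        \<le> G * m + B powr (1 / q) * m' + H * m"
      by (auto simp: G_def H_def mult_ac)
    have "(\<integral>\<^sup>+y\<in>{y \<in> cube x (2 * s). \<epsilon> < norm (x - y)}. ennreal (norm (x - y) powr (- n) * norm (f y)) \<partial>\<mu>)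
        \<le> (\<integral>\<^sup>+y\<in>{y \<in> cube x (10 * \<rho> k). \<epsilon> < norm (x - y)}. ennreal (norm (x - y) powr (- n) * norm (f y)) \<partial>\<mu>)"
      using s \<rho>_pos(1) [of k] by (intro nn_integral_mono_set) (auto simp: mem_cube_iff)
    then have "norm (\<integral>y. indicator (cube x (2 * s)) y *\<^sub>R (cutoff K \<epsilon> x y * f y) \<partial>\<mu>) \<le> C\<^sub>K * (D * m)"
      using near Dm by (intro norm_integral_cutoff_le \<epsilon> f) auto
    moreover have "\<epsilon> \<le> s" using s \<rho>_pos(2) [of k] \<epsilon> by simp
    ultimately have "norm (trunc K \<mu> \<epsilon> f x) \<le> C\<^sub>K * (D * m) + (G * m + B powr (1 / q) * m' + H * m)"
      using far by (subst trunc_split_at_cube [OF \<delta> _ f]) (auto intro: norm_triangle_mono)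
    moreover have "C\<^sub>K * (D * m) \<le> C\<^sub>K * (D + E) * m"
      using nonneg m C\<^sub>K_pos by (simp add: algebra_simps)
    ultimately show ?thesis by linarith
  qed
  also have "\<dots> \<le> C\<^sub>K * (D + E) * (m + m') + G * (m + m') + H * (m + m') + B powr (1 / q) * (m + m')"
    using nonneg m m' C\<^sub>K_pos by (intro add_mono mult_left_mono) auto
  also have "\<dots> = (C\<^sub>K * (D + E) + G + B powr (1 / q) + H) * (m + m')" by (simp add: algebra_simps)
  finally show ?thesis unfolding D_def E_def G_def H_def .
qed

end

section \<open>The pointwise bound\<close>

theorem theorem3p1:
  shows "\<exists>b\<^sub>0 t\<^sub>0 :: real. \<forall>b\<ge>b\<^sub>0. \<forall>t\<ge>t\<^sub>0.
    \<forall>n p q \<alpha> C\<^sub>0 C\<^sub>K B\<^sub>1 A\<^sub>1 A\<^sub>2 \<tau> :: real.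
      0 < n \<and> n \<le> real CARD('d) \<and> 1 < p \<and> p \<le> 2 \<and> 1 < q \<and> q \<le> 2 \<and> 0 < \<alpha> \<and> \<alpha> \<le> 1 \<and>
      0 < C\<^sub>0 \<and> 0 < C\<^sub>K \<and> 0 < B\<^sub>1 \<and> 0 < A\<^sub>1 \<and> 0 < A\<^sub>2 \<and> 0 < \<tau> \<and> \<tau> < 1 \<longrightarrow>
      (\<exists>C>0. \<forall>(\<mu> :: (real ^ 'd) measure) (K :: real ^ 'd \<Rightarrow> real ^ 'd \<Rightarrow> complex)
          (c :: real ^ 'd) (l :: real) (\<delta> :: real) (b\<^sub>Q :: real ^ 'd \<Rightarrow> complex).
        of_order n C\<^sub>0 \<mu> \<and> cz_kernel n C\<^sub>K \<alpha> K \<and> 0 < l \<and> 0 < \<delta> \<and>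
        admissible \<mu> p B\<^sub>1 (cube c l) b\<^sub>Q \<and>
        (\<integral>\<^sup>+x\<in>cube c l. ennreal (norm (trunc K \<mu> \<delta> b\<^sub>Q x) powr conj_exp q) \<partial>\<mu>)
          \<le> ennreal A\<^sub>1 * emeasure \<mu> (cube c l) \<and>
        (\<forall>z s. 0 < s \<and> cube z s \<subseteq> cube c l \<and> doubling \<mu> 5 b z s \<and> small_boundary \<mu> t z s \<longrightarrow>
          (\<exists>p\<^sub>R. admissible \<mu> q B\<^sub>1 (cube z s) p\<^sub>R \<and>
            (if 1 / p + 1 / q < 1 + 1 / (n * p)
             then (\<integral>\<^sup>+x\<in>cube z s. ennreal (norm (trunc_adj K \<mu> \<delta> p\<^sub>R x) powr conj_exp p) \<partial>\<mu>)
                    \<le> ennreal A\<^sub>2 * emeasure \<mu> (cube z s)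
             else (\<integral>\<^sup>+x\<in>cube z (2 * s). ennreal (norm (trunc_adj K \<mu> \<delta> p\<^sub>R x) powr conj_exp p) \<partial>\<mu>)
                    \<le> ennreal A\<^sub>2 * emeasure \<mu> (cube z s))))
        \<longrightarrow>
        (\<forall>\<epsilon>>\<delta>. \<forall>x\<in>cube c ((1 - \<tau>) * l).
          ennreal (norm (trunc K \<mu> \<epsilon> b\<^sub>Q x))
            \<le> ennreal C * (max_ball \<mu> b\<^sub>Q x + max_cube_powr \<mu> p b\<^sub>Q x
                + max_cube_powr \<mu> (conj_exp q)
                    (\<lambda>y. indicator (cube c l) y *\<^sub>R trunc K \<mu> \<delta> b\<^sub>Q y) x)))"
proof (rule exI [of _ "2 * 10 powr real CARD('d)"], rule exI [of _ 160], intro allI impI, elim conjE)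
  fix b t n p q \<alpha> C\<^sub>0 C\<^sub>K B\<^sub>1 A\<^sub>1 A\<^sub>2 \<tau> :: real
  assume b: "2 * 10 powr real CARD('d) \<le> b" and t: "160 \<le> t"
    and n: "0 < n" "n \<le> real CARD('d)" and p: "1 < p" "p \<le> 2" and q: "1 < q" "q \<le> 2"
    and \<alpha>: "0 < \<alpha>" "\<alpha> \<le> 1" and C\<^sub>0: "0 < C\<^sub>0" and C\<^sub>K: "0 < C\<^sub>K" and B\<^sub>1: "0 < B\<^sub>1"
    and A\<^sub>1: "0 < A\<^sub>1" and A\<^sub>2: "0 < A\<^sub>2" and \<tau>: "0 < \<tau>" "\<tau> < 1"
  define c\<^sub>0 where "c\<^sub>0 = C\<^sub>0 * real CARD('d) powr n"
  define C where "C = C\<^sub>K * (3 * 20 powr n * c\<^sub>0 + (2 / \<tau>) powr n * c\<^sub>0)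
       + C\<^sub>K * (1 + (2 * real CARD('d)) powr n) * real CARD('d) powr \<alpha>
          * (c\<^sub>0 * 4 powr n / (1 - 2 powr (- \<alpha>))) * B\<^sub>1 powr (1 / q)
       + B\<^sub>1 powr (1 / q) + dual_const (real CARD('d)) n c\<^sub>0 p q C\<^sub>K b B\<^sub>1 A\<^sub>2"
  have c\<^sub>0: "0 < c\<^sub>0" using C\<^sub>0 by (simp add: c\<^sub>0_def)
  \<comment> \<open>This is where \<open>n \<le> d\<close> makes the threshold for \<open>b\<close> independent of \<open>n\<close>.\<close>
  have bn: "2 * 10 powr n \<le> b"
  proof -
    have "(10::real) powr n \<le> 10 powr real CARD('d)" using n by (intro powr_mono) auto
    then show ?thesis using b by linarith
  qed
  have C: "0 < C"
  proof -
    have "2 powr (- \<alpha>) < 1" using \<alpha> by (intro powr_less_one) auto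
    then have "0 \<le> C\<^sub>K * (1 + (2 * real CARD('d)) powr n) * real CARD('d) powr \<alpha>
          * (c\<^sub>0 * 4 powr n / (1 - 2 powr (- \<alpha>))) * B\<^sub>1 powr (1 / q)"
      using C\<^sub>K c\<^sub>0 by (intro mult_nonneg_nonneg divide_nonneg_nonneg add_nonneg_nonneg) auto
    moreover have "0 \<le> C\<^sub>K * (3 * 20 powr n * c\<^sub>0 + (2 / \<tau>) powr n * c\<^sub>0)"
      using C\<^sub>K c\<^sub>0 by (intro mult_nonneg_nonneg add_nonneg_nonneg) auto
    moreover have "0 < B\<^sub>1 powr (1 / q)" using B\<^sub>1 by simp
    moreover have "0 \<le> dual_const (real CARD('d)) n c\<^sub>0 p q C\<^sub>K b B\<^sub>1 A\<^sub>2"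
      using n p C\<^sub>K by (intro dual_const_nonneg)
    ultimately show ?thesis unfolding C_def by linarith
  qed
  let ?claim = "\<lambda>C (\<mu> :: (real ^ 'd) measure) K c l \<delta> b\<^sub>Q \<epsilon> x.
      ennreal (norm (trunc K \<mu> \<epsilon> b\<^sub>Q x))
            \<le> ennreal C * (max_ball \<mu> b\<^sub>Q x + max_cube_powr \<mu> p b\<^sub>Q x
                + max_cube_powr \<mu> (conj_exp q)
                    (\<lambda>y. indicator (cube c l) y *\<^sub>R trunc K \<mu> \<delta> b\<^sub>Q y) x)"
  have main: "?claim C \<mu> K c l \<delta> b\<^sub>Q \<epsilon> x"
    if ord: "of_order n C\<^sub>0 \<mu>" and K: "cz_kernel n C\<^sub>K \<alpha> K" and l: "0 < l" and \<delta>: "0 < \<delta>"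
      and adm: "admissible \<mu> p B\<^sub>1 (cube c l) b\<^sub>Q"
      and test: "\<forall>z s. 0 < s \<and> cube z s \<subseteq> cube c l \<and> doubling \<mu> 5 b z s \<and> small_boundary \<mu> t z s \<longrightarrow>
          (\<exists>p\<^sub>R. admissible \<mu> q B\<^sub>1 (cube z s) p\<^sub>R \<and>
            (if 1 / p + 1 / q < 1 + 1 / (n * p)
             then (\<integral>\<^sup>+x\<in>cube z s. ennreal (norm (trunc_adj K \<mu> \<delta> p\<^sub>R x) powr conj_exp p) \<partial>\<mu>)
                    \<le> ennreal A\<^sub>2 * emeasure \<mu> (cube z s)
             else (\<integral>\<^sup>+x\<in>cube z (2 * s). ennreal (norm (trunc_adj K \<mu> \<delta> p\<^sub>R x) powr conj_exp p) \<partial>\<mu>)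
                    \<le> ennreal A\<^sub>2 * emeasure \<mu> (cube z s)))"
      and \<epsilon>: "\<delta> < \<epsilon>" and x: "x \<in> cube c ((1 - \<tau>) * l)"
    for \<mu> :: "(real ^ 'd) measure" and K c l \<delta> b\<^sub>Q \<epsilon> x
  proof -
    interpret growth_measure \<mu> n c\<^sub>0
      unfolding c\<^sub>0_def by (rule growth_measure_of_order [OF ord n(1) C\<^sub>0])
    interpret cz_growth \<mu> n c\<^sub>0 K C\<^sub>K \<alpha>
      by standard (use K \<alpha> C\<^sub>K in auto)
    define M where "M = max_cube_powr \<mu> p b\<^sub>Q x"
    define M' where "M' = max_cube_powr \<mu> (conj_exp q) (\<lambda>y. indicator (cube c l) y *\<^sub>R trunc K \<mu> \<delta> b\<^sub>Q y) x"
    show ?thesis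
    proof (cases "M = \<infinity> \<or> M' = \<infinity>")
      case True
      then have "ennreal C * (max_ball \<mu> b\<^sub>Q x + M + M') = \<infinity>"
        using C by (auto simp: ennreal_mult_top)
      then show ?thesis by (simp add: M_def M'_def)
    next
      case False
      then obtain m m' where m: "0 \<le> m" "M = ennreal m" and m': "0 \<le> m'" "M' = ennreal m'"
        by (cases M; cases M') auto
      have q': "0 < conj_exp q" using conj_exp_conjugate(1) [OF q(1)] by simp
      have "norm (trunc K \<mu> \<epsilon> b\<^sub>Q x) \<le> C * (m + m')"
        unfolding C_def
      proof (rule trunc_pointwise_bound [OF p q B\<^sub>1 A\<^sub>2 bn t \<delta> \<epsilon> m(1) m'(1) l \<tau> x adm])
        show "(\<integral>\<^sup>+y\<in>cube x r. ennreal (norm (b\<^sub>Q y) powr p) \<partial>\<mu>) \<le> ennreal (m powr p * measure \<mu> (cube x r))"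
          if "0 < r" for r
          using m p that by (intro nn_integral_le_of_max_cube_powr) (auto simp: M_def)
        show "(\<integral>\<^sup>+w\<in>cube x r. ennreal (norm (trunc K \<mu> \<delta> b\<^sub>Q w) powr conj_exp q) \<partial>\<mu>)
          \<le> ennreal (m' powr conj_exp q * measure \<mu> (cube x r))" if r: "0 < r" "cube x r \<subseteq> cube c l" for r
        proof -
          have "(\<integral>\<^sup>+w\<in>cube x r. ennreal (norm (trunc K \<mu> \<delta> b\<^sub>Q w) powr conj_exp q) \<partial>\<mu>)
            = (\<integral>\<^sup>+w\<in>cube x r. ennreal (norm (indicator (cube c l) w *\<^sub>R trunc K \<mu> \<delta> b\<^sub>Q w) powr conj_exp q) \<partial>\<mu>)"
            using r(2) by (intro nn_integral_cong) (auto simp: indicator_def)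
          also have "\<dots> \<le> ennreal (m' powr conj_exp q * measure \<mu> (cube x r))"
            using m' q' r(1) by (intro nn_integral_le_of_max_cube_powr) (auto simp: M'_def)
          finally show ?thesis .
        qed
      qed (use test in blast)
      then have "ennreal (norm (trunc K \<mu> \<epsilon> b\<^sub>Q x)) \<le> ennreal (C * (m + m'))" by (rule ennreal_leI)
      also have "\<dots> = ennreal C * (M + M')"
        using C m m' by (simp add: ennreal_mult')
      also have "\<dots> \<le> ennreal C * (max_ball \<mu> b\<^sub>Q x + M + M')"
        by (intro mult_left_mono add_right_mono) auto
      finally show ?thesis by (simp add: M_def M'_def)
    qed
  qed
  show "\<exists>C>0. \<forall>(\<mu> :: (real ^ 'd) measure) (K :: real ^ 'd \<Rightarrow> real ^ 'd \<Rightarrow> complex)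
          (c :: real ^ 'd) (l :: real) (\<delta> :: real) (b\<^sub>Q :: real ^ 'd \<Rightarrow> complex).
        of_order n C\<^sub>0 \<mu> \<and> cz_kernel n C\<^sub>K \<alpha> K \<and> 0 < l \<and> 0 < \<delta> \<and>
        admissible \<mu> p B\<^sub>1 (cube c l) b\<^sub>Q \<and>
        (\<integral>\<^sup>+x\<in>cube c l. ennreal (norm (trunc K \<mu> \<delta> b\<^sub>Q x) powr conj_exp q) \<partial>\<mu>)
          \<le> ennreal A\<^sub>1 * emeasure \<mu> (cube c l) \<and>
        (\<forall>z s. 0 < s \<and> cube z s \<subseteq> cube c l \<and> doubling \<mu> 5 b z s \<and> small_boundary \<mu> t z s \<longrightarrow>
          (\<exists>p\<^sub>R. admissible \<mu> q B\<^sub>1 (cube z s) p\<^sub>R \<and>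
            (if 1 / p + 1 / q < 1 + 1 / (n * p)
             then (\<integral>\<^sup>+x\<in>cube z s. ennreal (norm (trunc_adj K \<mu> \<delta> p\<^sub>R x) powr conj_exp p) \<partial>\<mu>)
                    \<le> ennreal A\<^sub>2 * emeasure \<mu> (cube z s)
             else (\<integral>\<^sup>+x\<in>cube z (2 * s). ennreal (norm (trunc_adj K \<mu> \<delta> p\<^sub>R x) powr conj_exp p) \<partial>\<mu>)
                    \<le> ennreal A\<^sub>2 * emeasure \<mu> (cube z s))))
        \<longrightarrow> (\<forall>\<epsilon>>\<delta>. \<forall>x\<in>cube c ((1 - \<tau>) * l). ?claim C \<mu> K c l \<delta> b\<^sub>Q \<epsilon> x)"
  proof (rule exI [of _ C], rule conjI [OF C], intro allI impI ballI, goal_cases)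
    case 1
    show ?case by (rule main) (insert 1, elim conjE, assumption)+
  qed
qed

end
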